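(* Let $M$ be a compact manifold with corners with embedded faces, and let $X_M\supset M$ be the manifold with corners constructed from $M$ in the context, with $M$ identified with its image $\Psi(M)$. Then $X_M$ is a classifying space for $M$; that is, the inclusion $\iota:M\to X_M$ is a closed embedding of manifolds with corners such that (i) each open face of $X_M$ is diffeomorphic to a Euclidean space, and (ii) $F\mapsto F\cap M$ induces a bijection between the set of open faces of $X_M$ and the set of open faces of $M$.
   Context: A manifold with corners is locally modeled on $[0,\infty)^k\times\mathbb R^{n-k}$; a point corresponding to $0$ in such a chart has depth $k$. An open face of codimension $k$ is a connected component of the set of points of depth $k$ (codimension $0$ included); a face is the closure of an open face; a hyperface is a face of codimension $1$. A manifold with corners has embedded faces if each hyperface $H$ has a defining function $\rho:M\to[0,\infty)$ (smooth, $\rho^{-1}(0)=H$, $d\rho\neq0$ on $H$). A closed embedding $f:M\to X$ of manifolds with corners is a smooth injective map with closed range such that $df$ is injective, $f(M)$ is transverse to each open face $F$ of $X$ (i.e. $df(T_xM)+T_{f(x)}F=T_{f(x)}X$ whenever $f(x)\in F$), and each hyperface of $M$ is a connected component of the inverse image of a hyperface of $X$. Construction of $X_M$ (it depends on choices). Let $H_1,\dots,H_r$ be the hyperfaces of $M$, fix a defining function $\rho_i$ of each $H_i$, and fix an embedding $\phi:M\to\mathbb R^N$ for some $N$. For $J\subset\{1,\dots,r\}$ put $F_J=\bigcap_{j\in J}H_j$. Let $\mathcal J$ be the set of nonempty $J\subset\{1,\dots,r\}$ with $F_J\neq\emptyset$, and let $l=|\mathcal J|$. For $J\in\mathcal J$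 let $n_J$ be the number of connected components of $F_J$, choose a continuous function $f_J:F_J\to\{1,\dots,n_J\}$ taking different values on different connected components of $F_J$, and extend it to a smooth function $f_J:M\to\mathbb R$. Define $$\Psi=(\phi,\rho_1,\dots,\rho_r,(f_J)_{J\in\mathcal J}):M\to X_0:=\mathbb R^N\times[0,\infty)^r\times\mathbb R^l .$$ Write points of $X_0$ as $(z,x_1,\dots,x_r,(y_J)_{J\in\mathcal J})$. For $J\in\mathcal J$ let $$Y_J=\{(z,x_1,\dots,x_r,(y_{J'})_{J'\in\mathcal J})\in X_0:\ y_J-\tfrac12\in\mathbb Z\ \text{and}\ x_j=0\ \text{for all } j\in J\},$$ a closed subset of $X_0$ with $\Psi(M)\cap Y_J=\emptyset$. Let $X_1=X_0\smallsetminus\bigcup_{J\in\mathcal J}Y_J$. Finally, $X_M$ is obtained from $X_1$ by removing all the faces that do not intersect $M$: $$X_M=X_1\smallsetminus\bigcup F,\qquad F\subset X_1\ \text{a face with}\ F\cap\Psi(M)=\emptyset .$$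
   Formalization: M is additionally assumed connected: since only nonempty J are used, the codimension-0 part of X_M is connected, so (ii) fails for every disconnected M (e.g. M two points, where X_M = R^N has one open face and M has two). *)

theory Defs
  imports "HOL-Analysis.Analysis"
begin

section \<open>Coordinate spaces and smooth functions on them\<close>

text \<open>For a finite index set \<open>I\<close>, the space \<open>\<real>\<^sup>I\<close> is realised as the functions that vanish
  off \<open>I\<close>, with the product topology; this allows the dimension to be a term rather than a type.
  \<open>corner I K\<close> is \<open>[0,\<infinity>)\<^sup>K \<times> \<real>\<^sup>I\<^sup>-\<^sup>K\<close>.\<close>

definition coord_space :: "'i set \<Rightarrow> ('i \<Rightarrow> real) set" where
  "coord_space I = {x. \<forall>i. i \<notin> I \<longrightarrow> x i = 0}"

definition corner :: "'i set \<Rightarrow> 'i set \<Rightarrow> ('i \<Rightarrow> real) set" where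
  "corner I K = {x \<in> coord_space I. \<forall>i\<in>K. 0 \<le> x i}"

text \<open>The derivative is taken within \<open>S\<close>, so it is two-sided when \<open>S\<close> is open in \<open>\<real>\<^sup>I\<close> and one-sided
  in the boundary directions when \<open>S\<close> is open in a corner and the point lies on its boundary.\<close>

definition coord_deriv :: "('i \<Rightarrow> real) set \<Rightarrow> 'i \<Rightarrow> (('i \<Rightarrow> real) \<Rightarrow> real) \<Rightarrow> ('i \<Rightarrow> real) \<Rightarrow> real" where
  "coord_deriv S i g x = vector_derivative (\<lambda>t. g (x(i := t))) (at (x i) within {t. x(i := t) \<in> S})"

primrec Ck_on :: "nat \<Rightarrow> 'i set \<Rightarrow> ('i \<Rightarrow> real) set \<Rightarrow> (('i \<Rightarrow> real) \<Rightarrow> real) \<Rightarrow> bool" where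
  "Ck_on 0 I U g \<longleftrightarrow> continuous_on U g"
| "Ck_on (Suc m) I U g \<longleftrightarrow> continuous_on U g \<and>
     (\<forall>i\<in>I. (\<forall>x\<in>U. (\<lambda>t. g (x(i := t))) differentiable (at (x i) within {t. x(i := t) \<in> U})) \<and>
             Ck_on m I U (coord_deriv U i g))"

text \<open>On a subset of \<open>\<real>\<^sup>I\<close> that need not be open, smoothness means local extendability to a
  \<open>C\<^sup>\<infinity>\<close> function on an open subset of \<open>\<real>\<^sup>I\<close>.\<close>

definition smooth_on :: "'i set \<Rightarrow> ('i \<Rightarrow> real) set \<Rightarrow> (('i \<Rightarrow> real) \<Rightarrow> real) \<Rightarrow> bool" where
  "smooth_on I S g \<longleftrightarrow>
     (\<forall>x\<in>S. \<exists>U h. openin (top_of_set (coord_space I)) U \<and> x \<in> U \<and>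
        (\<forall>m. Ck_on m I U h) \<and> (\<forall>y\<in>S \<inter> U. h y = g y))"

section \<open>Manifolds with corners\<close>

text \<open>A chart \<open>(I, K, U, \<phi>)\<close> maps the open set \<open>U\<close> onto an open subset of \<open>corner I K\<close>.\<close>

type_synonym ('a, 'i) chart = "'i set \<times> 'i set \<times> 'a set \<times> ('a \<Rightarrow> 'i \<Rightarrow> real)"

record ('a, 'i) manifold =
  mtop :: "'a topology"
  mdim :: nat
  matlas :: "('a, 'i) chart set"

abbreviation mcarrier :: "('a, 'i, 'z) manifold_scheme \<Rightarrow> 'a set" where
  "mcarrier M \<equiv> topspace (mtop M)"

fun is_chart :: "'a topology \<Rightarrow> nat \<Rightarrow> ('a, 'i) chart \<Rightarrow> bool" where
  "is_chart T n (I, K, U, \<phi>) \<longleftrightarrow>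
     finite I \<and> card I = n \<and> K \<subseteq> I \<and> openin T U \<and>
     openin (top_of_set (corner I K)) (\<phi> ` U) \<and>
     homeomorphic_map (subtopology T U) (top_of_set (\<phi> ` U)) \<phi>"

fun smooth_transition :: "('a, 'i) chart \<Rightarrow> ('a, 'i) chart \<Rightarrow> bool" where
  "smooth_transition (I, K, U, \<phi>) (I', K', U', \<phi>') \<longleftrightarrow>
     (\<forall>j\<in>I'. smooth_on I (\<phi> ` (U \<inter> U')) (\<lambda>x. \<phi>' (inv_into U \<phi> x) j))"

definition compatible :: "('a, 'i) chart \<Rightarrow> ('a, 'i) chart \<Rightarrow> bool" where
  "compatible c d \<longleftrightarrow> smooth_transition c d \<and> smooth_transition d c"

definition manifold_with_corners :: "('a, 'i) manifold \<Rightarrow> bool" where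
  "manifold_with_corners M \<longleftrightarrow>
     Hausdorff_space (mtop M) \<and> second_countable (mtop M) \<and>
     (\<forall>c\<in>matlas M. is_chart (mtop M) (mdim M) c) \<and>
     (\<forall>c\<in>matlas M. \<forall>d\<in>matlas M. compatible c d) \<and>
     (\<Union>(I, K, U, \<phi>)\<in>matlas M. U) = mcarrier M"

text \<open>The maximal atlas generated by the given one.\<close>

definition charts :: "('a, 'i) manifold \<Rightarrow> ('a, 'i) chart set" where
  "charts M = {c. is_chart (mtop M) (mdim M) c \<and> (\<forall>d\<in>matlas M. compatible c d)}"

definition charts_at :: "('a, 'i) manifold \<Rightarrow> 'a \<Rightarrow> ('a, 'i) chart set" where
  "charts_at M p = {(I, K, U, \<phi>). (I, K, U, \<phi>) \<in> charts M \<and> p \<in> U}"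

text \<open>\<open>model_manifold I K\<close> is \<open>[0,\<infinity>)\<^sup>K \<times> \<real>\<^sup>I\<^sup>-\<^sup>K\<close> with the identity as a global chart.\<close>

definition model_manifold :: "'i set \<Rightarrow> 'i set \<Rightarrow> ('i \<Rightarrow> real, 'i) manifold" where
  "model_manifold I K =
     \<lparr>mtop = top_of_set (corner I K), mdim = card I, matlas = {(I, K, corner I K, \<lambda>x. x)}\<rparr>"

abbreviation euclidean_manifold :: "nat \<Rightarrow> (nat \<Rightarrow> real, nat) manifold" where
  "euclidean_manifold n \<equiv> model_manifold {..<n} {}"

lemma mtop_euclidean_manifold: "mtop (euclidean_manifold n) = Euclidean_space n"
proof -
  have "corner {..<n} {} = {x :: nat \<Rightarrow> real. \<forall>i\<ge>n. x i = 0}"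
    by (auto simp: corner_def coord_space_def not_less)
  then show ?thesis
    by (simp add: model_manifold_def Euclidean_space_def euclidean_product_topology)
qed

definition submanifold_on :: "('a, 'i) manifold \<Rightarrow> 'a set \<Rightarrow> ('a, 'i) manifold" where
  "submanifold_on M S =
     \<lparr>mtop = subtopology (mtop M) S, mdim = mdim M,
      matlas = {(I, K, U \<inter> S, \<phi>) | I K U \<phi>. (I, K, U, \<phi>) \<in> matlas M}\<rparr>"

section \<open>Smooth maps\<close>

definition smooth_fun :: "('a, 'i) manifold \<Rightarrow> ('a \<Rightarrow> real) \<Rightarrow> bool" where
  "smooth_fun M g \<longleftrightarrow>
     (\<forall>(I, K, U, \<phi>)\<in>matlas M. smooth_on I (\<phi> ` U) (\<lambda>x. g (inv_into U \<phi> x)))"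

definition smooth_map :: "('a, 'i) manifold \<Rightarrow> ('b, 'j) manifold \<Rightarrow> ('a \<Rightarrow> 'b) \<Rightarrow> bool" where
  "smooth_map M X f \<longleftrightarrow>
     continuous_map (mtop M) (mtop X) f \<and>
     (\<forall>(I, K, U, \<phi>)\<in>matlas M. \<forall>(J, L, V, \<psi>)\<in>matlas X. \<forall>j\<in>J.
        smooth_on I (\<phi> ` {p \<in> U. f p \<in> V}) (\<lambda>x. \<psi> (f (inv_into U \<phi> x)) j))"

definition diffeomorphic :: "('a, 'i) manifold \<Rightarrow> ('b, 'j) manifold \<Rightarrow> bool" where
  "diffeomorphic M X \<longleftrightarrow>
     (\<exists>f g. smooth_map M X f \<and> smooth_map X M g \<and>
        (\<forall>p\<in>mcarrier M. g (f p) = p) \<and> (\<forall>q\<in>mcarrier X. f (g q) = q))"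

section \<open>Tangent spaces and differentials\<close>

text \<open>The derivative of \<open>g\<close> at \<open>p\<close> in the direction that has components \<open>w\<close> in the given chart.
  Only the values of \<open>g\<close> near \<open>p\<close> matter.\<close>

fun chart_deriv :: "('a, 'i) chart \<Rightarrow> ('a \<Rightarrow> real) \<Rightarrow> 'a \<Rightarrow> ('i \<Rightarrow> real) \<Rightarrow> real" where
  "chart_deriv (I, K, U, \<phi>) g p w =
     (\<Sum>i\<in>I. w i * coord_deriv (\<phi> ` U) i (\<lambda>x. g (inv_into U \<phi> x)) (\<phi> p))"

text \<open>A tangent vector at \<open>p\<close> assigns to each chart around \<open>p\<close> its vector of components, subject to
  the transformation rule given by the Jacobians of the transition maps. At boundary points this is
  the full tangent space, of dimension \<open>mdim M\<close>, not just the cone of inward-pointing vectors.\<close>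

definition tangent_space :: "('a, 'i) manifold \<Rightarrow> 'a \<Rightarrow> (('a, 'i) chart \<Rightarrow> 'i \<Rightarrow> real) set" where
  "tangent_space M p =
     {v. (\<forall>c. c \<notin> charts_at M p \<longrightarrow> v c = (\<lambda>_. 0)) \<and>
         (\<forall>(I, K, U, \<phi>)\<in>charts_at M p. v (I, K, U, \<phi>) \<in> coord_space I) \<and>
         (\<forall>c\<in>charts_at M p. \<forall>(J, L, V, \<psi>)\<in>charts_at M p. \<forall>j\<in>J.
            v (J, L, V, \<psi>) j = chart_deriv c (\<lambda>q. \<psi> q j) p (v c))}"

text \<open>By the transformation rule the value does not depend on the chart that is selected.\<close>

definition fun_differential ::
    "('a, 'i) manifold \<Rightarrow> ('a \<Rightarrow> real) \<Rightarrow> 'a \<Rightarrow> (('a, 'i) chart \<Rightarrow> 'i \<Rightarrow> real) \<Rightarrow> real" where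
  "fun_differential M g p v = (let c = (SOME c. c \<in> charts_at M p) in chart_deriv c g p (v c))"

definition map_differential ::
    "('a, 'i) manifold \<Rightarrow> ('b, 'j) manifold \<Rightarrow> ('a \<Rightarrow> 'b) \<Rightarrow> 'a \<Rightarrow>
     (('a, 'i) chart \<Rightarrow> 'i \<Rightarrow> real) \<Rightarrow> (('b, 'j) chart \<Rightarrow> 'j \<Rightarrow> real)" where
  "map_differential M X f p v =
     (\<lambda>(J, L, V, \<psi>) j. if (J, L, V, \<psi>) \<in> charts_at X (f p) \<and> j \<in> J
        then fun_differential M (\<lambda>q. \<psi> (f q) j) p v else 0)"

definition immersion :: "('a, 'i) manifold \<Rightarrow> ('b, 'j) manifold \<Rightarrow> ('a \<Rightarrow> 'b) \<Rightarrow> bool" where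
  "immersion M X f \<longleftrightarrow> smooth_map M X f \<and>
     (\<forall>p\<in>mcarrier M. inj_on (map_differential M X f p) (tangent_space M p))"

definition smooth_embedding :: "('a, 'i) manifold \<Rightarrow> ('b, 'j) manifold \<Rightarrow> ('a \<Rightarrow> 'b) \<Rightarrow> bool" where
  "smooth_embedding M X f \<longleftrightarrow> immersion M X f \<and> embedding_map (mtop M) (mtop X) f"

section \<open>Faces\<close>

definition has_depth :: "('a, 'i) manifold \<Rightarrow> 'a \<Rightarrow> nat \<Rightarrow> bool" where
  "has_depth M p k \<longleftrightarrow>
     (\<exists>(I, K, U, \<phi>)\<in>charts_at M p. \<phi> p = (\<lambda>_. 0) \<and> card K = k)"

definition open_faces_of_codim :: "('a, 'i) manifold \<Rightarrow> nat \<Rightarrow> 'a set set" where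
  "open_faces_of_codim M k =
     connected_components_of (subtopology (mtop M) {p \<in> mcarrier M. has_depth M p k})"

definition open_faces :: "('a, 'i) manifold \<Rightarrow> 'a set set" where
  "open_faces M = (\<Union>k. open_faces_of_codim M k)"

definition faces :: "('a, 'i) manifold \<Rightarrow> 'a set set" where
  "faces M = (\<lambda>F. mtop M closure_of F) ` open_faces M"

definition hyperfaces :: "('a, 'i) manifold \<Rightarrow> 'a set set" where
  "hyperfaces M = (\<lambda>F. mtop M closure_of F) ` open_faces_of_codim M 1"

text \<open>The manifold structure of an open face \<open>F\<close> of codimension \<open>k\<close>. In a chart \<open>(I, K, U, \<phi>)\<close> of
  \<open>M\<close> with \<open>card K = k\<close>, the points of depth \<open>k\<close> are those at which all coordinates in \<open>K\<close> vanish,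
  so that \<open>\<phi>\<close> maps \<open>U \<inter> F\<close> to an open subset of \<open>\<real>\<^sup>I\<^sup>-\<^sup>K\<close>.\<close>

definition open_face_manifold :: "('a, 'i) manifold \<Rightarrow> nat \<Rightarrow> 'a set \<Rightarrow> ('a, 'i) manifold" where
  "open_face_manifold M k F =
     \<lparr>mtop = subtopology (mtop M) F, mdim = mdim M - k,
      matlas = {(I - K, {}, U \<inter> F, \<phi>) | I K U \<phi>. (I, K, U, \<phi>) \<in> charts M \<and> card K = k}\<rparr>"

definition defining_function :: "('a, 'i) manifold \<Rightarrow> 'a set \<Rightarrow> ('a \<Rightarrow> real) \<Rightarrow> bool" where
  "defining_function M H \<rho> \<longleftrightarrow>
     smooth_fun M \<rho> \<and> (\<forall>p\<in>mcarrier M. 0 \<le> \<rho> p) \<and> {p \<in> mcarrier M. \<rho> p = 0} = H \<and>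
     (\<forall>p\<in>H. \<exists>v\<in>tangent_space M p. fun_differential M \<rho> p v \<noteq> 0)"

definition has_embedded_faces :: "('a, 'i) manifold \<Rightarrow> bool" where
  "has_embedded_faces M \<longleftrightarrow> (\<forall>H\<in>hyperfaces M. \<exists>\<rho>. defining_function M H \<rho>)"

section \<open>Closed embeddings and classifying spaces\<close>

text \<open>The tangent space of \<open>F\<close> is regarded as a subspace of that of \<open>X\<close> by means of the differential
  of the inclusion.\<close>

definition transverse_to_face ::
    "('a, 'i) manifold \<Rightarrow> ('b, 'j) manifold \<Rightarrow> ('a \<Rightarrow> 'b) \<Rightarrow> nat \<Rightarrow> 'b set \<Rightarrow> bool" where
  "transverse_to_face M X f k F \<longleftrightarrow>
     (\<forall>p\<in>mcarrier M. f p \<in> F \<longrightarrow>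
        {\<lambda>c j. map_differential M X f p v c j
              + map_differential (open_face_manifold X k F) X (\<lambda>q. q) (f p) u c j | v u.
           v \<in> tangent_space M p \<and> u \<in> tangent_space (open_face_manifold X k F) (f p)}
        = tangent_space X (f p))"

definition closed_embedding :: "('a, 'i) manifold \<Rightarrow> ('b, 'j) manifold \<Rightarrow> ('a \<Rightarrow> 'b) \<Rightarrow> bool" where
  "closed_embedding M X f \<longleftrightarrow>
     immersion M X f \<and> inj_on f (mcarrier M) \<and> closedin (mtop X) (f ` mcarrier M) \<and>
     (\<forall>k. \<forall>F\<in>open_faces_of_codim X k. transverse_to_face M X f k F) \<and>
     (\<forall>H\<in>hyperfaces M. \<exists>H'\<in>hyperfaces X.
        H \<in> connected_components_of (subtopology (mtop M) {p \<in> mcarrier M. f p \<in> H'}))"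

text \<open>With \<open>M\<close> identified with its image under \<open>\<iota>\<close>, the preimage in the last clause is \<open>F \<inter> M\<close>.\<close>

definition classifying_space :: "('a, 'i) manifold \<Rightarrow> ('b, 'j) manifold \<Rightarrow> ('a \<Rightarrow> 'b) \<Rightarrow> bool" where
  "classifying_space M X \<iota> \<longleftrightarrow>
     closed_embedding M X \<iota> \<and>
     (\<forall>k. \<forall>F\<in>open_faces_of_codim X k.
        \<exists>m. diffeomorphic (open_face_manifold X k F) (euclidean_manifold m)) \<and>
     bij_betw (\<lambda>F. {p \<in> mcarrier M. \<iota> p \<in> F}) (open_faces X) (open_faces M)"

section \<open>The construction\<close>

text \<open>Since the empty set is not an index, no coordinate \<open>y\<^sub>J\<close> separates the components of \<open>M\<close>
  itself, and the interior of \<open>X\<^sub>M\<close> is connected whenever \<open>M\<close> is nonempty. The construction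
  therefore yields a classifying space only for connected \<open>M\<close>.\<close>

definition face_indices :: "nat \<Rightarrow> (nat \<Rightarrow> 'a set) \<Rightarrow> nat set set" where
  "face_indices r H = {J. J \<subseteq> {1..r} \<and> J \<noteq> {} \<and> (\<Inter>j\<in>J. H j) \<noteq> {}}"

definition separates_components :: "('a, 'i) manifold \<Rightarrow> 'a set \<Rightarrow> ('a \<Rightarrow> real) \<Rightarrow> bool" where
  "separates_components M S g \<longleftrightarrow>
     (let \<C> = connected_components_of (subtopology (mtop M) S) in
        continuous_map (subtopology (mtop M) S) euclideanreal g \<and>
        g ` S \<subseteq> real ` {1..card \<C>} \<and>
        (\<forall>C\<in>\<C>. \<forall>D\<in>\<C>. C \<noteq> D \<longrightarrow> (\<forall>p\<in>C. \<forall>q\<in>D. g p \<noteq> g q)))"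

text \<open>Index type for the coordinates \<open>z\<^sub>i\<close>, \<open>x\<^sub>j\<close> and \<open>y\<^sub>J\<close> on
  \<open>X\<^sub>0 = \<real>\<^sup>N \<times> [0,\<infinity>)\<^sup>r \<times> \<real>\<^sup>l\<close>: a point \<open>p\<close> has coordinates \<open>z\<^sub>i = p (Zc i)\<close> for \<open>i < N\<close>,
  \<open>x\<^sub>j = p (Xc j)\<close> for \<open>1 \<le> j \<le> r\<close>, and \<open>y\<^sub>J = p (Yc J)\<close> for \<open>J \<in> \<J>\<close>.\<close>

datatype coord = Zc nat | Xc nat | Yc "nat set"

definition Psi ::
    "nat \<Rightarrow> ('a \<Rightarrow> nat \<Rightarrow> real) \<Rightarrow> (nat \<Rightarrow> 'a \<Rightarrow> real) \<Rightarrow> nat set set \<Rightarrow> (nat set \<Rightarrow> 'a \<Rightarrow> real) \<Rightarrow>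
     'a \<Rightarrow> coord \<Rightarrow> real" where
  "Psi r \<phi> \<rho> \<J> f p =
     (\<lambda>c. case c of
        Zc i \<Rightarrow> \<phi> p i
      | Xc j \<Rightarrow> if j \<in> {1..r} then \<rho> j p else 0
      | Yc J \<Rightarrow> if J \<in> \<J> then f J p else 0)"

definition X0 :: "nat \<Rightarrow> nat \<Rightarrow> nat set set \<Rightarrow> (coord \<Rightarrow> real, coord) manifold" where
  "X0 N r \<J> = model_manifold (Zc ` {..<N} \<union> Xc ` {1..r} \<union> Yc ` \<J>) (Xc ` {1..r})"

definition Y_set :: "nat \<Rightarrow> nat \<Rightarrow> nat set set \<Rightarrow> nat set \<Rightarrow> (coord \<Rightarrow> real) set" where
  "Y_set N r \<J> J = {p \<in> mcarrier (X0 N r \<J>). p (Yc J) - 1/2 \<in> \<int> \<and> (\<forall>j\<in>J. p (Xc j) = 0)}"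

definition X1 :: "nat \<Rightarrow> nat \<Rightarrow> nat set set \<Rightarrow> (coord \<Rightarrow> real, coord) manifold" where
  "X1 N r \<J> = submanifold_on (X0 N r \<J>) (mcarrier (X0 N r \<J>) - (\<Union>J\<in>\<J>. Y_set N r \<J> J))"

definition XM ::
    "nat \<Rightarrow> nat \<Rightarrow> nat set set \<Rightarrow> (coord \<Rightarrow> real) set \<Rightarrow> (coord \<Rightarrow> real, coord) manifold" where
  "XM N r \<J> A =
     submanifold_on (X1 N r \<J>) (mcarrier (X1 N r \<J>) - \<Union>{F \<in> faces (X1 N r \<J>). F \<inter> A = {}})"

end

theory Submission
  imports Defs
begin

text \<open>Depth is a diffeomorphism invariant, and a defining function with nonzero differential cannot
  vanish on two local boundary hypersurfaces at once. Hence the local boundary hypersurfaces through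
  a point of \<open>M\<close> lie in distinct hyperfaces, the depth of a point is the number of hyperfaces
  through it, and the \<open>d\<rho>\<^sub>i\<close> of these hyperfaces are linearly independent, which is transversality.

  A point of \<open>X\<^sub>1\<close> lies in the cell given by the set \<open>A\<close> of its vanishing coordinates \<open>x\<^sub>j\<close> and
  the integers nearest to its coordinates \<open>y\<^sub>J\<close> with \<open>J \<subseteq> A\<close>; the cells are the open faces. The cells that
  survive in \<open>X\<^sub>M\<close> are those that contain a point of \<open>M\<close>, because the face of \<open>X\<^sub>1\<close> through a cell
  meets \<open>M\<close> exactly when some point of \<open>F\<^sub>A\<close> has the prescribed values of \<open>f\<^sub>J\<close>. Such a cell cuts
  out of \<open>M\<close> the points of depth \<open>|A|\<close> in one component of \<open>F\<^sub>A\<close>, which are dense and locally connected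
  in that component and thus form an open face of \<open>M\<close>. A cell is a product of lines, open half-lines
  and open intervals.\<close>

section \<open>Calculus on coordinate spaces\<close>

text \<open>A face \<open>F_J\<close> of \<open>M\<close> may be disconnected, whereas the faces of
  a corner are connected. The coordinate \<open>y_J\<close> pulls the components of
  \<open>F_J\<close> apart: on \<open>F_J\<close> it is an integer, and deleting the half-integers
  where all \<open>x_j\<close> with \<open>j \<in> J\<close> vanish puts walls between the integers.
  A cell thus carries one integer for each \<open>J \<subseteq> A\<close>, and many combinations of
  integers do not occur in \<open>M\<close>; these account for the faces to be deleted. The delicate
  point is that a face of \<open>X_1\<close> might a priori meet \<open>M\<close> only at points
  deeper than the open face. Near such a point the set of incident hyperfaces can be shrunk without
  changing the relevant values of \<open>f_J\<close>, which yields a point of the right depth. A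
  second obstacle is the boundary. Smoothness means extendability and derivatives there are
  one-sided, while extensions are not unique. Differentiating along curves that stay in the corner
  shows that the one-sided partial derivatives do not depend on the extension and obey the chain
  rule.\<close>

abbreviation coord_open :: "'i set \<Rightarrow> ('i \<Rightarrow> real) set \<Rightarrow> bool" where
  "coord_open I U \<equiv> openin (top_of_set (coord_space I)) U"

lemma coord_space_zero: "x \<in> coord_space I \<Longrightarrow> i \<notin> I \<Longrightarrow> x i = 0"
  by (simp add: coord_space_def)

lemma corner_subset_coord_space: "corner I K \<subseteq> coord_space I"
  by (auto simp: corner_def)

lemma corner_empty [simp]: "corner I {} = coord_space I"
  by (auto simp: corner_def)

lemma coord_space_upd: "x \<in> coord_space I \<Longrightarrow> i \<in> I \<Longrightarrow> x(i := t) \<in> coord_space I"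
  by (auto simp: coord_space_def)

lemma continuous_on_coord: "continuous_on S (\<lambda>x. x i :: real)"
  by (rule continuous_on_subset[OF continuous_on_product_coordinates]) auto

lemma continuous_on_fun_upd: "continuous_on S (\<lambda>t::real. x(i := t))"
proof (rule continuous_on_coordinatewise_then_product)
  fix j
  show "continuous_on S (\<lambda>t. (x(i := t)) j)"
    by (cases "j = i") (auto intro!: continuous_intros)
qed

lemma open_coord_box:
  assumes "finite I"
  shows "open {y :: 'i \<Rightarrow> real. \<forall>i\<in>I. \<bar>y i - x i\<bar> < e}"
proof -
  have "{y :: 'i \<Rightarrow> real. \<forall>i\<in>I. \<bar>y i - x i\<bar> < e} = (\<Inter>i\<in>I. {y. \<bar>y i - x i\<bar> < e})"
    by auto
  moreover have "open {y :: 'i \<Rightarrow> real. \<bar>y i - x i\<bar> < e}" for i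
    by (intro open_Collect_less continuous_intros continuous_on_coord)
  ultimately show ?thesis using assms by auto
qed

text \<open>A basic open set of the product topology restricts only finitely many coordinates, so
  one radius serves all of them; the index type itself may be infinite.\<close>

lemma open_contains_coord_box:
  fixes x :: "'i \<Rightarrow> real"
  assumes "open U" "x \<in> U"
  shows "\<exists>J e. finite J \<and> e > 0 \<and> {y. \<forall>i\<in>J. \<bar>y i - x i\<bar> < e} \<subseteq> U"
proof -
  have "openin (product_topology (\<lambda>i. euclidean) UNIV) U"
    using assms by (simp add: euclidean_product_topology)
  from product_topology_open_contains_basis[OF this \<open>x \<in> U\<close>]
  obtain X where X: "x \<in> (\<Pi>\<^sub>E i\<in>UNIV. X i)" "\<And>i. open (X i)" "finite {i. X i \<noteq> UNIV}"
      "(\<Pi>\<^sub>E i\<in>UNIV. X i) \<subseteq> U"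
    by auto
  define J where "J = {i. X i \<noteq> UNIV}"
  have "\<exists>e>0. \<forall>y. dist y (x i) < e \<longrightarrow> y \<in> X i" for i
    using X(1,2) open_dist by (metis PiE_mem UNIV_I)
  then obtain e where e: "\<And>i. e i > 0" "\<And>i y. dist y (x i) < e i \<Longrightarrow> y \<in> X i"
    by metis
  \<comment> \<open>The inserted 1 keeps the minimum meaningful and positive when no coordinate is
    restricted.\<close>
  define d where "d = Min (insert 1 (e ` J))"
  have J: "finite J" using X(3) by (simp add: J_def)
  have d: "d > 0" "\<And>i. i \<in> J \<Longrightarrow> d \<le> e i"
    using J e(1) by (auto simp: d_def)
  have "{y. \<forall>i\<in>J. \<bar>y i - x i\<bar> < d} \<subseteq> U"
  proof
    fix y assume y: "y \<in> {y. \<forall>i\<in>J. \<bar>y i - x i\<bar> < d}"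
    have "y i \<in> X i" for i
    proof (cases "i \<in> J")
      case True
      then show ?thesis using y d(2)[of i] e(2)[of "y i" i] by (force simp: dist_real_def)
    qed (simp add: J_def)
    then show "y \<in> U" using X(4) by auto
  qed
  then show ?thesis using J d(1) by blast
qed

text \<open>The finitely many coordinates of a product box need not lie in \<open>I\<close>. Off
  \<open>I\<close> both points vanish, so closeness on \<open>I\<close> already gives closeness in
  all coordinates.\<close>

lemma openin_contains_coord_box:
  assumes "openin (top_of_set S) U" "S \<subseteq> coord_space I" "x \<in> U"
  shows "\<exists>e>0. \<forall>y\<in>S. (\<forall>i\<in>I. \<bar>y i - x i\<bar> < e) \<longrightarrow> y \<in> U"
proof -
  obtain T where T: "open T" "U = S \<inter> T"
    using assms(1) by (metis openin_open)
  then obtain J e where J: "finite J" "e > 0" "{y. \<forall>i\<in>J. \<bar>y i - x i\<bar> < e} \<subseteq> T"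
    using open_contains_coord_box[of T x] assms(3) by blast
  have "y \<in> U" if "y \<in> S" "\<forall>i\<in>I. \<bar>y i - x i\<bar> < e" for y
  proof -
    have "\<bar>y i - x i\<bar> < e" for i
    proof (cases "i \<in> I")
      case False
      then have "x i = 0" "y i = 0"
        using that assms T by (auto intro!: coord_space_zero[of _ I i])
      then show ?thesis using J(2) by simp
    qed (use that in auto)
    then show ?thesis using that T J(3) by auto
  qed
  then show ?thesis using J(2) by blast
qed

lemma open_coord_line:
  assumes "coord_open I U" "x \<in> U" "i \<in> I"
  shows "open {t. x(i := t) \<in> U}"
proof -
  obtain T where T: "open T" "U = coord_space I \<inter> T"
    using assms(1) by (metis openin_open)
  have "{t. x(i := t) \<in> U} = (\<lambda>t. x(i := t)) -` T"
    using assms T by (auto intro: coord_space_upd)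
  then show ?thesis
    using T(1) by (simp add: open_vimage continuous_on_fun_upd)
qed

lemma eventually_coord_line:
  assumes "coord_open I U" "x \<in> U" "i \<in> I"
  shows "eventually (\<lambda>t. x(i := t) \<in> U) (nhds (x i))"
  using eventually_nhds_in_open[OF open_coord_line[OF assms], of "x i"] assms by simp

lemma coord_derivI:
  assumes "((\<lambda>t. g (x(i := t))) has_real_derivative d) (at (x i) within {t. x(i := t) \<in> S})"
    and "at (x i) within {t. x(i := t) \<in> S} \<noteq> bot"
  shows "coord_deriv S i g x = d"
  using assms unfolding coord_deriv_def
  by (intro vector_derivative_within) (auto simp: has_real_derivative_iff_has_vector_derivative)

lemma at_within_coord_line:
  assumes "coord_open I U" "x \<in> U" "i \<in> I"
  shows "at (x i) within {t. x(i := t) \<in> U} = at (x i)"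
  using open_coord_line[OF assms] assms by (intro at_within_open) auto

lemma coord_deriv_openI:
  assumes "coord_open I U" "x \<in> U" "i \<in> I"
    and "((\<lambda>t. g (x(i := t))) has_real_derivative d) (at (x i))"
  shows "coord_deriv U i g x = d"
  using assms(4) by (intro coord_derivI) (auto simp: at_within_coord_line[OF assms(1-3)])

lemma Ck_on_SucD:
  assumes "coord_open I U" "Ck_on (Suc m) I U g" "x \<in> U" "i \<in> I"
  shows "((\<lambda>t. g (x(i := t))) has_real_derivative coord_deriv U i g x) (at (x i))"
  using assms unfolding coord_deriv_def
  by (auto simp: at_within_coord_line has_real_derivative_iff_has_vector_derivative
      vector_derivative_works[symmetric])

lemma Ck_on_imp_continuous: "Ck_on m I U g \<Longrightarrow> continuous_on U g"
  by (cases m) auto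

lemma continuous_on_cong_simple: "continuous_on U g \<Longrightarrow> (\<And>x. x \<in> U \<Longrightarrow> g' x = g x) \<Longrightarrow> continuous_on U g'"
  using continuous_on_cong by metis

text \<open>Near a point of an open \<open>U\<close> the coordinate lines stay in \<open>U\<close>,
  so partial derivatives cannot see values outside. Both functions vary in the induction because
  they are replaced by their partial derivatives.\<close>

lemma Ck_on_cong:
  assumes U: "coord_open I U" and "\<And>x. x \<in> U \<Longrightarrow> g' x = g x" "Ck_on m I U g"
  shows "Ck_on m I U g'"
  using assms(2,3)
proof (induction m arbitrary: g g')
  case 0
  then show ?case using continuous_on_cong_simple[of U g g'] by simp
next
  case (Suc m)
  have d: "((\<lambda>t. g' (x(i := t))) has_real_derivative coord_deriv U i g x) (at (x i))"
    if "x \<in> U" "i \<in> I" for x i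
  proof -
    have "eventually (\<lambda>t. g' (x(i := t)) = g (x(i := t))) (nhds (x i))"
      using eventually_coord_line[OF U that] by eventually_elim (rule Suc.prems(1))
    then show ?thesis
      using Ck_on_SucD[OF U Suc.prems(2) that] by (simp only: DERIV_cong_ev[OF refl _ refl])
  qed
  have "Ck_on m I U (coord_deriv U i g')" if "i \<in> I" for i
    using Suc.prems(2) that coord_deriv_openI[OF U _ that d]
    by (intro Suc.IH[of "coord_deriv U i g'" "coord_deriv U i g"]) (auto simp: that)
  moreover have "continuous_on U g'"
    using Suc.prems continuous_on_cong_simple[of U g g'] by simp
  moreover have "(\<lambda>t. g' (x(i := t))) differentiable (at (x i) within {t. x(i := t) \<in> U})"
    if "x \<in> U" "i \<in> I" for x i
    using d[OF that] by (auto simp: at_within_coord_line[OF U that] real_differentiable_def)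
  ultimately show ?case by simp
qed

text \<open>Lets the partial derivatives be named by formulas \<open>g' i\<close> in place of
  \<open>coord_deriv\<close>. The closure properties below rest on this: each supplies the formula
  from the corresponding rule of differentiation.\<close>

lemma Ck_on_SucI:
  assumes U: "coord_open I U" and "continuous_on U g"
    and "\<And>i. i \<in> I \<Longrightarrow> Ck_on m I U (g' i)"
    and d: "\<And>x i. x \<in> U \<Longrightarrow> i \<in> I \<Longrightarrow> ((\<lambda>t. g (x(i := t))) has_real_derivative g' i x) (at (x i))"
  shows "Ck_on (Suc m) I U g"
proof -
  have "Ck_on m I U (coord_deriv U i g)" if "i \<in> I" for i
    by (rule Ck_on_cong[OF U _ assms(3)[OF that]]) (simp add: coord_deriv_openI[OF U _ that d] that)
  moreover have "(\<lambda>t. g (x(i := t))) differentiable (at (x i) within {t. x(i := t) \<in> U})"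
    if "x \<in> U" "i \<in> I" for x i
    using d[OF that] by (auto simp: at_within_coord_line[OF U that] real_differentiable_def)
  ultimately show ?thesis using assms(2) by simp
qed

lemma Ck_on_Suc_imp: "Ck_on (Suc m) I U g \<Longrightarrow> Ck_on m I U g"
  by (induction m arbitrary: g) auto

text \<open>\<open>coord_deriv\<close> mentions its domain. On open sets both limits are two-sided
  limits of the same function, so restriction does not change them.\<close>

lemma Ck_on_subset:
  assumes U: "coord_open I U" and V: "coord_open I V" "V \<subseteq> U" and "Ck_on m I U g"
  shows "Ck_on m I V g"
  using assms(4)
proof (induction m arbitrary: g)
  case 0
  then show ?case using V continuous_on_subset by auto
next
  case (Suc m)
  show ?case
  proof (rule Ck_on_SucI[OF V(1), where g' = "\<lambda>i. coord_deriv U i g"])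
    show "continuous_on V g"
      using Suc.prems V continuous_on_subset by auto
    show "((\<lambda>t. g (x(i := t))) has_real_derivative coord_deriv U i g x) (at (x i))" if "x \<in> V" "i \<in> I" for x i
      using that V(2) by (intro Ck_on_SucD[OF U Suc.prems]) auto
  qed (use Suc in auto)
qed

lemma Ck_on_const:
  assumes "coord_open I U"
  shows "Ck_on m I U (\<lambda>_. c)"
proof (induction m arbitrary: c)
  case (Suc m)
  show ?case
    by (rule Ck_on_SucI[OF assms, where g' = "\<lambda>_ _. 0"]) (auto simp: Suc.IH)
qed simp

lemma Ck_on_coord:
  assumes U: "coord_open I U"
  shows "Ck_on m I U (\<lambda>x. x j)"
proof (cases m)
  case (Suc n)
  show ?thesis unfolding Suc
    by (rule Ck_on_SucI[OF U, where g' = "\<lambda>i _. if i = j then 1 else 0"])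
      (auto intro!: continuous_on_coord Ck_on_const[OF U] derivative_eq_intros)
qed (auto intro: continuous_on_coord)

lemma Ck_on_add:
  assumes U: "coord_open I U" and "Ck_on m I U g" "Ck_on m I U h"
  shows "Ck_on m I U (\<lambda>x. g x + h x)"
  using assms(2,3)
proof (induction m arbitrary: g h)
  case (Suc m)
  show ?case
  proof (rule Ck_on_SucI[OF U, where g' = "\<lambda>i x. coord_deriv U i g x + coord_deriv U i h x"])
    show "((\<lambda>t. g (x(i := t)) + h (x(i := t))) has_real_derivative
        coord_deriv U i g x + coord_deriv U i h x) (at (x i))" if "x \<in> U" "i \<in> I" for x i
      by (intro DERIV_add Ck_on_SucD[OF U Suc.prems(1)] Ck_on_SucD[OF U Suc.prems(2)] that)
  qed (use Suc in \<open>auto intro!: continuous_intros\<close>)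
qed (auto intro: continuous_intros)

lemma Ck_on_mult:
  assumes U: "coord_open I U" and "Ck_on m I U g" "Ck_on m I U h"
  shows "Ck_on m I U (\<lambda>x. g x * h x)"
  using assms(2,3)
proof (induction m arbitrary: g h)
  case (Suc m)
  show ?case
  proof (rule Ck_on_SucI[OF U, where g' = "\<lambda>i x. coord_deriv U i g x * h x + coord_deriv U i h x * g x"])
    show "continuous_on U (\<lambda>x. g x * h x)"
      using Suc.prems by (auto intro: continuous_intros)
    show "Ck_on m I U (\<lambda>x. coord_deriv U i g x * h x + coord_deriv U i h x * g x)" if "i \<in> I" for i
      using Suc.prems that Ck_on_Suc_imp[OF Suc.prems(1)] Ck_on_Suc_imp[OF Suc.prems(2)]
      by (intro Ck_on_add[OF U] Suc.IH) auto
    show "((\<lambda>t. g (x(i := t)) * h (x(i := t))) has_real_derivative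
        coord_deriv U i g x * h x + coord_deriv U i h x * g x) (at (x i))" if "x \<in> U" "i \<in> I" for x i
      using DERIV_mult[OF Ck_on_SucD[OF U Suc.prems(1) that] Ck_on_SucD[OF U Suc.prems(2) that]]
      by (simp only: fun_upd_triv)
  qed
qed (auto intro: continuous_intros)

lemma Ck_on_sum:
  assumes U: "coord_open I U" and "\<And>j. j \<in> A \<Longrightarrow> Ck_on m I U (g j)"
  shows "Ck_on m I U (\<lambda>x. \<Sum>j\<in>A. g j x)"
  using assms(2)
  by (induction A rule: infinite_finite_induct) (auto intro: Ck_on_const[OF U] Ck_on_add[OF U])

text \<open>The mean value theorem is applied to one coordinate after the other; \<open>A\<close> is the set of
  coordinates that have already been moved from \<open>x\<close> to \<open>y\<close>.\<close>

lemma C1_linear_approximation: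
  assumes U: "coord_open I U" and I: "finite I" and h: "Ck_on 1 I U h" and x: "x \<in> U" and "e > 0"
  shows "\<exists>d>0. \<forall>y\<in>coord_space I. (\<forall>i\<in>I. \<bar>y i - x i\<bar> < d) \<longrightarrow>
     \<bar>h y - h x - (\<Sum>i\<in>I. coord_deriv U i h x * (y i - x i))\<bar> \<le> e * (\<Sum>i\<in>I. \<bar>y i - x i\<bar>)"
proof -
  define V where "V = U \<inter> (\<Inter>i\<in>I. {y \<in> U. coord_deriv U i h y \<in> ball (coord_deriv U i h x) e})"
  have xU: "x \<in> coord_space I" using U x openin_imp_subset by blast
  have "coord_open I {y \<in> U. coord_deriv U i h y \<in> ball (coord_deriv U i h x) e}" if "i \<in> I" for i
  proof -
    have "continuous_on U (coord_deriv U i h)"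
      using h that by simp
    then have "openin (top_of_set U) (U \<inter> coord_deriv U i h -` ball (coord_deriv U i h x) e)"
      by (intro continuous_openin_preimage_gen) auto
    moreover have "{y \<in> U. coord_deriv U i h y \<in> ball (coord_deriv U i h x) e}
        = U \<inter> coord_deriv U i h -` ball (coord_deriv U i h x) e"
      by blast
    ultimately show ?thesis
      using openin_trans[OF _ U] by metis
  qed
  then have "coord_open I V"
    unfolding V_def using I U by (cases "I = {}") (auto intro!: openin_Int openin_INT2)
  moreover have "x \<in> V" using x \<open>e > 0\<close> by (auto simp: V_def)
  ultimately obtain d where d: "d > 0" "\<And>y. y \<in> coord_space I \<Longrightarrow> \<forall>i\<in>I. \<bar>y i - x i\<bar> < d \<Longrightarrow> y \<in> V"
    using openin_contains_coord_box[of "coord_space I" V I x] by blast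
  have "\<bar>h y - h x - (\<Sum>i\<in>I. coord_deriv U i h x * (y i - x i))\<bar> \<le> e * (\<Sum>i\<in>I. \<bar>y i - x i\<bar>)"
    if y: "y \<in> coord_space I" "\<forall>i\<in>I. \<bar>y i - x i\<bar> < d" for y
  proof -
    define z where "z A = (\<lambda>i. if i \<in> A then y i else x i)" for A
    have "\<bar>h (z A) - h x - (\<Sum>i\<in>A. coord_deriv U i h x * (y i - x i))\<bar> \<le> e * (\<Sum>i\<in>A. \<bar>y i - x i\<bar>)"
      if "A \<subseteq> I" for A
      using finite_subset[OF that I] that
    proof (induction A rule: finite_subset_induct')
      case empty
      then show ?case by (simp add: z_def)
    next
      case (insert a A)
      have zV: "(z A)(a := t) \<in> V" if "min (x a) (y a) \<le> t" "t \<le> max (x a) (y a)" for t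
      proof (rule d(2))
        show "(z A)(a := t) \<in> coord_space I"
          using y(1) xU insert.hyps by (auto simp: z_def coord_space_def)
        show "\<forall>i\<in>I. \<bar>((z A)(a := t)) i - x i\<bar> < d"
          using y(2) insert.hyps that d(1) by (force simp: z_def)
      qed
      define k where "k t = h ((z A)(a := t)) - coord_deriv U a h x * t" for t
      have dk: "(k has_real_derivative (coord_deriv U a h ((z A)(a := t)) - coord_deriv U a h x)) (at t)"
        if "min (x a) (y a) \<le> t" "t \<le> max (x a) (y a)" for t
      proof -
        have "(z A)(a := t) \<in> U" using zV[OF that] by (auto simp: V_def)
        from Ck_on_SucD[OF U h[unfolded One_nat_def] this, of a] insert.hyps
        have "((\<lambda>t. h ((z A)(a := t))) has_real_derivative coord_deriv U a h ((z A)(a := t))) (at t)"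
          by auto
        then show ?thesis unfolding k_def by (auto intro!: derivative_eq_intros)
      qed
      have b: "norm (coord_deriv U a h ((z A)(a := t)) - coord_deriv U a h x) \<le> e"
        if "min (x a) (y a) \<le> t" "t \<le> max (x a) (y a)" for t
        using zV[OF that] insert.hyps by (auto simp: V_def dist_real_def abs_minus_commute less_imp_le)
      have "norm (k (y a) - k (x a)) \<le> e * norm (y a - x a)"
        by (rule field_differentiable_bound[where S = "{min (x a) (y a)..max (x a) (y a)}"])
          (use dk b in \<open>auto intro: has_field_derivative_at_within\<close>)
      moreover have "(z A)(a := y a) = z (insert a A)" "(z A)(a := x a) = z A"
        using insert.hyps by (auto simp: z_def)
      ultimately have "\<bar>h (z (insert a A)) - h (z A) - coord_deriv U a h x * (y a - x a)\<bar> \<le> e * \<bar>y a - x a\<bar>"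
        by (simp add: k_def algebra_simps)
      then show ?case
        using insert.IH insert.hyps by (simp add: algebra_simps)
    qed
    from this[of I] have "\<bar>h (z I) - h x - (\<Sum>i\<in>I. coord_deriv U i h x * (y i - x i))\<bar> \<le> e * (\<Sum>i\<in>I. \<bar>y i - x i\<bar>)"
      by simp
    moreover have "z I = y"
      using y(1) xU by (auto simp: z_def coord_space_def)
    ultimately show ?thesis by simp
  qed
  then show ?thesis using d(1) by blast
qed

text \<open>The remainder of the linear approximation, divided by \<open>t - t0\<close>, is at most
  a small factor times the sum of the absolute difference quotients \<open>q\<close>, which
  converges. The approach set \<open>A\<close> is arbitrary because a curve starting at a boundary
  point may exist on one side only.\<close>

lemma C1_curve_derivative:
  assumes V: "coord_open J V" and J: "finite J" and h: "Ck_on 1 J V h" and y: "\<gamma> t0 \<in> V"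
    and \<gamma>: "eventually (\<lambda>t. \<gamma> t \<in> coord_space J) (at t0 within A)"
    and d: "\<And>j. j \<in> J \<Longrightarrow> ((\<lambda>t. \<gamma> t j) has_real_derivative d j) (at t0 within A)"
  shows "((\<lambda>t. h (\<gamma> t)) has_real_derivative (\<Sum>j\<in>J. coord_deriv V j h (\<gamma> t0) * d j)) (at t0 within A)"
proof -
  let ?F = "at t0 within A"
  define a where "a j = coord_deriv V j h (\<gamma> t0)" for j
  define q where "q j t = (\<gamma> t j - \<gamma> t0 j) / (t - t0)" for j t
  define R where "R t = (h (\<gamma> t) - h (\<gamma> t0)) / (t - t0) - (\<Sum>j\<in>J. a j * q j t)" for t
  have q: "((\<lambda>t. q j t) \<longlongrightarrow> d j) ?F" if "j \<in> J" for j
    using d[OF that] by (simp add: has_field_derivative_iff q_def)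
  define C where "C = (\<Sum>j\<in>J. \<bar>d j\<bar>)"
  have C: "((\<lambda>t. \<Sum>j\<in>J. \<bar>q j t\<bar>) \<longlongrightarrow> C) ?F"
    unfolding C_def by (intro tendsto_intros q)
  have "C \<ge> 0" by (simp add: C_def sum_nonneg)
  have "(R \<longlongrightarrow> 0) ?F"
    unfolding tendsto_iff
  proof (intro allI impI)
    fix e :: real assume "e > 0"
    \<comment> \<open>\<open>C\<close> is the limit of the sum of the
      \<open>\<bar>q j t\<bar>\<close>; the extra 1 makes \<open>C + 1\<close> an eventual strict
      bound and a nonzero divisor.\<close>
    define e' where "e' = e / (C + 1)"
    have e': "e' > 0" "e' * (C + 1) = e" using \<open>e > 0\<close> \<open>C \<ge> 0\<close> by (auto simp: e'_def)
    obtain \<delta> where \<delta>: "\<delta> > 0" "\<And>z. z \<in> coord_space J \<Longrightarrow> \<forall>j\<in>J. \<bar>z j - \<gamma> t0 j\<bar> < \<delta> \<Longrightarrow>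
      \<bar>h z - h (\<gamma> t0) - (\<Sum>j\<in>J. a j * (z j - \<gamma> t0 j))\<bar> \<le> e' * (\<Sum>j\<in>J. \<bar>z j - \<gamma> t0 j\<bar>)"
      using C1_linear_approximation[OF V J h y e'(1)] unfolding a_def by blast
    have "eventually (\<lambda>t. \<bar>\<gamma> t j - \<gamma> t0 j\<bar> < \<delta>) ?F" if "j \<in> J" for j
    proof -
      have "((\<lambda>t. \<gamma> t j) \<longlongrightarrow> \<gamma> t0 j) ?F"
        using DERIV_continuous[OF d[OF that]] by (simp add: continuous_within)
      then show ?thesis using \<delta>(1) by (auto simp: tendsto_iff dist_real_def)
    qed
    then have 1: "eventually (\<lambda>t. \<forall>j\<in>J. \<bar>\<gamma> t j - \<gamma> t0 j\<bar> < \<delta>) ?F"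
      using J by (simp add: eventually_ball_finite)
    have 2: "eventually (\<lambda>t. (\<Sum>j\<in>J. \<bar>q j t\<bar>) < C + 1) ?F"
      using C by (rule order_tendstoD) simp
    have 3: "eventually (\<lambda>t. t \<noteq> t0) ?F"
      by (simp add: eventually_at_filter)
    show "eventually (\<lambda>t. dist (R t) 0 < e) ?F"
      using \<gamma> 1 2 3
    proof eventually_elim
      case (elim t)
      have "R t = (h (\<gamma> t) - h (\<gamma> t0) - (\<Sum>j\<in>J. a j * (\<gamma> t j - \<gamma> t0 j))) / (t - t0)"
        by (simp add: R_def q_def diff_divide_distrib sum_divide_distrib right_diff_distrib)
      then have "\<bar>R t\<bar> \<le> e' * (\<Sum>j\<in>J. \<bar>\<gamma> t j - \<gamma> t0 j\<bar>) / \<bar>t - t0\<bar>"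
        using \<delta>(2)[OF elim(1,2)] by (simp add: abs_divide divide_right_mono)
      also have "\<dots> = e' * (\<Sum>j\<in>J. \<bar>q j t\<bar>)"
        by (simp only: q_def sum_divide_distrib times_divide_eq_right[symmetric] abs_divide)
      also have "\<dots> < e' * (C + 1)"
        using elim(3) e'(1) by simp
      finally show ?case by (simp add: e')
    qed
  qed
  then have "((\<lambda>t. R t + (\<Sum>j\<in>J. a j * q j t)) \<longlongrightarrow> 0 + (\<Sum>j\<in>J. a j * d j)) ?F"
    by (intro tendsto_intros q)
  then show ?thesis
    by (simp add: R_def has_field_derivative_iff a_def)
qed

lemma coord_open_continuous_preimage:
  assumes U: "coord_open I U" and V: "coord_open J V"
    and G: "\<And>j. j \<in> J \<Longrightarrow> continuous_on U (\<lambda>x. G x j)" "\<And>x. x \<in> U \<Longrightarrow> G x \<in> coord_space J"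
  shows "continuous_on U G" "coord_open I {x \<in> U. G x \<in> V}"
proof -
  show c: "continuous_on U G"
  proof (rule continuous_on_coordinatewise_then_product)
    fix j
    show "continuous_on U (\<lambda>x. G x j)"
    proof (cases "j \<in> J")
      case False
      then show ?thesis
        by - (rule continuous_on_cong_simple[of U "\<lambda>_. 0"], auto intro: coord_space_zero[OF G(2)])
    qed (rule G(1))
  qed
  have "openin (top_of_set U) (U \<inter> G -` V)"
    by (rule continuous_openin_preimage[OF c _ V]) (use G(2) in auto)
  moreover have "{x \<in> U. G x \<in> V} = U \<inter> G -` V"
    by blast
  ultimately show "coord_open I {x \<in> U. G x \<in> V}"
    using openin_trans[OF _ U] by metis
qed

text \<open>By the chain rule the partial derivatives of \<open>h (G x)\<close> are sums of products
  of functions of order \<open>m\<close>. One factor is again a composition with \<open>G\<close>,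
  so \<open>h\<close> is generalised in the induction and \<open>G\<close> is kept.\<close>

lemma Ck_on_compose:
  assumes U: "coord_open I U" and V: "coord_open J V" and J: "finite J"
    and "\<And>j. j \<in> J \<Longrightarrow> Ck_on m I U (\<lambda>x. G x j)" and GV: "\<And>x. x \<in> U \<Longrightarrow> G x \<in> V"
    and "Ck_on m J V h"
  shows "Ck_on m I U (\<lambda>x. h (G x))"
  using assms(4,6)
proof (induction m arbitrary: h)
  case 0
  have "continuous_on U G"
    by (rule coord_open_continuous_preimage(1)[OF U V]) (use 0 GV openin_imp_subset[OF V] in auto)
  then show ?case
    using 0 GV by (auto intro: continuous_on_compose2[of V h U G])
next
  case (Suc m)
  have VJ: "V \<subseteq> coord_space J" using V openin_imp_subset by blast
  have "continuous_on U G"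
    by (rule coord_open_continuous_preimage(1)[OF U V])
      (use Suc.prems(1) GV VJ in \<open>auto dest: Ck_on_imp_continuous\<close>)
  then have "continuous_on U (\<lambda>x. h (G x))"
    using GV Suc.prems(2) by (auto intro: continuous_on_compose2[of V h U G])
  moreover have "Ck_on m I U (\<lambda>x. \<Sum>j\<in>J. coord_deriv V j h (G x) * coord_deriv U i (\<lambda>x. G x j) x)"
    if "i \<in> I" for i
  proof (intro Ck_on_sum[OF U] Ck_on_mult[OF U])
    fix j assume "j \<in> J"
    show "Ck_on m I U (\<lambda>x. coord_deriv V j h (G x))"
    proof (rule Suc.IH)
      show "Ck_on m I U (\<lambda>x. G x j)" if "j \<in> J" for j
        by (rule Ck_on_Suc_imp[OF Suc.prems(1)[OF that]])
      show "Ck_on m J V (coord_deriv V j h)"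
        using Suc.prems(2) \<open>j \<in> J\<close> by simp
    qed
    show "Ck_on m I U (coord_deriv U i (\<lambda>x. G x j))"
      using Suc.prems(1)[OF \<open>j \<in> J\<close>] \<open>i \<in> I\<close> by simp
  qed
  moreover have "((\<lambda>t. h (G (x(i := t)))) has_real_derivative
      (\<Sum>j\<in>J. coord_deriv V j h (G x) * coord_deriv U i (\<lambda>x. G x j) x)) (at (x i))"
    if "x \<in> U" "i \<in> I" for x i
  proof -
    have "Ck_on 1 J V h"
      using Suc.prems(2) by (induction m) (auto dest: Ck_on_imp_continuous)
    moreover have "eventually (\<lambda>t. G (x(i := t)) \<in> coord_space J) (at (x i))"
      using eventually_nhds_conv_at[THEN iffD1, OF eventually_coord_line[OF U that], THEN conjunct1]
      by eventually_elim (use GV VJ in blast)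
    ultimately have "((\<lambda>t. h (G (x(i := t)))) has_real_derivative
      (\<Sum>j\<in>J. coord_deriv V j h (G (x(i := x i))) * coord_deriv U i (\<lambda>x. G x j) x)) (at (x i))"
      by (intro C1_curve_derivative[OF V J] Ck_on_SucD[OF U Suc.prems(1) that])
        (simp_all only: fun_upd_triv GV[OF that(1)])
    then show ?thesis by (simp only: fun_upd_triv)
  qed
  ultimately show ?case
    by (rule Ck_on_SucI[OF U])
qed

section \<open>Germs of smooth functions\<close>

text \<open>The germ version of \<open>smooth_on\<close>: the extension near \<open>x\<close> has to
  agree with \<open>g\<close> on \<open>S\<close> only. Compositions and changes of chart are
  checked with it one point at a time.\<close>

definition smooth_at :: "'i set \<Rightarrow> ('i \<Rightarrow> real) set \<Rightarrow> (('i \<Rightarrow> real) \<Rightarrow> real) \<Rightarrow> ('i \<Rightarrow> real) \<Rightarrow> bool" where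
  "smooth_at I S g x \<longleftrightarrow> (\<exists>U h. coord_open I U \<and> x \<in> U \<and> (\<forall>m. Ck_on m I U h) \<and> (\<forall>y\<in>S \<inter> U. h y = g y))"

lemma smooth_on_iff: "smooth_on I S g \<longleftrightarrow> (\<forall>x\<in>S. smooth_at I S g x)"
  by (simp add: smooth_on_def smooth_at_def)

lemma smooth_at_local:
  assumes "smooth_at I S g x" "coord_open I N" "x \<in> N" "\<And>y. y \<in> S' \<inter> N \<Longrightarrow> y \<in> S \<and> g' y = g y"
  shows "smooth_at I S' g' x"
proof -
  obtain U h where U: "coord_open I U" "x \<in> U" "\<And>m. Ck_on m I U h" "\<And>y. y \<in> S \<inter> U \<Longrightarrow> h y = g y"
    using assms(1) unfolding smooth_at_def by blast
  have UN: "coord_open I (U \<inter> N)" using U(1) assms(2) by auto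
  then have "Ck_on m I (U \<inter> N) h" for m
    using Ck_on_subset[OF U(1) UN _ U(3)] by auto
  then show ?thesis
    unfolding smooth_at_def using UN U assms by (intro exI[of _ "U \<inter> N"] exI[of _ h]) auto
qed

lemma smooth_at_subset: "smooth_at I S g x \<Longrightarrow> S' \<subseteq> S \<Longrightarrow> smooth_at I S' g x"
  unfolding smooth_at_def by blast

lemma smooth_at_coord: "x \<in> coord_space I \<Longrightarrow> smooth_at I S (\<lambda>x. x j) x"
  unfolding smooth_at_def by (intro exI[of _ "coord_space I"] exI) (auto intro: Ck_on_coord)

lemma smooth_at_const: "x \<in> coord_space I \<Longrightarrow> smooth_at I S (\<lambda>x. c) x"
  unfolding smooth_at_def by (intro exI[of _ "coord_space I"] exI) (auto intro: Ck_on_const)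

text \<open>Extensions of the coordinates of \<open>G\<close> are glued into one map, which is
  composed with an extension of \<open>h\<close> on the open set where it lands in the domain of the
  latter.\<close>

lemma smooth_at_compose:
  assumes I: "x \<in> coord_space I" and J: "finite J" and h: "smooth_at J T h (G x)"
    and G: "\<And>j. j \<in> J \<Longrightarrow> smooth_at I S (\<lambda>x. G x j) x"
    and GT: "\<And>y. y \<in> S \<Longrightarrow> G y \<in> T" and T: "T \<subseteq> coord_space J" and x: "x \<in> S"
  shows "smooth_at I S (\<lambda>x. h (G x)) x"
proof -
  obtain V h' where V: "coord_open J V" "G x \<in> V" "\<And>m. Ck_on m J V h'" "\<And>y. y \<in> T \<inter> V \<Longrightarrow> h' y = h y"
    using h unfolding smooth_at_def by blast
  obtain U g where U: "\<And>j. j \<in> J \<Longrightarrow> coord_open I (U j) \<and> x \<in> U j \<and> (\<forall>m. Ck_on m I (U j) (g j)) \<and>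
      (\<forall>y\<in>S \<inter> U j. g j y = G y j)"
    using G unfolding smooth_at_def by metis
  define U0 where "U0 = coord_space I \<inter> (\<Inter>j\<in>J. U j)"
  have U0: "coord_open I U0"
    unfolding U0_def using J U
    by (cases "J = {}") (auto intro!: openin_Int openin_INT2)
  have U0j: "Ck_on m I U0 (g j)" if "j \<in> J" for j m
    using U[OF that] that by (intro Ck_on_subset[OF _ U0, of "U j"]) (auto simp: U0_def)
  \<comment> \<open>The value 0 off \<open>J\<close> keeps \<open>G'\<close> inside
    \<open>coord_space J\<close> also at points outside \<open>S\<close>; on \<open>S\<close> it
    agrees with \<open>G\<close> because \<open>T\<close> lies in
    \<open>coord_space J\<close>.\<close>
  define G' where "G' y = (\<lambda>j. if j \<in> J then g j y else 0)" for y
  have G': "G' y = G y" if "y \<in> S \<inter> U0" for y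
  proof
    fix j show "G' y j = G y j"
      using that U[of j] GT[of y] T by (auto simp: G'_def U0_def coord_space_def)
  qed
  define W where "W = {y \<in> U0. G' y \<in> V}"
  have W: "coord_open I W"
    unfolding W_def using U0j[of _ 0]
    by (intro coord_open_continuous_preimage(2)[OF U0 V(1)]) (auto simp: G'_def coord_space_def)
  have xU0: "x \<in> U0" using U I by (auto simp: U0_def)
  then have "x \<in> W" using G'[of x] x V(2) by (auto simp: W_def)
  moreover have "Ck_on m I W (\<lambda>y. h' (G' y))" for m
  proof (rule Ck_on_compose[where G = G' and h = h', OF W V(1) J])
    show "Ck_on m I W (\<lambda>x. G' x j)" if "j \<in> J" for j
      using Ck_on_subset[OF U0 W _ U0j[OF that]] that by (auto simp: G'_def W_def)
  qed (use V in \<open>auto simp: W_def\<close>)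
  moreover have "h' (G' y) = h (G y)" if "y \<in> S \<inter> W" for y
    using that G'[of y] GT V(4)[of "G y"] by (auto simp: W_def)
  ultimately show ?thesis unfolding smooth_at_def using W by blast
qed

text \<open>A corner allows every coordinate to increase, so each coordinate line can be followed at
  least one way from any point. This makes partial derivatives unique even on the boundary, where
  they are one-sided.\<close>

lemma corner_line_nontrivial:
  assumes "openin (top_of_set (corner I K)) S" "x \<in> S" "i \<in> I"
  shows "at (x i) within {t. x(i := t) \<in> S} \<noteq> bot"
proof -
  obtain e where e: "e > 0" "\<And>y. y \<in> corner I K \<Longrightarrow> \<forall>i\<in>I. \<bar>y i - x i\<bar> < e \<Longrightarrow> y \<in> S"
    using openin_contains_coord_box[OF assms(1) corner_subset_coord_space assms(2)] by blast
  have x: "x \<in> corner I K" using assms openin_imp_subset by blast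
  have "x(i := x i + s) \<in> S" if "0 \<le> s" "s < e" for s
    using that assms(3) x \<open>e > 0\<close> by (intro e(2)) (auto simp: corner_def coord_space_def add_nonneg_nonneg)
  then have S: "x i + min (e/2) (d/2) \<in> {t. x(i := t) \<in> S}" if "d > 0" for d
    using that e(1) by auto
  have "x i islimpt {t. x(i := t) \<in> S}"
    unfolding islimpt_approachable
  proof (intro allI impI)
    fix d :: real assume "d > 0"
    with S[of d] e(1) show "\<exists>t\<in>{t. x(i := t) \<in> S}. t \<noteq> x i \<and> dist t (x i) < d"
      by (intro bexI[of _ "x i + min (e/2) (d/2)"]) (auto simp: dist_real_def min_def)
  qed
  then show ?thesis by (simp add: trivial_limit_within)
qed

text \<open>The coefficients are the partial derivatives of one chosen extension. They are fixed
  before the curve is, so they can later be identified by testing on coordinate lines.\<close>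

lemma smooth_at_curve_aux:
  assumes T: "openin (top_of_set (corner J L)) T" and J: "finite J" and h: "smooth_at J T h y" and y: "y \<in> T"
  shows "\<exists>a. \<forall>(\<gamma>::real \<Rightarrow> _) t0 A d. \<gamma> t0 = y \<longrightarrow> eventually (\<lambda>t. \<gamma> t \<in> T) (at t0 within A) \<longrightarrow>
     (\<forall>j\<in>J. ((\<lambda>t. \<gamma> t j) has_real_derivative d j) (at t0 within A)) \<longrightarrow>
     ((\<lambda>t. h (\<gamma> t)) has_real_derivative (\<Sum>j\<in>J. a j * d j)) (at t0 within A)"
proof -
  obtain V h' where V: "coord_open J V" "y \<in> V" "\<And>m. Ck_on m J V h'" "\<And>y. y \<in> T \<inter> V \<Longrightarrow> h' y = h y"
    using h unfolding smooth_at_def by blast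
  have TJ: "T \<subseteq> coord_space J"
    using openin_imp_subset[OF T] by (auto simp: corner_def)
  have "((\<lambda>t. h (\<gamma> t)) has_real_derivative (\<Sum>j\<in>J. coord_deriv V j h' y * d j)) (at t0 within A)"
    if \<gamma>: "\<gamma> t0 = y" "eventually (\<lambda>t. \<gamma> t \<in> T) (at t0 within A)"
      and d: "\<forall>j\<in>J. ((\<lambda>t. \<gamma> t j) has_real_derivative d j) (at t0 within A)"
    for \<gamma> :: "real \<Rightarrow> _" and t0 A d
  proof -
    have "((\<lambda>t. h' (\<gamma> t)) has_real_derivative (\<Sum>j\<in>J. coord_deriv V j h' (\<gamma> t0) * d j)) (at t0 within A)"
    proof (rule C1_curve_derivative[OF V(1) J V(3)])
      show "eventually (\<lambda>t. \<gamma> t \<in> coord_space J) (at t0 within A)"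
        using \<gamma>(2) by eventually_elim (use TJ in auto)
    qed (use V \<gamma> d in auto)
    moreover have "eventually (\<lambda>t. h' (\<gamma> t) = h (\<gamma> t)) (at t0 within A)"
    proof -
      obtain e where e: "e > 0" "\<And>z. z \<in> coord_space J \<Longrightarrow> \<forall>j\<in>J. \<bar>z j - y j\<bar> < e \<Longrightarrow> z \<in> V"
        using openin_contains_coord_box[OF V(1) subset_refl V(2)] by auto
      have "eventually (\<lambda>t. \<bar>\<gamma> t j - y j\<bar> < e) (at t0 within A)" if "j \<in> J" for j
      proof -
        have "((\<lambda>t. \<gamma> t j) \<longlongrightarrow> y j) (at t0 within A)"
          using DERIV_continuous[OF d[rule_format, OF that]] \<gamma>(1) by (simp add: continuous_within)
        then show ?thesis using e(1) by (auto simp: tendsto_iff dist_real_def)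
      qed
      then have "eventually (\<lambda>t. \<forall>j\<in>J. \<bar>\<gamma> t j - y j\<bar> < e) (at t0 within A)"
        using J by (simp add: eventually_ball_finite)
      with \<gamma>(2) show ?thesis
      proof eventually_elim
        case (elim t)
        then show ?case using e(2)[of "\<gamma> t"] TJ V(4)[of "\<gamma> t"] by auto
      qed
    qed
    ultimately show ?thesis
      using \<gamma>(1) V(4)[of y] V(2) y
      by (subst (asm) has_field_derivative_cong_eventually[where g = "\<lambda>t. h (\<gamma> t)"]) auto
  qed
  then show ?thesis by (intro exI[of _ "\<lambda>j. coord_deriv V j h' y"] allI impI)
qed

lemma smooth_at_line_derivative:
  assumes S: "openin (top_of_set (corner I K)) S" and I: "finite I" and g: "smooth_at I S g x" and x: "x \<in> S"
    and i: "i \<in> I"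
  shows "((\<lambda>t. g (x(i := t))) has_real_derivative coord_deriv S i g x) (at (x i) within {t. x(i := t) \<in> S})"
proof -
  let ?A = "{t. x(i := t) \<in> S}"
  obtain a where a: "\<And>(\<gamma>::real \<Rightarrow> _) t0 A d. \<gamma> t0 = x \<Longrightarrow> eventually (\<lambda>t. \<gamma> t \<in> S) (at t0 within A) \<Longrightarrow>
     (\<forall>j\<in>I. ((\<lambda>t. \<gamma> t j) has_real_derivative d j) (at t0 within A)) \<Longrightarrow>
     ((\<lambda>t. g (\<gamma> t)) has_real_derivative (\<Sum>j\<in>I. a j * d j)) (at t0 within A)"
    using smooth_at_curve_aux[OF S I g x] by metis
  have "((\<lambda>t. g (x(i := t))) has_real_derivative (\<Sum>j\<in>I. a j * (if j = i then 1 else 0))) (at (x i) within ?A)"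
  proof (rule a)
    show "eventually (\<lambda>t. x(i := t) \<in> S) (at (x i) within ?A)"
      by (simp add: eventually_at_filter)
    show "\<forall>j\<in>I. ((\<lambda>t. (x(i := t)) j) has_real_derivative (if j = i then 1 else 0)) (at (x i) within ?A)"
      by auto
  qed auto
  moreover from coord_derivI[OF this corner_line_nontrivial[OF S x i]] 
  have "coord_deriv S i g x = (\<Sum>j\<in>I. a j * (if j = i then 1 else 0))" .
  ultimately show ?thesis by simp
qed

text \<open>Tested on the coordinate lines, the coefficients turn out to be the partial derivatives
  taken within \<open>T\<close>. Hence these do not depend on the extension, and the chain rule
  holds up to the boundary.\<close>

lemma smooth_at_curve_derivative:
  assumes T: "openin (top_of_set (corner J L)) T" and J: "finite J" and h: "smooth_at J T h (\<gamma> t0)" and y: "\<gamma> t0 \<in> T"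
    and "eventually (\<lambda>t. \<gamma> t \<in> T) (at t0 within A)"
    and "\<And>j. j \<in> J \<Longrightarrow> ((\<lambda>t::real. \<gamma> t j) has_real_derivative d j) (at t0 within A)"
  shows "((\<lambda>t. h (\<gamma> t)) has_real_derivative (\<Sum>j\<in>J. coord_deriv T j h (\<gamma> t0) * d j)) (at t0 within A)"
proof -
  obtain a where a: "\<And>(\<gamma>'::real \<Rightarrow> _) t0' A d. \<gamma>' t0' = \<gamma> t0 \<Longrightarrow> eventually (\<lambda>t. \<gamma>' t \<in> T) (at t0' within A) \<Longrightarrow>
     (\<forall>j\<in>J. ((\<lambda>t. \<gamma>' t j) has_real_derivative d j) (at t0' within A)) \<Longrightarrow>
     ((\<lambda>t. h (\<gamma>' t)) has_real_derivative (\<Sum>j\<in>J. a j * d j)) (at t0' within A)"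
    using smooth_at_curve_aux[OF T J h y] by metis
  have "coord_deriv T i h (\<gamma> t0) = a i" if i: "i \<in> J" for i
  proof -
    let ?A = "{t. (\<gamma> t0)(i := t) \<in> T}"
    have "((\<lambda>t. h ((\<gamma> t0)(i := t))) has_real_derivative (\<Sum>j\<in>J. a j * (if j = i then 1 else 0))) (at (\<gamma> t0 i) within ?A)"
    proof (rule a)
      show "eventually (\<lambda>t. (\<gamma> t0)(i := t) \<in> T) (at (\<gamma> t0 i) within ?A)"
        by (simp add: eventually_at_filter)
      show "\<forall>j\<in>J. ((\<lambda>t. ((\<gamma> t0)(i := t)) j) has_real_derivative (if j = i then 1 else 0)) (at (\<gamma> t0 i) within ?A)"
        by auto
    qed auto
    then show ?thesis
      using coord_derivI[OF _ corner_line_nontrivial[OF T y i]] i J by (simp add: if_distrib cong: if_cong)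
  qed
  then have "(\<Sum>j\<in>J. coord_deriv T j h (\<gamma> t0) * d j) = (\<Sum>j\<in>J. a j * d j)"
    by simp
  then show ?thesis using a[of \<gamma> t0 A d] assms(5,6) by simp
qed

section \<open>Charts\<close>

abbreviation cindex :: "('a, 'i) chart \<Rightarrow> 'i set" where "cindex c \<equiv> fst c"
abbreviation cbound :: "('a, 'i) chart \<Rightarrow> 'i set" where "cbound c \<equiv> fst (snd c)"
abbreviation cdom :: "('a, 'i) chart \<Rightarrow> 'a set" where "cdom c \<equiv> fst (snd (snd c))"
abbreviation cmap :: "('a, 'i) chart \<Rightarrow> 'a \<Rightarrow> 'i \<Rightarrow> real" where "cmap c \<equiv> snd (snd (snd c))"

definition cinv :: "('a, 'i) chart \<Rightarrow> ('i \<Rightarrow> real) \<Rightarrow> 'a" where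
  "cinv c = inv_into (cdom c) (cmap c)"

definition smooth_in :: "('a, 'i) chart \<Rightarrow> ('a \<Rightarrow> real) \<Rightarrow> 'a \<Rightarrow> bool" where
  "smooth_in c g p \<longleftrightarrow> smooth_at (cindex c) (cmap c ` cdom c) (\<lambda>x. g (cinv c x)) (cmap c p)"

definition chart_partial :: "('a, 'i) chart \<Rightarrow> 'i \<Rightarrow> ('a \<Rightarrow> real) \<Rightarrow> 'a \<Rightarrow> real" where
  "chart_partial c i g p = coord_deriv (cmap c ` cdom c) i (\<lambda>x. g (cinv c x)) (cmap c p)"

lemma chart_deriv_eq: "chart_deriv c g p w = (\<Sum>i\<in>cindex c. w i * chart_partial c i g p)"
  by (cases c) (simp add: chart_partial_def cinv_def)

lemma is_chart_iff:
  "is_chart T n c \<longleftrightarrow> finite (cindex c) \<and> card (cindex c) = n \<and> cbound c \<subseteq> cindex c \<and> openin T (cdom c) \<and>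
     openin (top_of_set (corner (cindex c) (cbound c))) (cmap c ` cdom c) \<and>
     homeomorphic_map (subtopology T (cdom c)) (top_of_set (cmap c ` cdom c)) (cmap c)"
  by (cases c) simp

context
  fixes T :: "'a topology" and n :: nat and c :: "('a, 'i) chart"
  assumes c: "is_chart T n c"
begin

lemma chart_finite: "finite (cindex c)" and chart_card: "card (cindex c) = n"
  and chart_bound: "cbound c \<subseteq> cindex c" and chart_openin_dom: "openin T (cdom c)"
  and chart_openin_range: "openin (top_of_set (corner (cindex c) (cbound c))) (cmap c ` cdom c)"
  and chart_homeo: "homeomorphic_map (subtopology T (cdom c)) (top_of_set (cmap c ` cdom c)) (cmap c)"
  using c by (auto simp: is_chart_iff)

lemma chart_dom_subset: "cdom c \<subseteq> topspace T"
  using chart_openin_dom openin_subset by blast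

lemma topspace_chart_dom [simp]: "topspace (subtopology T (cdom c)) = cdom c"
  using chart_dom_subset by auto

lemma chart_inj: "inj_on (cmap c) (cdom c)"
  using homeomorphic_imp_injective_map[OF chart_homeo] by (simp only: topspace_chart_dom)

lemma cinv_cmap: "q \<in> cdom c \<Longrightarrow> cinv c (cmap c q) = q"
  by (simp add: cinv_def inv_into_f_f[OF chart_inj])

lemma cmap_corner: "q \<in> cdom c \<Longrightarrow> cmap c q \<in> corner (cindex c) (cbound c)"
  using openin_imp_subset[OF chart_openin_range] by blast

lemma cmap_coord: "q \<in> cdom c \<Longrightarrow> cmap c q \<in> coord_space (cindex c)"
  using cmap_corner corner_subset_coord_space by blast

lemma cmap_nonneg: "q \<in> cdom c \<Longrightarrow> i \<in> cbound c \<Longrightarrow> 0 \<le> cmap c q i"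
  using cmap_corner by (auto simp: corner_def)

lemma chart_continuous: "continuous_map (subtopology T (cdom c)) euclidean (cmap c)"
  using homeomorphic_imp_continuous_map[OF chart_homeo] continuous_map_in_subtopology by blast

lemma chart_preimage_open:
  assumes "open N"
  shows "openin T {q \<in> cdom c. cmap c q \<in> N}"
proof -
  have "openin (subtopology T (cdom c)) {q \<in> topspace (subtopology T (cdom c)). cmap c q \<in> N}"
    by (rule openin_continuous_map_preimage[OF chart_continuous open_openin[THEN iffD1, OF assms]])
  then show ?thesis
    using openin_trans_full[OF _ chart_openin_dom] by (simp only: topspace_chart_dom)
qed

lemma chart_image_open:
  assumes "openin T O'" "O' \<subseteq> cdom c"
  shows "\<exists>N. open N \<and> cmap c ` O' = cmap c ` cdom c \<inter> N"
proof -
  have "openin (subtopology T (cdom c)) O'"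
    using assms by (metis inf.absorb_iff2 inf_commute openin_subtopology)
  then have "openin (top_of_set (cmap c ` cdom c)) (cmap c ` O')"
    using homeomorphic_imp_open_map[OF chart_homeo] by (auto simp: open_map_def)
  then show ?thesis by (auto simp: openin_open)
qed

lemma chart_image_openin_corner:
  assumes "openin T O'" "O' \<subseteq> cdom c"
  shows "openin (top_of_set (corner (cindex c) (cbound c))) (cmap c ` O')"
proof -
  obtain N where N: "open N" "cmap c ` O' = cmap c ` cdom c \<inter> N"
    using chart_image_open[OF assms] by blast
  then have "openin (top_of_set (cmap c ` cdom c)) (cmap c ` O')"
    by (auto simp: openin_open)
  then show ?thesis using openin_trans chart_openin_range by blast
qed

text \<open>The chart is a homeomorphism onto its image, so an open part of its domain is cut out of
  the image by an open set \<open>N\<close>, which serves as the neighbourhood for the local test of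
  smoothness.\<close>

lemma smooth_at_shrink_dom:
  assumes "openin T O'" "O' \<subseteq> cdom c" "p \<in> O'"
    and "\<And>q. q \<in> O' \<Longrightarrow> g (cmap c q) = g' (cmap c q)"
    and "smooth_at (cindex c) (cmap c ` O') g (cmap c p)"
  shows "smooth_at (cindex c) (cmap c ` cdom c) g' (cmap c p)"
proof -
  obtain N where N: "open N" "cmap c ` O' = cmap c ` cdom c \<inter> N"
    using chart_image_open[OF assms(1,2)] by blast
  have "cmap c p \<in> coord_space (cindex c) \<inter> N"
    using N(2) assms(2,3) cmap_coord by blast
  moreover have "y \<in> cmap c ` O' \<and> g' y = g y"
    if "y \<in> cmap c ` cdom c \<inter> (coord_space (cindex c) \<inter> N)" for y
  proof -
    have "y \<in> cmap c ` O'" unfolding N(2) using that by blast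
    then obtain q where "q \<in> O'" "y = cmap c q" by blast
    then show ?thesis using assms(4)[of q] by simp
  qed
  ultimately show ?thesis
    using N(1) by (intro smooth_at_local[OF assms(5), of "coord_space (cindex c) \<inter> N"]) auto
qed

lemma smooth_in_line:
  assumes "p \<in> cdom c" "i \<in> cindex c" "smooth_in c g p"
  shows "((\<lambda>t. g (cinv c ((cmap c p)(i := t)))) has_real_derivative chart_partial c i g p)
    (at (cmap c p i) within {t. (cmap c p)(i := t) \<in> cmap c ` cdom c})"
  using smooth_at_line_derivative[OF chart_openin_range chart_finite _ _ assms(2)] assms
  unfolding smooth_in_def chart_partial_def by blast

lemma chart_partialI:
  assumes "p \<in> cdom c" "i \<in> cindex c"
    and "((\<lambda>t. g (cinv c ((cmap c p)(i := t)))) has_real_derivative d)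
    (at (cmap c p i) within {t. (cmap c p)(i := t) \<in> cmap c ` cdom c})"
  shows "chart_partial c i g p = d"
  unfolding chart_partial_def
  by (rule coord_derivI[OF assms(3) corner_line_nontrivial[OF chart_openin_range _ assms(2)]]) (use assms in auto)

text \<open>Translates nearness on a coordinate line into nearness in the manifold, so that facts
  known on a neighbourhood of \<open>p\<close> apply along the line.\<close>

lemma eventually_chart_line:
  assumes "openin T O'" "p \<in> O'" "p \<in> cdom c" "i \<in> cindex c"
  shows "eventually (\<lambda>t. \<exists>q\<in>O' \<inter> cdom c. (cmap c p)(i := t) = cmap c q)
    (at (cmap c p i) within {t. (cmap c p)(i := t) \<in> cmap c ` cdom c})"
proof -
  obtain N where N: "open N" "cmap c ` (O' \<inter> cdom c) = cmap c ` cdom c \<inter> N"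
    using chart_image_open[of "O' \<inter> cdom c"] assms(1) chart_openin_dom by auto
  have "open {t. (cmap c p)(i := t) \<in> N}"
    using N(1) open_vimage[OF N(1) continuous_on_fun_upd[of UNIV "cmap c p" i]] by (simp add: vimage_def)
  moreover have "cmap c p i \<in> {t. (cmap c p)(i := t) \<in> N}"
    using N(2) assms by auto
  ultimately have "eventually (\<lambda>t. (cmap c p)(i := t) \<in> N) (nhds (cmap c p i))"
    using eventually_nhds_in_open by fastforce
  then have "eventually (\<lambda>t. (cmap c p)(i := t) \<in> N) (at (cmap c p i) within {t. (cmap c p)(i := t) \<in> cmap c ` cdom c})"
    by (simp add: eventually_at_filter eventually_mono)
  moreover have "eventually (\<lambda>t. (cmap c p)(i := t) \<in> cmap c ` cdom c) (at (cmap c p i) within {t. (cmap c p)(i := t) \<in> cmap c ` cdom c})"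
    by (simp add: eventually_at_filter)
  ultimately show ?thesis
  proof eventually_elim
    case (elim t)
    then have "(cmap c p)(i := t) \<in> cmap c ` (O' \<inter> cdom c)" using N(2) by blast
    then show ?case by blast
  qed
qed

lemma smooth_in_coord:
  assumes "p \<in> cdom c"
  shows "smooth_in c (\<lambda>q. cmap c q j) p"
proof -
  have "smooth_at (cindex c) (cmap c ` cdom c) (\<lambda>x. x j) (cmap c p)"
    by (intro smooth_at_coord cmap_coord assms)
  then show ?thesis unfolding smooth_in_def
    by (rule smooth_at_shrink_dom[rotated -1]) (use assms cinv_cmap chart_openin_dom in auto)
qed

lemma smooth_in_const: "p \<in> cdom c \<Longrightarrow> smooth_in c (\<lambda>q. a) p"
  unfolding smooth_in_def using smooth_at_const cmap_coord by blast

lemma chart_partial_coord: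
  assumes "p \<in> cdom c" "i \<in> cindex c"
  shows "chart_partial c i (\<lambda>q. cmap c q j) p = (if i = j then 1 else 0)"
proof (rule chart_partialI[OF assms])
  let ?F = "at (cmap c p i) within {t. (cmap c p)(i := t) \<in> cmap c ` cdom c}"
  have "eventually (\<lambda>t. ((cmap c p)(i := t)) j = cmap c (cinv c ((cmap c p)(i := t))) j) ?F"
    using eventually_chart_line[OF chart_openin_dom assms(1,1,2)]
  proof eventually_elim
    case (elim t)
    then obtain q where "q \<in> cdom c" and q: "(cmap c p)(i := t) = cmap c q" by blast
    then show ?case unfolding q by (simp only: cinv_cmap)
  qed
  moreover have "((cmap c p)(i := cmap c p i)) j = cmap c (cinv c ((cmap c p)(i := cmap c p i))) j"
    by (simp only: fun_upd_triv cinv_cmap assms)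
  moreover have "((\<lambda>t. ((cmap c p)(i := t)) j) has_real_derivative (if i = j then 1 else 0)) ?F"
    by auto
  ultimately show "((\<lambda>t. cmap c (cinv c ((cmap c p)(i := t))) j) has_real_derivative (if i = j then 1 else 0)) ?F"
    by (rule has_field_derivative_cong_eventually[THEN iffD1])
qed

text \<open>Only the piece of the coordinate line near \<open>p\<close> matters. With
  \<open>a = 0\<close> this is how a defining function that vanishes on a local boundary
  hypersurface is shown to have vanishing partial derivatives along it.\<close>

lemma chart_partial_eq_0I:
  assumes "p \<in> cdom c" "i \<in> cindex c" "openin T O'" "p \<in> O'"
    and "\<And>q. q \<in> O' \<Longrightarrow> q \<in> cdom c \<Longrightarrow> (\<And>j. j \<noteq> i \<Longrightarrow> cmap c q j = cmap c p j) \<Longrightarrow> g q = a"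
  shows "chart_partial c i g p = 0"
proof (rule chart_partialI[OF assms(1,2)])
  let ?F = "at (cmap c p i) within {t. (cmap c p)(i := t) \<in> cmap c ` cdom c}"
  have "g (cinv c ((cmap c p)(i := t))) = a" if q: "q \<in> O' \<inter> cdom c" "(cmap c p)(i := t) = cmap c q" for q t
  proof -
    have "cmap c q j = cmap c p j" if "j \<noteq> i" for j
      using fun_cong[OF q(2), of j] that by simp
    then show ?thesis using assms(5)[of q] q cinv_cmap by auto
  qed
  then have "eventually (\<lambda>t. a = g (cinv c ((cmap c p)(i := t)))) ?F"
    using eventually_chart_line[OF assms(3,4,1,2)] by (auto elim: eventually_mono)
  moreover have "a = g (cinv c ((cmap c p)(i := cmap c p i)))"
    using assms(1,4,5) by (simp only: fun_upd_triv cinv_cmap)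
  moreover have "((\<lambda>t. a) has_real_derivative 0) ?F"
    by simp
  ultimately show "((\<lambda>t. g (cinv c ((cmap c p)(i := t)))) has_real_derivative 0) ?F"
    by (rule has_field_derivative_cong_eventually[THEN iffD1])
qed

end

text \<open>A coordinate line of \<open>c\<close> is mapped to a curve that stays in the image of
  \<open>d\<close> as long as the line stays in \<open>O'\<close>; differentiation along curves then
  gives the chain rule. With the identity for \<open>f\<close> this is the change of chart.\<close>

lemma
  assumes c: "is_chart T n c" and d: "is_chart T' n' d" and p: "p \<in> cdom c" and fp: "f p \<in> cdom d"
    and O: "openin T O'" "p \<in> O'" "\<And>q. q \<in> O' \<Longrightarrow> f q \<in> cdom d"
    and g: "smooth_in d g (f p)" and f: "\<And>j. j \<in> cindex d \<Longrightarrow> smooth_in c (\<lambda>q. cmap d (f q) j) p"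
  shows smooth_in_compose: "smooth_in c (\<lambda>q. g (f q)) p"
    and chart_partial_compose: "i \<in> cindex c \<Longrightarrow> chart_partial c i (\<lambda>q. g (f q)) p =
      (\<Sum>j\<in>cindex d. chart_partial d j g (f p) * chart_partial c i (\<lambda>q. cmap d (f q) j) p)"
proof -
  define Q where "Q = O' \<inter> cdom c"
  have Q: "openin T Q" "p \<in> Q" "Q \<subseteq> cdom c" "\<And>q. q \<in> Q \<Longrightarrow> f q \<in> cdom d"
    using O p chart_openin_dom[OF c] by (auto simp: Q_def)
  define G where "G y = cmap d (f (cinv c y))" for y
  define h where "h = (\<lambda>y. g (cinv d y))"
  have Gp: "G (cmap c q) = cmap d (f q)" if "q \<in> Q" for q
    using that Q cinv_cmap[OF c] by (auto simp: G_def)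
  have "smooth_at (cindex c) (cmap c ` Q) (\<lambda>y. h (G y)) (cmap c p)"
  proof (rule smooth_at_compose[where h = h and G = G])
    show "cmap c p \<in> coord_space (cindex c)" using cmap_coord[OF c p] .
    show "smooth_at (cindex d) (cmap d ` cdom d) h (G (cmap c p))"
      using g Gp[OF Q(2)] by (simp add: smooth_in_def h_def)
    show "smooth_at (cindex c) (cmap c ` Q) (\<lambda>x. G x j) (cmap c p)" if "j \<in> cindex d" for j
      by (rule smooth_at_subset[OF f[OF that, unfolded smooth_in_def, folded G_def]]) (use Q in auto)
    show "G y \<in> cmap d ` cdom d" if "y \<in> cmap c ` Q" for y
      using that Gp Q by auto
    show "cmap d ` cdom d \<subseteq> coord_space (cindex d)"
      using cmap_coord[OF d] by auto
  qed (use Q chart_finite[OF d] in auto)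
  then show "smooth_in c (\<lambda>q. g (f q)) p"
    unfolding smooth_in_def
    by (rule smooth_at_shrink_dom[OF c Q(1,3,2), rotated])
      (use Gp Q cinv_cmap[OF c] cinv_cmap[OF d] in \<open>auto simp: h_def\<close>)
  show "chart_partial c i (\<lambda>q. g (f q)) p =
      (\<Sum>j\<in>cindex d. chart_partial d j g (f p) * chart_partial c i (\<lambda>q. cmap d (f q) j) p)"
    if i: "i \<in> cindex c"
  proof (rule chart_partialI[OF c p i])
    let ?F = "at (cmap c p i) within {t. (cmap c p)(i := t) \<in> cmap c ` cdom c}"
    let ?\<gamma> = "\<lambda>t. G ((cmap c p)(i := t))"
    have \<gamma>0: "?\<gamma> (cmap c p i) = cmap d (f p)" using Gp[OF Q(2)] by simp
    have ev: "eventually (\<lambda>t. \<exists>q\<in>Q. (cmap c p)(i := t) = cmap c q) ?F"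
      using eventually_chart_line[OF c Q(1,2) p i] by eventually_elim auto
    have "((\<lambda>t. h (?\<gamma> t)) has_real_derivative
        (\<Sum>j\<in>cindex d. coord_deriv (cmap d ` cdom d) j h (?\<gamma> (cmap c p i)) * chart_partial c i (\<lambda>q. cmap d (f q) j) p)) ?F"
    proof (rule smooth_at_curve_derivative[OF chart_openin_range[OF d] chart_finite[OF d]])
      show "smooth_at (cindex d) (cmap d ` cdom d) h (?\<gamma> (cmap c p i))"
        using g \<gamma>0 by (simp add: smooth_in_def h_def)
      show "?\<gamma> (cmap c p i) \<in> cmap d ` cdom d" using \<gamma>0 fp by simp
      show "eventually (\<lambda>t. ?\<gamma> t \<in> cmap d ` cdom d) ?F"
        using ev by eventually_elim (use Gp Q in auto)
      show "((\<lambda>t. ?\<gamma> t j) has_real_derivative chart_partial c i (\<lambda>q. cmap d (f q) j) p) ?F"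
        if "j \<in> cindex d" for j
        using smooth_in_line[OF c p i f[OF that]] by (simp add: G_def)
    qed
    moreover have "coord_deriv (cmap d ` cdom d) j h (?\<gamma> (cmap c p i)) = chart_partial d j g (f p)" for j
      unfolding \<gamma>0 chart_partial_def h_def ..
    moreover have "eventually (\<lambda>t. h (?\<gamma> t) = g (f (cinv c ((cmap c p)(i := t))))) ?F"
      using ev by eventually_elim (use Gp Q cinv_cmap[OF c] cinv_cmap[OF d] in \<open>auto simp: h_def\<close>)
    moreover have "h (?\<gamma> (cmap c p i)) = g (f (cinv c ((cmap c p)(i := cmap c p i))))"
      unfolding \<gamma>0 using cinv_cmap[OF c p] cinv_cmap[OF d fp] by (simp add: h_def)
    ultimately show "((\<lambda>t. g (f (cinv c ((cmap c p)(i := t))))) has_real_derivative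
       (\<Sum>j\<in>cindex d. chart_partial d j g (f p) * chart_partial c i (\<lambda>q. cmap d (f q) j) p)) ?F"
      using has_field_derivative_cong_eventually[of "\<lambda>t. h (?\<gamma> t)" "\<lambda>t. g (f (cinv c ((cmap c p)(i := t))))"]
      by simp
  qed
qed

text \<open>The transition map is given on the overlap. Since the overlap is open, extendability
  from it and from the whole chart image agree near its points.\<close>

lemma compatible_iff:
  assumes c: "is_chart T n c" and d: "is_chart T n d"
  shows "compatible c d \<longleftrightarrow> (\<forall>p\<in>cdom c \<inter> cdom d.
    (\<forall>j\<in>cindex d. smooth_in c (\<lambda>q. cmap d q j) p) \<and> (\<forall>j\<in>cindex c. smooth_in d (\<lambda>q. cmap c q j) p))"
proof -
  have *: "smooth_transition c d \<longleftrightarrow> (\<forall>p\<in>cdom c \<inter> cdom d. \<forall>j\<in>cindex d. smooth_in c (\<lambda>q. cmap d q j) p)"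
    if c: "is_chart T n c" and d: "is_chart T n d" for c d
  proof -
    have "smooth_at (cindex c) (cmap c ` (cdom c \<inter> cdom d)) (\<lambda>x. cmap d (cinv c x) j) (cmap c p) \<longleftrightarrow>
       smooth_in c (\<lambda>q. cmap d q j) p" if "p \<in> cdom c \<inter> cdom d" for p j
      unfolding smooth_in_def
      using smooth_at_shrink_dom[OF c, of "cdom c \<inter> cdom d" p] that chart_openin_dom[OF c] chart_openin_dom[OF d]
      by (auto intro: smooth_at_subset)
    moreover have "smooth_transition c d \<longleftrightarrow> (\<forall>j\<in>cindex d. \<forall>p\<in>cdom c \<inter> cdom d.
      smooth_at (cindex c) (cmap c ` (cdom c \<inter> cdom d)) (\<lambda>x. cmap d (cinv c x) j) (cmap c p))"
      by (cases c; cases d) (simp add: smooth_on_iff cinv_def)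
    ultimately show ?thesis by blast
  qed
  show ?thesis unfolding compatible_def *[OF c d] *[OF d c] by blast
qed

section \<open>Manifolds\<close>

lemma manifold_with_corners_iff:
  "manifold_with_corners M \<longleftrightarrow>
     Hausdorff_space (mtop M) \<and> second_countable (mtop M) \<and>
     (\<forall>c\<in>matlas M. is_chart (mtop M) (mdim M) c) \<and>
     (\<forall>c\<in>matlas M. \<forall>d\<in>matlas M. compatible c d) \<and>
     (\<Union>c\<in>matlas M. cdom c) = mcarrier M"
proof -
  have "(\<Union>(I, K, U, \<phi>)\<in>matlas M. U) = (\<Union>c\<in>matlas M. cdom c)"
    by (intro SUP_cong) (auto simp: split_beta)
  then show ?thesis by (simp add: manifold_with_corners_def)
qed

lemma charts_at_iff: "c \<in> charts_at M p \<longleftrightarrow> c \<in> charts M \<and> p \<in> cdom c"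
  by (cases c) (simp add: charts_at_def)

lemma charts_is_chart: "c \<in> charts M \<Longrightarrow> is_chart (mtop M) (mdim M) c"
  by (simp add: charts_def)

lemma charts_dom: "c \<in> charts M \<Longrightarrow> p \<in> cdom c \<Longrightarrow> p \<in> mcarrier M"
  using charts_is_chart chart_dom_subset by blast

context
  fixes M :: "('a, 'i) manifold"
  assumes M: "manifold_with_corners M"
begin

lemma atlas_is_chart: "c \<in> matlas M \<Longrightarrow> is_chart (mtop M) (mdim M) c"
  using M by (simp add: manifold_with_corners_iff)

lemma atlas_subset_charts: "c \<in> matlas M \<Longrightarrow> c \<in> charts M"
  using M by (simp add: manifold_with_corners_iff charts_def)

lemma atlas_cover: "p \<in> mcarrier M \<Longrightarrow> \<exists>c\<in>matlas M. p \<in> cdom c"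
  using M unfolding manifold_with_corners_iff by blast

text \<open>Members of the maximal atlas are by definition compatible with the given atlas, not with
  each other, so the transition is factored through an atlas chart around \<open>p\<close>.\<close>

lemma charts_transition_smooth:
  assumes "c \<in> charts M" "d \<in> charts M" "p \<in> cdom c" "p \<in> cdom d" "j \<in> cindex d"
  shows "smooth_in c (\<lambda>q. cmap d q j) p"
proof -
  obtain e where e: "e \<in> matlas M" "p \<in> cdom e"
    using atlas_cover[OF charts_dom[OF assms(1,3)]] by blast
  note ce = charts_is_chart[OF assms(1)] atlas_is_chart[OF e(1)]
  note de = charts_is_chart[OF assms(2)] atlas_is_chart[OF e(1)]
  have "compatible c e" "compatible d e" using assms e by (auto simp: charts_def)
  then have "\<forall>j\<in>cindex e. smooth_in c (\<lambda>q. cmap e q j) p" "\<forall>j\<in>cindex d. smooth_in e (\<lambda>q. cmap d q j) p"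
    using assms e unfolding compatible_iff[OF ce] compatible_iff[OF de] by auto
  then show ?thesis
    using assms e chart_openin_dom[OF ce(2)]
    by - (rule smooth_in_compose[OF ce, where f = "\<lambda>q. q" and O' = "cdom e"], auto)
qed

text \<open>Comparison near each point with one chart already in the maximal atlas suffices, since
  the transition to an atlas chart factors through it.\<close>

lemma chartsI:
  assumes c: "is_chart (mtop M) (mdim M) c"
    and "\<And>p. p \<in> cdom c \<Longrightarrow> \<exists>d\<in>charts M. p \<in> cdom d \<and>
      (\<forall>j\<in>cindex d. smooth_in c (\<lambda>q. cmap d q j) p) \<and> (\<forall>j\<in>cindex c. smooth_in d (\<lambda>q. cmap c q j) p)"
  shows "c \<in> charts M"
proof -
  have "compatible c e" if e: "e \<in> matlas M" for e
    unfolding compatible_iff[OF c atlas_is_chart[OF e]]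
  proof
    fix p assume p: "p \<in> cdom c \<inter> cdom e"
    then obtain d where d: "d \<in> charts M" "p \<in> cdom d" "\<And>j. j\<in>cindex d \<Longrightarrow> smooth_in c (\<lambda>q. cmap d q j) p"
       "\<And>j. j\<in>cindex c \<Longrightarrow> smooth_in d (\<lambda>q. cmap c q j) p" using assms(2) by blast
    note ch = charts_is_chart[OF d(1)] atlas_is_chart[OF e]
    have "smooth_in c (\<lambda>q. cmap e q j) p" if "j \<in> cindex e" for j
      by (rule smooth_in_compose[OF c ch(1), where f = "\<lambda>q. q" and O' = "cdom d"])
        (use p d e that chart_openin_dom[OF ch(1)] charts_transition_smooth atlas_subset_charts in auto)
    moreover have "smooth_in e (\<lambda>q. cmap c q j) p" if "j \<in> cindex c" for j
      by (rule smooth_in_compose[OF ch(2) ch(1), where f = "\<lambda>q. q" and O' = "cdom d"])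
        (use p d e that chart_openin_dom[OF ch(1)] charts_transition_smooth atlas_subset_charts in auto)
    ultimately show "(\<forall>j\<in>cindex e. smooth_in c (\<lambda>q. cmap e q j) p) \<and> (\<forall>j\<in>cindex c. smooth_in e (\<lambda>q. cmap c q j) p)"
      by blast
  qed
  then show ?thesis using c by (simp add: charts_def)
qed

lemma
  assumes "c \<in> charts M" "d \<in> charts M" "p \<in> cdom c" "p \<in> cdom d" "smooth_in d g p"
  shows smooth_in_change_chart: "smooth_in c g p"
    and chart_partial_change: "i \<in> cindex c \<Longrightarrow>
      chart_partial c i g p = (\<Sum>j\<in>cindex d. chart_partial d j g p * chart_partial c i (\<lambda>q. cmap d q j) p)"
proof -
  note cd = charts_is_chart[OF assms(1)] charts_is_chart[OF assms(2)]
  note * = assms(3,4) chart_openin_dom[OF cd(2)] assms(4) _ assms(5) charts_transition_smooth[OF assms(1-4)]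
  show "smooth_in c g p"
    using smooth_in_compose[OF cd, where f = "\<lambda>q. q", OF *] by simp
  show "chart_partial c i g p = (\<Sum>j\<in>cindex d. chart_partial d j g p * chart_partial c i (\<lambda>q. cmap d q j) p)"
    if "i \<in> cindex c"
    using chart_partial_compose[OF cd, where f = "\<lambda>q. q", OF *] that by simp
qed

section \<open>Smooth functions, tangent vectors and their differentials in charts\<close>

lemma smooth_fun_iff: "smooth_fun M g \<longleftrightarrow> (\<forall>c\<in>matlas M. \<forall>p\<in>cdom c. smooth_in c g p)"
  unfolding smooth_fun_def smooth_on_iff smooth_in_def cinv_def by (simp add: split_beta)

lemma smooth_funD:
  assumes "smooth_fun M g" "c \<in> charts M" "p \<in> cdom c"
  shows "smooth_in c g p"
proof -
  obtain e where e: "e \<in> matlas M" "p \<in> cdom e"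
    using atlas_cover[OF charts_dom[OF assms(2,3)]] by blast
  then show ?thesis
    using smooth_in_change_chart[OF assms(2) atlas_subset_charts[OF e(1)] assms(3) e(2)] assms(1)
    by (auto simp: smooth_fun_iff)
qed

lemma tangent_space_iff:
  "v \<in> tangent_space M p \<longleftrightarrow>
     (\<forall>c. c \<notin> charts_at M p \<longrightarrow> v c = (\<lambda>_. 0)) \<and>
     (\<forall>c\<in>charts_at M p. v c \<in> coord_space (cindex c)) \<and>
     (\<forall>c\<in>charts_at M p. \<forall>d\<in>charts_at M p. \<forall>j\<in>cindex d.
        v d j = (\<Sum>i\<in>cindex c. v c i * chart_partial c i (\<lambda>q. cmap d q j) p))"
  unfolding tangent_space_def chart_deriv_eq by (simp add: split_beta)

lemma tangent_off: "v \<in> tangent_space M p \<Longrightarrow> c \<notin> charts_at M p \<Longrightarrow> v c = (\<lambda>_. 0)"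
  and tangent_coord: "v \<in> tangent_space M p \<Longrightarrow> c \<in> charts_at M p \<Longrightarrow> v c \<in> coord_space (cindex c)"
  and tangent_transform: "v \<in> tangent_space M p \<Longrightarrow> c \<in> charts_at M p \<Longrightarrow> d \<in> charts_at M p \<Longrightarrow> j \<in> cindex d \<Longrightarrow>
     v d j = (\<Sum>i\<in>cindex c. v c i * chart_partial c i (\<lambda>q. cmap d q j) p)"
  unfolding tangent_space_iff by blast+

lemma tangentI:
  assumes "\<And>c. c \<notin> charts_at M p \<Longrightarrow> v c = (\<lambda>_. 0)"
    and "\<And>c. c \<in> charts_at M p \<Longrightarrow> v c \<in> coord_space (cindex c)"
    and "\<And>c d j. c \<in> charts_at M p \<Longrightarrow> d \<in> charts_at M p \<Longrightarrow> j \<in> cindex d \<Longrightarrow>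
     v d j = (\<Sum>i\<in>cindex c. v c i * chart_partial c i (\<lambda>q. cmap d q j) p)"
  shows "v \<in> tangent_space M p"
  unfolding tangent_space_iff using assms by blast

lemma tangent_eqI:
  assumes "v \<in> tangent_space M p" "v' \<in> tangent_space M p" "c \<in> charts_at M p" "v c = v' c"
  shows "v = v'"
proof
  fix d
  show "v d = v' d"
  proof (cases "d \<in> charts_at M p")
    case True
    show ?thesis
    proof
      fix j show "v d j = v' d j"
      proof (cases "j \<in> cindex d")
        case j: True
        show ?thesis
          unfolding tangent_transform[OF assms(1,3) True j] tangent_transform[OF assms(2,3) True j] assms(4) ..
      next
        case False
        then show ?thesis
          using tangent_coord[OF assms(1) True] tangent_coord[OF assms(2) True] by (simp add: coord_space_zero)
      qed
    qed
  next
    case False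
    then show ?thesis
      using tangent_off assms(1,2) by simp
  qed
qed

text \<open>The components in the other charts are defined by the transformation rule from
  \<open>c\<close>. That the rule then holds between any two charts is the chain rule for transition
  maps.\<close>

lemma tangent_exists:
  assumes c: "c \<in> charts_at M p" and w: "w \<in> coord_space (cindex c)"
  shows "\<exists>v\<in>tangent_space M p. v c = w"
proof -
  have cM: "c \<in> charts M" "p \<in> cdom c" using c by (auto simp: charts_at_iff)
  note ch = charts_is_chart[OF cM(1)]
  define v where "v d = (\<lambda>j. if d \<in> charts_at M p \<and> j \<in> cindex d
     then chart_deriv c (\<lambda>q. cmap d q j) p w else 0)" for d
  have "v c = w"
  proof
    fix j
    show "v c j = w j"
    proof (cases "j \<in> cindex c")
      case True
      have "v c j = (\<Sum>i\<in>cindex c. w i * (if i = j then 1 else 0))"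
        using c True chart_partial_coord[OF ch cM(2)] by (simp add: v_def chart_deriv_eq)
      then show ?thesis using True chart_finite[OF ch] by (simp add: if_distrib cong: if_cong)
    qed (use w in \<open>auto simp: v_def coord_space_def\<close>)
  qed
  moreover have "v \<in> tangent_space M p"
  proof (rule tangentI)
    fix d e j assume d: "d \<in> charts_at M p" and e: "e \<in> charts_at M p" and j: "j \<in> cindex e"
    have dM: "d \<in> charts M" "p \<in> cdom d" and eM: "e \<in> charts M" "p \<in> cdom e"
      using d e by (auto simp: charts_at_iff)
    have "v e j = (\<Sum>i\<in>cindex c. w i * chart_partial c i (\<lambda>q. cmap e q j) p)"
      using e j by (simp add: v_def chart_deriv_eq)
    also have "\<dots> = (\<Sum>i\<in>cindex c. w i * (\<Sum>k\<in>cindex d. chart_partial d k (\<lambda>q. cmap e q j) p * chart_partial c i (\<lambda>q. cmap d q k) p))"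
      using chart_partial_change[OF cM(1) dM(1) cM(2) dM(2) charts_transition_smooth[OF dM(1) eM(1) dM(2) eM(2) j]]
      by (intro sum.cong) auto
    also have "\<dots> = (\<Sum>k\<in>cindex d. (\<Sum>i\<in>cindex c. w i * chart_partial c i (\<lambda>q. cmap d q k) p) * chart_partial d k (\<lambda>q. cmap e q j) p)"
      by (simp add: sum_distrib_left sum_distrib_right, subst sum.swap) (simp add: mult_ac)
    also have "\<dots> = (\<Sum>k\<in>cindex d. v d k * chart_partial d k (\<lambda>q. cmap e q j) p)"
      using d by (simp add: v_def chart_deriv_eq)
    finally show "v e j = (\<Sum>k\<in>cindex d. v d k * chart_partial d k (\<lambda>q. cmap e q j) p)" .
  qed (auto simp: v_def coord_space_def)
  ultimately show ?thesis by blast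
qed

lemma tangent_add:
  assumes "v \<in> tangent_space M p" "u \<in> tangent_space M p"
  shows "(\<lambda>c j. v c j + u c j) \<in> tangent_space M p"
proof (rule tangentI)
  fix c d j assume *: "c \<in> charts_at M p" "d \<in> charts_at M p" "j \<in> cindex d"
  show "v d j + u d j = (\<Sum>i\<in>cindex c. (v c i + u c i) * chart_partial c i (\<lambda>q. cmap d q j) p)"
    unfolding tangent_transform[OF assms(1) *] tangent_transform[OF assms(2) *]
    by (simp add: sum.distrib distrib_right)
next
  fix c assume "c \<in> charts_at M p"
  then show "(\<lambda>j. v c j + u c j) \<in> coord_space (cindex c)"
    using tangent_coord[OF assms(1)] tangent_coord[OF assms(2)] by (auto simp: coord_space_def)
qed (simp add: tangent_off[OF assms(1)] tangent_off[OF assms(2)])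

text \<open>The chart in \<open>fun_differential\<close> is selected by \<open>SOME\<close>; the
  transformation rule and the chain rule carry the value over to any convenient chart.\<close>

lemma fun_differential_eq:
  assumes v: "v \<in> tangent_space M p" and c: "c \<in> charts_at M p" and g: "smooth_in c g p"
  shows "fun_differential M g p v = (\<Sum>i\<in>cindex c. v c i * chart_partial c i g p)"
proof -
  define d where "d = (SOME d. d \<in> charts_at M p)"
  have d: "d \<in> charts_at M p" unfolding d_def using c by (rule someI)
  have cM: "c \<in> charts M" "p \<in> cdom c" and dM: "d \<in> charts M" "p \<in> cdom d"
    using c d by (auto simp: charts_at_iff)
  have "fun_differential M g p v = (\<Sum>i\<in>cindex d. v d i * chart_partial d i g p)"
    by (simp add: fun_differential_def d_def[symmetric] chart_deriv_eq Let_def)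
  also have "\<dots> = (\<Sum>i\<in>cindex d. v d i * (\<Sum>k\<in>cindex c. chart_partial c k g p * chart_partial d i (\<lambda>q. cmap c q k) p))"
    using chart_partial_change[OF dM(1) cM(1) dM(2) cM(2) g] by simp
  also have "\<dots> = (\<Sum>k\<in>cindex c. (\<Sum>i\<in>cindex d. v d i * chart_partial d i (\<lambda>q. cmap c q k) p) * chart_partial c k g p)"
    by (simp add: sum_distrib_left sum_distrib_right, subst sum.swap) (simp add: mult_ac)
  also have "\<dots> = (\<Sum>k\<in>cindex c. v c k * chart_partial c k g p)"
    by (intro sum.cong refl) (simp add: tangent_transform[OF v d c])
  finally show ?thesis .
qed

end

section \<open>Smooth maps and their differentials in charts\<close>

lemma smooth_map_iff:
  "smooth_map M X f \<longleftrightarrow> continuous_map (mtop M) (mtop X) f \<and>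
     (\<forall>c\<in>matlas M. \<forall>d\<in>matlas X. \<forall>j\<in>cindex d. \<forall>p\<in>cdom c. f p \<in> cdom d \<longrightarrow>
        smooth_at (cindex c) (cmap c ` {p \<in> cdom c. f p \<in> cdom d}) (\<lambda>x. cmap d (f (cinv c x)) j) (cmap c p))"
  unfolding smooth_map_def smooth_on_iff cinv_def by (simp add: split_beta) blast

context
  fixes M :: "('a, 'i) manifold" and X :: "('b, 'j) manifold" and f :: "'a \<Rightarrow> 'b"
  assumes M: "manifold_with_corners M" and X: "manifold_with_corners X"
    and f: "continuous_map (mtop M) (mtop X) f"
begin

lemma openin_chart_preimage:
  assumes "d \<in> charts X"
  shows "openin (mtop M) {p \<in> mcarrier M. f p \<in> cdom d}"
  using f chart_openin_dom[OF charts_is_chart[OF assms]] by (auto simp: continuous_map_def)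

lemma smooth_in_change_charts:
  assumes c: "c \<in> charts M" "p \<in> cdom c" and d: "d \<in> charts X" "f p \<in> cdom d"
    and c': "c' \<in> charts M" "p \<in> cdom c'" and d': "d' \<in> charts X" "f p \<in> cdom d'"
    and s: "\<And>j. j \<in> cindex d \<Longrightarrow> smooth_in c (\<lambda>q. cmap d (f q) j) p" and j: "j \<in> cindex d'"
  shows "smooth_in c' (\<lambda>q. cmap d' (f q) j) p"
proof (rule smooth_in_change_chart[OF M c'(1) c(1) c'(2) c(2)])
  have "p \<in> mcarrier M" using charts_dom[OF c] .
  then show "smooth_in c (\<lambda>q. cmap d' (f q) j) p"
    using charts_transition_smooth[OF X d(1) d'(1) d(2) d'(2) j] c d s
    by - (rule smooth_in_compose[OF charts_is_chart[OF c(1)] charts_is_chart[OF d(1)], where f = f and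
          O' = "{p \<in> mcarrier M. f p \<in> cdom d}"], auto intro: openin_chart_preimage)
qed

lemma smooth_at_preimage_iff:
  assumes c: "c \<in> charts M" "p \<in> cdom c" and d: "d \<in> charts X" "f p \<in> cdom d"
  shows "smooth_at (cindex c) (cmap c ` {p \<in> cdom c. f p \<in> cdom d}) (\<lambda>x. cmap d (f (cinv c x)) j) (cmap c p)
     \<longleftrightarrow> smooth_in c (\<lambda>q. cmap d (f q) j) p"
proof -
  have "openin (mtop M) ({p \<in> mcarrier M. f p \<in> cdom d} \<inter> cdom c)"
    using openin_chart_preimage[OF d(1)] chart_openin_dom[OF charts_is_chart[OF c(1)]] by auto
  moreover have "{p \<in> mcarrier M. f p \<in> cdom d} \<inter> cdom c = {p \<in> cdom c. f p \<in> cdom d}"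
    using charts_dom[OF c(1)] by auto
  ultimately have O: "openin (mtop M) {p \<in> cdom c. f p \<in> cdom d}" by simp
  show ?thesis unfolding smooth_in_def
    using smooth_at_shrink_dom[OF charts_is_chart[OF c(1)] O, of p] c d
    by (auto intro: smooth_at_subset)
qed

text \<open>\<open>smooth_map\<close> tests all pairs of atlas charts, but smoothness at a point
  does not depend on the charts, so one pair per point is enough.\<close>

lemma smooth_mapI:
  assumes "\<And>p. p \<in> mcarrier M \<Longrightarrow> \<exists>c\<in>charts M. \<exists>d\<in>charts X. p \<in> cdom c \<and> f p \<in> cdom d \<and>
     (\<forall>j\<in>cindex d. smooth_in c (\<lambda>q. cmap d (f q) j) p)"
  shows "smooth_map M X f"
  unfolding smooth_map_iff
proof (intro conjI f ballI impI)
  fix c d j p assume cd: "c \<in> matlas M" "d \<in> matlas X" "j \<in> cindex d" "p \<in> cdom c" "f p \<in> cdom d"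
  note c = atlas_subset_charts[OF M cd(1)] cd(4)
  note d = atlas_subset_charts[OF X cd(2)] cd(5)
  have "p \<in> mcarrier M" using charts_dom[OF c] .
  then obtain c' d' where c': "c' \<in> charts M" "d' \<in> charts X" "p \<in> cdom c'" "f p \<in> cdom d'"
     "\<forall>j\<in>cindex d'. smooth_in c' (\<lambda>q. cmap d' (f q) j) p" using assms by blast
  show "smooth_at (cindex c) (cmap c ` {p \<in> cdom c. f p \<in> cdom d}) (\<lambda>x. cmap d (f (cinv c x)) j) (cmap c p)"
    unfolding smooth_at_preimage_iff[OF c d]
    using smooth_in_change_charts[OF c'(1,3,2,4) c d] c' cd(3) by blast
qed

lemma smooth_mapD:
  assumes s: "smooth_map M X f" and c: "c \<in> charts M" "p \<in> cdom c" and d: "d \<in> charts X" "f p \<in> cdom d"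
    and j: "j \<in> cindex d"
  shows "smooth_in c (\<lambda>q. cmap d (f q) j) p"
proof -
  have "p \<in> mcarrier M" "f p \<in> mcarrier X" using charts_dom[OF c] charts_dom[OF d] .
  then obtain c' d' where c': "c' \<in> matlas M" "p \<in> cdom c'" and d': "d' \<in> matlas X" "f p \<in> cdom d'"
    using atlas_cover[OF M] atlas_cover[OF X] by metis
  note c'M = atlas_subset_charts[OF M c'(1)] c'(2)
  note d'X = atlas_subset_charts[OF X d'(1)] d'(2)
  have "smooth_in c' (\<lambda>q. cmap d' (f q) j) p" if "j \<in> cindex d'" for j
    using s c' d' that unfolding smooth_map_iff smooth_at_preimage_iff[OF c'M d'X, symmetric] by blast
  then show ?thesis
    using smooth_in_change_charts[OF c'M d'X c d _ j] by blast
qed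

lemma map_differential_eq:
  assumes s: "smooth_map M X f" and v: "v \<in> tangent_space M p" and c: "c \<in> charts_at M p"
    and d: "d \<in> charts_at X (f p)" and j: "j \<in> cindex d"
  shows "map_differential M X f p v d j = (\<Sum>i\<in>cindex c. v c i * chart_partial c i (\<lambda>q. cmap d (f q) j) p)"
proof -
  have "map_differential M X f p v d j = fun_differential M (\<lambda>q. cmap d (f q) j) p v"
    using d j by (cases d) (simp add: map_differential_def)
  then show ?thesis
    using fun_differential_eq[OF M v c smooth_mapD[OF s]] c d j by (simp add: charts_at_iff)
qed

text \<open>The chain rule for a transition map of \<open>X\<close> after \<open>f\<close> is
  exactly the transformation rule for the image vector.\<close>

lemma map_differential_tangent:
  assumes s: "smooth_map M X f" and p: "p \<in> mcarrier M" and v: "v \<in> tangent_space M p"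
  shows "map_differential M X f p v \<in> tangent_space X (f p)"
proof -
  obtain c where "c \<in> matlas M" "p \<in> cdom c"
    using atlas_cover[OF M p] by blast
  then have c: "c \<in> charts_at M p" "c \<in> charts M" "p \<in> cdom c"
    using atlas_subset_charts[OF M] by (auto simp: charts_at_iff)
  have 0: "map_differential M X f p v d j = 0" if "d \<notin> charts_at X (f p) \<or> j \<notin> cindex d" for d j
    using that by (cases d) (auto simp: map_differential_def)
  show ?thesis
  proof (rule tangentI[OF X])
    fix d e j assume d: "d \<in> charts_at X (f p)" and e: "e \<in> charts_at X (f p)" and j: "j \<in> cindex e"
    have dX: "d \<in> charts X" "f p \<in> cdom d" and eX: "e \<in> charts X" "f p \<in> cdom e"
      using d e by (auto simp: charts_at_iff)
    have "chart_partial c i (\<lambda>q. cmap e (f q) j) p =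
       (\<Sum>k\<in>cindex d. chart_partial d k (\<lambda>q. cmap e q j) (f p) * chart_partial c i (\<lambda>q. cmap d (f q) k) p)"
      if "i \<in> cindex c" for i
      using that p c dX smooth_mapD[OF s c(2,3) dX] charts_transition_smooth[OF X dX(1) eX(1) dX(2) eX(2) j]
      by (intro chart_partial_compose[OF charts_is_chart[OF c(2)] charts_is_chart[OF dX(1)], where f = f and
          O' = "{p \<in> mcarrier M. f p \<in> cdom d}"] openin_chart_preimage) auto
    then have "map_differential M X f p v e j =
      (\<Sum>i\<in>cindex c. v c i * (\<Sum>k\<in>cindex d. chart_partial d k (\<lambda>q. cmap e q j) (f p) * chart_partial c i (\<lambda>q. cmap d (f q) k) p))"
      using map_differential_eq[OF s v c(1) e j] by simp
    also have "\<dots> = (\<Sum>k\<in>cindex d. (\<Sum>i\<in>cindex c. v c i * chart_partial c i (\<lambda>q. cmap d (f q) k) p) * chart_partial d k (\<lambda>q. cmap e q j) (f p))"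
      by (simp add: sum_distrib_left sum_distrib_right, subst sum.swap) (simp add: mult_ac)
    also have "\<dots> = (\<Sum>k\<in>cindex d. map_differential M X f p v d k * chart_partial d k (\<lambda>q. cmap e q j) (f p))"
      using map_differential_eq[OF s v c(1) d] by simp
    finally show "map_differential M X f p v e j =
      (\<Sum>k\<in>cindex d. map_differential M X f p v d k * chart_partial d k (\<lambda>q. cmap e q j) (f p))" .
  qed (use 0 in \<open>auto simp: coord_space_def\<close>)
qed

end

section \<open>Depth\<close>

lemma smooth_at_add:
  assumes "smooth_at I S g x" "smooth_at I S h x"
  shows "smooth_at I S (\<lambda>y. g y + h y) x"
proof -
  obtain U g' where U: "coord_open I U" "x \<in> U" "\<And>m. Ck_on m I U g'" "\<And>y. y \<in> S \<inter> U \<Longrightarrow> g' y = g y"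
    using assms(1) unfolding smooth_at_def by blast
  obtain V h' where V: "coord_open I V" "x \<in> V" "\<And>m. Ck_on m I V h'" "\<And>y. y \<in> S \<inter> V \<Longrightarrow> h' y = h y"
    using assms(2) unfolding smooth_at_def by blast
  have UV: "coord_open I (U \<inter> V)" using U V by auto
  have "Ck_on m I (U \<inter> V) (\<lambda>y. g' y + h' y)" for m
    by (intro Ck_on_add[OF UV] Ck_on_subset[OF U(1) UV _ U(3)] Ck_on_subset[OF V(1) UV _ V(3)]) auto
  then show ?thesis
    unfolding smooth_at_def using U V UV by (intro exI[of _ "U \<inter> V"] exI[of _ "\<lambda>y. g' y + h' y"]) auto
qed

lemma smooth_in_add: "smooth_in c g p \<Longrightarrow> smooth_in c h p \<Longrightarrow> smooth_in c (\<lambda>q. g q + h q) p"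
  unfolding smooth_in_def by (rule smooth_at_add)

text \<open>The homeomorphism is certified by an explicit continuous inverse \<open>\<psi>\<close>,
  which is at hand for all charts constructed below.\<close>

lemma is_chartI:
  assumes "finite I" "card I = n" "K \<subseteq> I" "openin T U" "openin (top_of_set (corner I K)) (\<phi> ` U)"
    and \<phi>: "continuous_map (subtopology T U) euclidean \<phi>"
    and \<psi>: "continuous_map (top_of_set (\<phi> ` U)) T \<psi>" "\<And>q. q \<in> U \<Longrightarrow> \<psi> (\<phi> q) = q"
  shows "is_chart T n (I, K, U, \<phi>)"
proof -
  have U: "topspace (subtopology T U) = U" using openin_subset[OF assms(4)] by auto
  have "homeomorphic_maps (subtopology T U) (top_of_set (\<phi> ` U)) \<phi> \<psi>"
    unfolding homeomorphic_maps_def U using \<phi> \<psi>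
    by (auto simp: continuous_map_in_subtopology)
  then have "homeomorphic_map (subtopology T U) (top_of_set (\<phi> ` U)) \<phi>"
    using homeomorphic_maps_map by blast
  then show ?thesis using assms by simp
qed

lemma chart_inverse_continuous:
  assumes c: "is_chart T n c"
  shows "continuous_map (top_of_set (cmap c ` cdom c)) T (cinv c)"
proof -
  obtain g where g: "homeomorphic_maps (subtopology T (cdom c)) (top_of_set (cmap c ` cdom c)) (cmap c) g"
    using chart_homeo[OF c] by (auto simp: homeomorphic_map_maps)
  have "continuous_map (top_of_set (cmap c ` cdom c)) T g"
    using g by (simp add: homeomorphic_maps_def continuous_map_in_subtopology)
  moreover have "g y = cinv c y" if y: "y \<in> cmap c ` cdom c" for y
  proof -
    obtain q where q: "q \<in> cdom c" "y = cmap c q" using y by blast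
    then have "g y = q"
      using g topspace_chart_dom[OF c] unfolding homeomorphic_maps_def by metis
    then show ?thesis using cinv_cmap[OF c q(1)] q(2) by simp
  qed
  ultimately show ?thesis
    by (rule continuous_map_eq) simp
qed

text \<open>The local boundary hypersurfaces of the chart that pass through \<open>p\<close>. In
  contrast to \<open>has_depth\<close>, no chart centred at \<open>p\<close> is involved.\<close>

definition boundary_zeros :: "('a, 'i) chart \<Rightarrow> 'a \<Rightarrow> 'i set" where
  "boundary_zeros c p = {i \<in> cbound c. cmap c p i = 0}"

context
  fixes M :: "('a, 'i) manifold"
  assumes M: "manifold_with_corners M"
begin

text \<open>In a direction that can be followed both ways inside the corner, a nonnegative function that
  vanishes at the base point has derivative zero.\<close>

lemma chart_partial_boundary_zero:
  assumes c: "c \<in> charts M" "p \<in> cdom c" and d: "d \<in> charts M" "p \<in> cdom d"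
    and i: "i \<in> cindex c" "i \<notin> boundary_zeros c p" and k: "k \<in> boundary_zeros d p"
  shows "chart_partial c i (\<lambda>q. cmap d q k) p = 0"
proof -
  note cc = charts_is_chart[OF c(1)] and dd = charts_is_chart[OF d(1)]
  let ?x = "cmap c p"
  let ?A = "{t. ?x(i := t) \<in> cmap c ` cdom c}"
  let ?g = "\<lambda>t. cmap d (cinv c (?x(i := t))) k"
  have kd: "k \<in> cindex d" using k chart_bound[OF dd] by (auto simp: boundary_zeros_def)
  obtain e where e: "e > 0" "\<And>y. y \<in> corner (cindex c) (cbound c) \<Longrightarrow> \<forall>i\<in>cindex c. \<bar>y i - ?x i\<bar> < e \<Longrightarrow> y \<in> cmap c ` cdom c"
    using openin_contains_coord_box[OF chart_openin_range[OF cc] corner_subset_coord_space imageI[OF c(2)]] by blast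
  \<comment> \<open>If \<open>i\<close> is a boundary index, the coordinate is positive at
    \<open>p\<close>, and its value bounds how far the line can be followed backwards.\<close>
  define e' where "e' = (if i \<in> cbound c then min e (?x i) else e)"
  have e': "e' > 0" using e(1) i(2) cmap_nonneg[OF cc c(2), of i]
    by (auto simp: e'_def boundary_zeros_def)
  have "ball (?x i) e' \<subseteq> ?A"
  proof
    fix t assume t: "t \<in> ball (?x i) e'"
    have "?x(i := t) \<in> corner (cindex c) (cbound c)"
      using cmap_corner[OF cc c(2)] t i(1)
      by (auto simp: corner_def coord_space_def e'_def dist_real_def split: if_splits)
    then have "?x(i := t) \<in> cmap c ` cdom c"
      using t e(1) by (intro e(2)) (auto simp: e'_def dist_real_def split: if_splits)
    then show "t \<in> ?A" by simp
  qed
  then have "at (?x i) within ?A = at (?x i)"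
    using e' by (intro at_within_interior) (auto simp: mem_interior)
  then have D: "(?g has_real_derivative chart_partial c i (\<lambda>q. cmap d q k) p) (at (?x i))"
    and ev: "eventually (\<lambda>t. \<exists>q\<in>cdom d \<inter> cdom c. ?x(i := t) = cmap c q) (at (?x i))"
    using smooth_in_line[OF cc c(2) i(1) charts_transition_smooth[OF M c(1) d(1) c(2) d(2) kd]]
      eventually_chart_line[OF cc chart_openin_dom[OF dd] d(2) c(2) i(1)] by simp_all
  have g0: "?g (?x i) = 0" using cinv_cmap[OF cc c(2)] k by (simp add: boundary_zeros_def)
  have "eventually (\<lambda>t. ?g (?x i) \<le> ?g t) (at (?x i))"
    using ev
  proof eventually_elim
    case (elim t)
    then obtain q where q: "q \<in> cdom d" "q \<in> cdom c" "?x(i := t) = cmap c q" by blast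
    show ?case
      unfolding g0 q(3) cinv_cmap[OF cc q(2)]
      using cmap_nonneg[OF dd q(1)] k by (auto simp: boundary_zeros_def)
  qed
  then obtain \<delta> where \<delta>: "\<delta> > 0" "\<And>t. t \<noteq> ?x i \<Longrightarrow> dist t (?x i) < \<delta> \<Longrightarrow> ?g (?x i) \<le> ?g t"
    unfolding eventually_at by blast
  have "\<forall>t. \<bar>?x i - t\<bar> < \<delta> \<longrightarrow> ?g (?x i) \<le> ?g t"
  proof (intro allI impI)
    fix t assume "\<bar>?x i - t\<bar> < \<delta>"
    then show "?g (?x i) \<le> ?g t"
      using \<delta>(2)[of t] by (cases "t = ?x i") (auto simp: dist_real_def abs_minus_commute)
  qed
  then show ?thesis using DERIV_local_min[OF D \<delta>(1)] by blast
qed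

text \<open>Both cardinalities are the trace of the product of the two mutually inverse Jacobian blocks.\<close>

lemma card_boundary_zeros_invariant:
  assumes c: "c \<in> charts M" "p \<in> cdom c" and d: "d \<in> charts M" "p \<in> cdom d"
  shows "card (boundary_zeros c p) = card (boundary_zeros d p)"
proof -
  have fin: "finite (boundary_zeros c p)" if "c \<in> charts M" for c :: "('a, 'i) chart"
    using that chart_bound[OF charts_is_chart] chart_finite[OF charts_is_chart]
    by (metis (no_types, lifting) boundary_zeros_def finite_subset mem_Collect_eq subsetI)
  have *: "real (card (boundary_zeros c p)) = (\<Sum>i\<in>boundary_zeros c p. \<Sum>k\<in>boundary_zeros d p.
      chart_partial d k (\<lambda>q. cmap c q i) p * chart_partial c i (\<lambda>q. cmap d q k) p)"
    if c: "c \<in> charts M" "p \<in> cdom c" and d: "d \<in> charts M" "p \<in> cdom d" for c d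
  proof -
    note cc = charts_is_chart[OF c(1)] and dd = charts_is_chart[OF d(1)]
    have "(\<Sum>k\<in>boundary_zeros d p. chart_partial d k (\<lambda>q. cmap c q i) p * chart_partial c i (\<lambda>q. cmap d q k) p) = 1"
      if i: "i \<in> boundary_zeros c p" for i
    proof -
      have ic: "i \<in> cindex c" using i chart_bound[OF cc] by (auto simp: boundary_zeros_def)
      have sub: "boundary_zeros d p \<subseteq> cindex d" using chart_bound[OF dd] by (auto simp: boundary_zeros_def)
      have "1 = chart_partial c i (\<lambda>q. cmap c q i) p"
        using chart_partial_coord[OF cc c(2) ic] by simp
      also have "\<dots> = (\<Sum>k\<in>cindex d. chart_partial d k (\<lambda>q. cmap c q i) p * chart_partial c i (\<lambda>q. cmap d q k) p)"
        by (rule chart_partial_change[OF M c(1) d(1) c(2) d(2) charts_transition_smooth[OF M d(1) c(1) d(2) c(2) ic] ic])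
      \<comment> \<open>Terms outside the block vanish: the boundary coordinate \<open>i\<close> of
        \<open>c\<close> has derivative zero along every \<open>k\<close> that is not in
        \<open>boundary_zeros d p\<close>.\<close>
      also have "\<dots> = (\<Sum>k\<in>boundary_zeros d p. chart_partial d k (\<lambda>q. cmap c q i) p * chart_partial c i (\<lambda>q. cmap d q k) p)"
        using chart_partial_boundary_zero[OF d c _ _ i]
        by (intro sum.mono_neutral_right chart_finite[OF dd] sub) auto
      finally show ?thesis by simp
    qed
    then show ?thesis by simp
  qed
  have "real (card (boundary_zeros c p)) = real (card (boundary_zeros d p))"
    unfolding *[OF c d] *[OF d c] by (subst sum.swap) (simp add: mult.commute)
  then show ?thesis by simp
qed

lemma has_depth_imp_card:
  assumes "has_depth M p k" "c \<in> charts M" "p \<in> cdom c"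
  shows "card (boundary_zeros c p) = k"
proof -
  obtain d where d: "d \<in> charts_at M p" "cmap d p = (\<lambda>_. 0)" "card (cbound d) = k"
    using assms(1) unfolding has_depth_def by auto
  then have "boundary_zeros d p = cbound d" by (auto simp: boundary_zeros_def)
  then show ?thesis
    using card_boundary_zeros_invariant[OF assms(2,3), of d] d by (auto simp: charts_at_iff)
qed

text \<open>Translation by \<open>cmap c p\<close> centres the chart. Boundary coordinates that are
  positive at \<open>p\<close> stop being constraints once the domain is shrunk to where they stay
  positive, so exactly the vanishing ones remain as corner directions.\<close>

lemma centred_chart_exists:
  assumes c: "c \<in> charts M" "p \<in> cdom c"
  shows "\<exists>d\<in>charts_at M p. cmap d p = (\<lambda>_. 0) \<and> cbound d = boundary_zeros c p"
proof -
  note cc = charts_is_chart[OF c(1)]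
  define I K Z where "I = cindex c" and "K = cbound c" and "Z = boundary_zeros c p"
  have KI: "K \<subseteq> I" "finite I" using chart_bound[OF cc] chart_finite[OF cc] by (auto simp: I_def K_def)
  have ZK: "Z \<subseteq> K" "\<And>i. i \<in> Z \<Longrightarrow> cmap c p i = 0" by (auto simp: Z_def K_def boundary_zeros_def)
  define P where "P = {x :: 'i \<Rightarrow> real. \<forall>i\<in>K-Z. x i > 0}"
  have P: "open P"
  proof -
    have "P = (\<Inter>i\<in>K-Z. {x. x i > 0})" by (auto simp: P_def)
    moreover have "open {x :: 'i \<Rightarrow> real. x i > 0}" for i
      by (intro open_Collect_less continuous_intros continuous_on_coord)
    ultimately show ?thesis using KI by (auto intro!: open_INT finite_subset[of "K - Z" I])
  qed
  define U where "U = {q \<in> cdom c. cmap c q \<in> P}"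
  have U: "openin (mtop M) U" "U \<subseteq> cdom c"
    using chart_preimage_open[OF cc P] by (auto simp: U_def)
  define \<tau> where "\<tau> x = (\<lambda>i. x i + cmap c p i)" for x :: "'i \<Rightarrow> real"
  define \<phi> where "\<phi> q = (\<lambda>i. cmap c q i - cmap c p i)" for q
  have \<tau>\<phi>: "\<tau> (\<phi> q) = cmap c q" for q by (auto simp: \<tau>_def \<phi>_def)
  have \<tau>: "continuous_on S \<tau>" for S
    unfolding \<tau>_def by (intro continuous_on_coordinatewise_then_product continuous_intros continuous_on_coord)
  have ch: "is_chart (mtop M) (mdim M) (I, Z, U, \<phi>)"
  proof (rule is_chartI)
    show "finite I" "card I = mdim M" "Z \<subseteq> I" "openin (mtop M) U"
      using KI ZK chart_card[OF cc] U by (auto simp: I_def)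
    obtain N where N: "open N" "cmap c ` cdom c = corner I K \<inter> N"
      using chart_openin_range[OF cc] by (auto simp: openin_open I_def K_def)
    have "\<phi> ` U = corner I Z \<inter> \<tau> -` (N \<inter> P)"
    proof (intro equalityI subsetI)
      fix y assume "y \<in> \<phi> ` U"
      then obtain q where q: "q \<in> cdom c" "cmap c q \<in> P" "y = \<phi> q" by (auto simp: U_def)
      have "cmap c q \<in> N" using q(1) N(2) by blast
      moreover have "y \<in> corner I Z"
        using cmap_corner[OF cc q(1)] cmap_corner[OF cc c(2)] ZK q(3)
        by (auto simp: corner_def coord_space_def \<phi>_def I_def K_def)
      ultimately show "y \<in> corner I Z \<inter> \<tau> -` (N \<inter> P)" using q \<tau>\<phi> by auto
    next
      fix y assume y: "y \<in> corner I Z \<inter> \<tau> -` (N \<inter> P)"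
      have "0 \<le> \<tau> y i" if "i \<in> K" for i
      proof (cases "i \<in> Z")
        case True
        then show ?thesis using y ZK(2) by (simp add: corner_def \<tau>_def)
      next
        case False
        then show ?thesis using y that by (auto simp: P_def intro: less_imp_le)
      qed
      then have "\<tau> y \<in> corner I K"
        using y cmap_coord[OF cc c(2)] by (auto simp: corner_def coord_space_def \<tau>_def I_def)
      then have "\<tau> y \<in> cmap c ` cdom c" using N(2) y by auto
      then obtain q where q: "q \<in> cdom c" "\<tau> y = cmap c q" by blast
      then have "q \<in> U" "y = \<phi> q" using y by (auto simp: U_def \<phi>_def \<tau>_def fun_eq_iff eq_diff_eq)
      then show "y \<in> \<phi> ` U" by blast
    qed
    then show "openin (top_of_set (corner I Z)) (\<phi> ` U)"
      using open_vimage[OF open_Int[OF N(1) P] \<tau>] openin_open by metis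
    show "continuous_map (subtopology (mtop M) U) euclidean \<phi>"
    proof -
      have "continuous_map (subtopology (mtop M) U) euclidean (cmap c)"
        using chart_continuous[OF cc] U(2) continuous_map_from_subtopology_mono by blast
      moreover have "continuous_map euclidean euclidean (\<lambda>x. \<lambda>i. x i - cmap c p i)"
        unfolding continuous_map_iff_continuous2
        by (intro continuous_on_coordinatewise_then_product continuous_intros continuous_on_coord)
      ultimately have "continuous_map (subtopology (mtop M) U) euclidean ((\<lambda>x. \<lambda>i. x i - cmap c p i) \<circ> cmap c)"
        by (rule continuous_map_compose)
      then show ?thesis by (simp add: \<phi>_def[abs_def] o_def)
    qed
    have "continuous_map (top_of_set (\<phi> ` U)) (top_of_set (cmap c ` cdom c)) \<tau>"
      using \<tau> \<tau>\<phi> U(2) by (auto simp: continuous_map_iff_continuous)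
    from continuous_map_compose[OF this chart_inverse_continuous[OF cc]]
    show "continuous_map (top_of_set (\<phi> ` U)) (mtop M) (cinv c \<circ> \<tau>)" .
    show "(cinv c \<circ> \<tau>) (\<phi> q) = q" if "q \<in> U" for q
      using that U(2) \<tau>\<phi> cinv_cmap[OF cc] by auto
  qed
  have "(I, Z, U, \<phi>) \<in> charts M"
  proof (rule chartsI[OF M ch])
    fix p' assume "p' \<in> cdom (I, Z, U, \<phi>)"
    then have p': "p' \<in> U" "p' \<in> cdom c" using U(2) by auto
    have "smooth_in (I, Z, U, \<phi>) (\<lambda>q. cmap c q j) p'" for j
      using smooth_in_add[OF smooth_in_coord[OF ch, of p' j] smooth_in_const[OF ch, of p' "cmap c p j"]] p'
      by (simp add: \<phi>_def)
    moreover have "smooth_in c (\<lambda>q. \<phi> q j) p'" for j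
      using smooth_in_add[OF smooth_in_coord[OF cc p'(2), of j] smooth_in_const[OF cc p'(2), of "- cmap c p j"]]
      by (simp add: \<phi>_def)
    ultimately show "\<exists>d\<in>charts M. p' \<in> cdom d \<and>
       (\<forall>j\<in>cindex d. smooth_in (I, Z, U, \<phi>) (\<lambda>q. cmap d q j) p') \<and>
       (\<forall>j\<in>cindex (I, Z, U, \<phi>). smooth_in d (\<lambda>q. cmap (I, Z, U, \<phi>) q j) p')"
      using c(1) p' by (intro bexI[of _ c]) auto
  qed
  moreover have "p \<in> U" using c(2) cmap_nonneg[OF cc c(2)]
    by (fastforce simp: U_def P_def Z_def K_def boundary_zeros_def less_le)
  ultimately show ?thesis
    by (intro bexI[of _ "(I, Z, U, \<phi>)"]) (auto simp: charts_at_iff \<phi>_def Z_def)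
qed

lemma has_depth_iff:
  assumes "c \<in> charts M" "p \<in> cdom c"
  shows "has_depth M p k \<longleftrightarrow> card (boundary_zeros c p) = k"
proof
  assume k: "card (boundary_zeros c p) = k"
  obtain d where "d\<in>charts_at M p" "cmap d p = (\<lambda>_. 0)" "cbound d = boundary_zeros c p"
    using centred_chart_exists[OF assms] by blast
  then show "has_depth M p k"
    unfolding has_depth_def using k by (intro bexI[of _ d]) auto
qed (use has_depth_imp_card assms in auto)

section \<open>The manifold structure of an open face\<close>

context
  fixes k :: nat and F :: "'a set"
  assumes F: "openin (subtopology (mtop M) {p \<in> mcarrier M. has_depth M p k}) F"
begin

lemma open_face_subset: "F \<subseteq> mcarrier M" "p \<in> F \<Longrightarrow> has_depth M p k"
  using openin_subset[OF F] by auto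

lemma open_face_topspace: "mcarrier (open_face_manifold M k F) = F"
  using open_face_subset by (auto simp: open_face_manifold_def)

lemma open_face_atlas:
  "matlas (open_face_manifold M k F) =
     (\<lambda>c. (cindex c - cbound c, {}, cdom c \<inter> F, cmap c)) ` {c \<in> charts M. card (cbound c) = k}"
  by (force simp: open_face_manifold_def image_def)

text \<open>The vanishing boundary coordinates form a subset of \<open>cbound c\<close>, and by the
  depth of \<open>p\<close> it has as many elements as the whole.\<close>

lemma open_face_bound_zero:
  assumes "c \<in> charts M" "card (cbound c) = k" "p \<in> cdom c" "p \<in> F" "i \<in> cbound c"
  shows "cmap c p i = 0"
proof -
  note cc = charts_is_chart[OF assms(1)]
  have "card (boundary_zeros c p) = card (cbound c)"
    using has_depth_imp_card[OF open_face_subset(2) assms(1,3)] assms by simp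
  moreover have "boundary_zeros c p \<subseteq> cbound c" by (auto simp: boundary_zeros_def)
  moreover have "finite (cbound c)"
    using chart_finite[OF cc] chart_bound[OF cc] finite_subset by blast
  ultimately have "boundary_zeros c p = cbound c" by (simp add: card_subset_eq)
  then show ?thesis using assms(5) by (auto simp: boundary_zeros_def)
qed

lemma open_face_is_chart:
  assumes c: "c \<in> charts M" "card (cbound c) = k"
  shows "is_chart (mtop (open_face_manifold M k F)) (mdim (open_face_manifold M k F))
    (cindex c - cbound c, {}, cdom c \<inter> F, cmap c)"
proof -
  note cc = charts_is_chart[OF c(1)]
  let ?D = "{p \<in> mcarrier M. has_depth M p k}"
  let ?I = "cindex c - cbound c"
  obtain Q where Q: "openin (mtop M) Q" "F = Q \<inter> ?D"
    using F by (auto simp: openin_subtopology)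
  have QU: "openin (mtop M) (cdom c \<inter> Q)" using Q chart_openin_dom[OF cc] by auto
  have finb: "finite (cbound c)"
    using chart_finite[OF cc] chart_bound[OF cc] finite_subset by blast
  obtain N where N: "open N" "cmap c ` (cdom c \<inter> Q) = corner (cindex c) (cbound c) \<inter> N"
    using chart_image_openin_corner[OF cc QU] by (auto simp: openin_open)
  \<comment> \<open>Openness of \<open>F\<close> among the points of depth \<open>k\<close> enters
    here: a point of \<open>cdom c \<inter> Q\<close> at which all boundary coordinates vanish has
    depth \<open>k\<close> and thus lies in \<open>F\<close>.\<close>
  have img: "cmap c ` (cdom c \<inter> F) = coord_space ?I \<inter> N"
  proof (intro equalityI subsetI)
    fix y assume "y \<in> cmap c ` (cdom c \<inter> F)"
    then obtain q where q: "q \<in> cdom c" "q \<in> F" "y = cmap c q" by blast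
    then have "y \<in> cmap c ` (cdom c \<inter> Q)" using Q(2) by blast
    then have "y \<in> N" using N(2) by blast
    moreover have "y \<in> coord_space ?I"
      using cmap_coord[OF cc q(1)] open_face_bound_zero[OF c q(1,2)] q(3) by (auto simp: coord_space_def)
    ultimately show "y \<in> coord_space ?I \<inter> N" by blast
  next
    fix y assume y: "y \<in> coord_space ?I \<inter> N"
    then have "y \<in> corner (cindex c) (cbound c)" by (auto simp: corner_def coord_space_def)
    then have "y \<in> cmap c ` (cdom c \<inter> Q)" using N(2) y by blast
    then obtain q where q: "q \<in> cdom c" "q \<in> Q" "y = cmap c q" by blast
    have "boundary_zeros c q = cbound c"
      using y q(3) by (auto simp: boundary_zeros_def coord_space_def)
    then have "has_depth M q k" using has_depth_iff[OF c(1) q(1)] c(2) by simp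
    then have "q \<in> F" using Q(2) q charts_dom[OF c(1) q(1)] by blast
    then show "y \<in> cmap c ` (cdom c \<inter> F)" using q by blast
  qed
  have "is_chart (subtopology (mtop M) F) (mdim M - k) (?I, {}, cdom c \<inter> F, cmap c)"
  proof (rule is_chartI)
    show "finite ?I" using chart_finite[OF cc] by simp
    show "card ?I = mdim M - k"
      using chart_card[OF cc] c(2) chart_bound[OF cc] by (simp add: card_Diff_subset[OF finb])
    show "openin (subtopology (mtop M) F) (cdom c \<inter> F)"
      using chart_openin_dom[OF cc] by (auto simp: openin_subtopology)
    show "openin (top_of_set (corner ?I {})) (cmap c ` (cdom c \<inter> F))"
      using img N(1) by (auto simp: openin_open)
    show "continuous_map (subtopology (subtopology (mtop M) F) (cdom c \<inter> F)) euclidean (cmap c)"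
      unfolding subtopology_subtopology
      by (rule continuous_map_from_subtopology_mono[OF chart_continuous[OF cc]]) auto
    have "continuous_map (top_of_set (cmap c ` (cdom c \<inter> F))) (mtop M) (cinv c)"
      by (rule continuous_map_from_subtopology_mono[OF chart_inverse_continuous[OF cc]]) auto
    then show "continuous_map (top_of_set (cmap c ` (cdom c \<inter> F))) (subtopology (mtop M) F) (cinv c)"
      using cinv_cmap[OF cc] by (auto simp: continuous_map_in_subtopology)
  qed (use cinv_cmap[OF cc] in auto)
  then show ?thesis by (simp add: open_face_manifold_def)
qed

text \<open>The face chart keeps the coordinate map, so restriction to the face is composition with
  the inclusion, whose coordinates are those of the chart itself.\<close>

lemma open_face_smooth_in:
  assumes c: "c \<in> charts M" "card (cbound c) = k" and p: "p \<in> cdom c" "p \<in> F" and g: "smooth_in c g p"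
  shows "smooth_in (cindex c - cbound c, {}, cdom c \<inter> F, cmap c) g p"
proof -
  let ?d = "(cindex c - cbound c, {}, cdom c \<inter> F, cmap c)"
  note dd = open_face_is_chart[OF c] and cc = charts_is_chart[OF c(1)]
  have O: "openin (mtop (open_face_manifold M k F)) (cdom c \<inter> F)"
    using chart_openin_dom[OF dd] by simp
  have s: "smooth_in ?d (\<lambda>q. cmap c q j) p" for j
    using smooth_in_coord[OF dd, of p j] p by simp
  show ?thesis
    using smooth_in_compose[OF dd cc, where f = "\<lambda>q. q" and O' = "cdom c \<inter> F", OF _ _ O _ _ g s] p by auto
qed

lemma open_face_manifold_with_corners: "manifold_with_corners (open_face_manifold M k F)"
  unfolding manifold_with_corners_iff
proof (intro conjI)
  show "Hausdorff_space (mtop (open_face_manifold M k F))" "second_countable (mtop (open_face_manifold M k F))"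
    using M by (auto simp: manifold_with_corners_iff open_face_manifold_def
        Hausdorff_space_subtopology second_countable_subtopology)
  show ch: "\<forall>c\<in>matlas (open_face_manifold M k F). is_chart (mtop (open_face_manifold M k F)) (mdim (open_face_manifold M k F)) c"
    using open_face_is_chart by (auto simp: open_face_atlas)
  show "\<forall>c\<in>matlas (open_face_manifold M k F). \<forall>d\<in>matlas (open_face_manifold M k F). compatible c d"
  proof (intro ballI)
    fix c d assume cd: "c \<in> matlas (open_face_manifold M k F)" "d \<in> matlas (open_face_manifold M k F)"
    then obtain c' d' where c': "c' \<in> charts M" "card (cbound c') = k" "c = (cindex c' - cbound c', {}, cdom c' \<inter> F, cmap c')"
      and d': "d' \<in> charts M" "card (cbound d') = k" "d = (cindex d' - cbound d', {}, cdom d' \<inter> F, cmap d')"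
      by (auto simp: open_face_atlas)
    show "compatible c d"
      unfolding compatible_iff[OF ch[rule_format, OF cd(1)] ch[rule_format, OF cd(2)]]
      using c' d' charts_transition_smooth[OF M c'(1) d'(1)] charts_transition_smooth[OF M d'(1) c'(1)]
      by (auto intro!: open_face_smooth_in)
  qed
  show "(\<Union>c\<in>matlas (open_face_manifold M k F). cdom c) = mcarrier (open_face_manifold M k F)"
  proof (intro equalityI subsetI)
    fix p assume "p \<in> mcarrier (open_face_manifold M k F)"
    then have p: "p \<in> F" by (simp add: open_face_topspace)
    then obtain c where "c \<in> charts_at M p" "card (cbound c) = k"
      using open_face_subset(2)[OF p] unfolding has_depth_def by auto
    then show "p \<in> (\<Union>c\<in>matlas (open_face_manifold M k F). cdom c)"
      using p unfolding open_face_atlas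
      by (intro UN_I[of "(cindex c - cbound c, {}, cdom c \<inter> F, cmap c)"]) (auto simp: charts_at_iff simp del: split_paired_Ex)
  qed (auto simp: open_face_atlas open_face_topspace)
qed

lemma open_face_chart:
  assumes "c \<in> charts M" "card (cbound c) = k"
  shows "(cindex c - cbound c, {}, cdom c \<inter> F, cmap c) \<in> charts (open_face_manifold M k F)"
  using assms by (intro atlas_subset_charts[OF open_face_manifold_with_corners]) (auto simp: open_face_atlas)

lemma open_face_inclusion_continuous: "continuous_map (mtop (open_face_manifold M k F)) (mtop M) (\<lambda>q. q)"
  by (simp add: open_face_manifold_def)

lemma open_face_inclusion_smooth: "smooth_map (open_face_manifold M k F) M (\<lambda>q. q)"
proof (rule smooth_mapI[OF open_face_manifold_with_corners M open_face_inclusion_continuous])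
  fix p assume "p \<in> mcarrier (open_face_manifold M k F)"
  then have p: "p \<in> F" by (simp add: open_face_topspace)
  then obtain c where c: "c \<in> charts M" "p \<in> cdom c" "card (cbound c) = k"
    using open_face_subset(2)[OF p] unfolding has_depth_def by (auto simp: charts_at_iff)
  then show "\<exists>d\<in>charts (open_face_manifold M k F). \<exists>c\<in>charts M. p \<in> cdom d \<and> p \<in> cdom c \<and>
      (\<forall>j\<in>cindex c. smooth_in d (\<lambda>q. cmap c q j) p)"
    using p open_face_chart[OF c(1,3)] smooth_in_coord[OF charts_is_chart[OF c(1)] c(2)]
    by (intro bexI[of _ "(cindex c - cbound c, {}, cdom c \<inter> F, cmap c)"] bexI[of _ c])
      (auto intro!: open_face_smooth_in)
qed

end

end

section \<open>Connectedness\<close>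

text \<open>A continuous function into the discrete space \<open>bool\<close> is constant along each
  segment, and segments join any two points.\<close>

lemma connected_segment_closed:
  assumes "\<And>x y t. x \<in> S \<Longrightarrow> y \<in> S \<Longrightarrow> 0 \<le> t \<Longrightarrow> t \<le> 1 \<Longrightarrow> (\<lambda>i. (1 - t) * x i + t * y i) \<in> S"
  shows "connected (S :: ('i \<Rightarrow> real) set)"
proof (rule connectedI_const)
  fix P :: "('i \<Rightarrow> real) \<Rightarrow> bool" assume P: "continuous_on S P"
  have "P x = P y" if "x \<in> S" "y \<in> S" for x y
  proof -
    let ?\<gamma> = "\<lambda>t. (\<lambda>i. (1 - t) * x i + t * y i)"
    have "continuous_on {0..1::real} ?\<gamma>"
      by (intro continuous_on_coordinatewise_then_product continuous_intros)
    then have "continuous_on {0..1::real} (\<lambda>t. P (?\<gamma> t))"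
      using P assms that by (intro continuous_on_compose2[of S P "{0..1}" ?\<gamma>]) auto
    then obtain b where b: "\<forall>t\<in>{0..1::real}. P (?\<gamma> t) = b"
      using connectedD_const[of "{0..1::real}" "\<lambda>t. P (?\<gamma> t)"] by auto
    have "P x = b" "P y = b"
      using bspec[OF b, of 0] bspec[OF b, of 1] by simp_all
    then show ?thesis by simp
  qed
  then show "\<exists>c. \<forall>s\<in>S. P s = c" by metis
qed

lemma connectedinD:
  assumes "connectedin T S" "openin T E1" "openin T E2" "S \<subseteq> E1 \<union> E2" "E1 \<inter> E2 \<inter> S = {}"
  shows "E1 \<inter> S = {} \<or> E2 \<inter> S = {}"
  using assms unfolding connectedin by metis

text \<open>The union of the other members is open, so each member is open and closed and therefore
  a maximal connected set. In this form the open faces of \<open>X_1\<close>, \<open>X_M\<close> and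
  \<open>M\<close> are computed.\<close>

lemma connected_components_of_eq_partition:
  assumes P: "\<And>P. P \<in> \<P> \<Longrightarrow> P \<noteq> {} \<and> connectedin T P \<and> openin T P"
    and disj: "\<And>P Q. P \<in> \<P> \<Longrightarrow> Q \<in> \<P> \<Longrightarrow> P \<inter> Q \<noteq> {} \<Longrightarrow> P = Q" and U: "\<Union>\<P> = topspace T"
  shows "connected_components_of T = \<P>"
proof -
  have comp: "connected_component_of_set T p = P" if "P \<in> \<P>" "p \<in> P" for P p
  proof -
    have "connectedin T C \<Longrightarrow> p \<in> C \<Longrightarrow> C \<subseteq> P" for C
    proof (rule ccontr)
      assume C: "connectedin T C" "p \<in> C" "\<not> C \<subseteq> P"
      have "openin T (\<Union>(\<P> - {P}))" using P by blast
      moreover have "P \<inter> \<Union>(\<P> - {P}) = {}" using disj that(1) by blast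
      moreover have "C \<subseteq> P \<union> \<Union>(\<P> - {P})" using connectedin_subset_topspace[OF C(1)] U by blast
      moreover have "P \<inter> C \<noteq> {}" "\<Union>(\<P> - {P}) \<inter> C \<noteq> {}"
        using C(2,3) that(2) \<open>C \<subseteq> P \<union> \<Union>(\<P> - {P})\<close> by blast+
      ultimately show False
        using connectedinD[OF C(1), of P "\<Union>(\<P> - {P})"] P[OF that(1)] by blast
    qed
    then show ?thesis
      using P[OF that(1)] that unfolding connected_component_of_def by blast
  qed
  show ?thesis
  proof (intro equalityI subsetI)
    fix C assume "C \<in> connected_components_of T"
    then obtain p where "p \<in> topspace T" "C = connected_component_of_set T p"
      by (auto simp: connected_components_of_def)
    then show "C \<in> \<P>" using comp U by blast
  next
    fix C assume C: "C \<in> \<P>"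
    then obtain p where "p \<in> C" using P by blast
    then show "C \<in> connected_components_of T"
      using comp[OF C] C U unfolding connected_components_of_def by blast
  qed
qed

text \<open>A separation of \<open>D\<close> would extend to \<open>C\<close>: \<open>W E\<close>
  collects the open sets whose trace on \<open>D\<close> lies in \<open>E\<close>. Small traces are
  connected, so the two unions cover \<open>C\<close>; they are nonempty, so the unions cannot
  overlap on \<open>C\<close>.\<close>

lemma connectedin_dense_subset:
  assumes C: "connectedin T C" and D: "D \<subseteq> C"
    and N: "\<And>p Q. p \<in> C \<Longrightarrow> openin T Q \<Longrightarrow> p \<in> Q \<Longrightarrow>
      \<exists>N. openin T N \<and> p \<in> N \<and> N \<subseteq> Q \<and> connectedin T (N \<inter> D) \<and> N \<inter> D \<noteq> {}"
  shows "connectedin T D"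
  unfolding connectedin
proof (intro conjI notI)
  show "D \<subseteq> topspace T" using C D connectedin_subset_topspace by blast
next
  assume "\<exists>E1 E2. openin T E1 \<and> openin T E2 \<and> D \<subseteq> E1 \<union> E2 \<and> E1 \<inter> E2 \<inter> D = {} \<and> E1 \<inter> D \<noteq> {} \<and> E2 \<inter> D \<noteq> {}"
  then obtain E1 E2 where E: "openin T E1" "openin T E2" "D \<subseteq> E1 \<union> E2" "E1 \<inter> E2 \<inter> D = {}"
    "E1 \<inter> D \<noteq> {}" "E2 \<inter> D \<noteq> {}" by blast
  define W where "W E = \<Union>{N. openin T N \<and> N \<inter> D \<subseteq> E}" for E
  have W: "openin T (W E)" for E by (auto simp: W_def)
  have dich: "N \<inter> D \<subseteq> E1 \<or> N \<inter> D \<subseteq> E2" if "connectedin T (N \<inter> D)" for N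
  proof (rule ccontr)
    assume "\<not> ?thesis"
    then have "E1 \<inter> (N \<inter> D) \<noteq> {}" "E2 \<inter> (N \<inter> D) \<noteq> {}" "N \<inter> D \<subseteq> E1 \<union> E2" "E1 \<inter> E2 \<inter> (N \<inter> D) = {}"
      using E(3,4) by blast+
    then show False using connectedinD[OF that E(1,2)] by blast
  qed
  have cov: "C \<subseteq> W E1 \<union> W E2"
  proof
    fix p assume p: "p \<in> C"
    then obtain N where "openin T N" "p \<in> N" "connectedin T (N \<inter> D)"
      using N[OF p openin_topspace] connectedin_subset_topspace[OF C] by blast
    then show "p \<in> W E1 \<union> W E2" using dich[of N] by (auto simp: W_def)
  qed
  have "W E1 \<inter> W E2 \<inter> C = {}"
  proof (rule ccontr)
    assume "W E1 \<inter> W E2 \<inter> C \<noteq> {}"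
    then obtain p N1 N2 where p: "p \<in> C" "p \<in> N1" "p \<in> N2" "openin T N1" "openin T N2" "N1 \<inter> D \<subseteq> E1" "N2 \<inter> D \<subseteq> E2"
      by (auto simp: W_def)
    obtain N' where "N' \<subseteq> N1 \<inter> N2" "N' \<inter> D \<noteq> {}"
      using N[OF p(1), of "N1 \<inter> N2"] p by auto
    then show False using p E(4) by blast
  qed
  moreover have "W E1 \<inter> C \<noteq> {}" "W E2 \<inter> C \<noteq> {}"
    using E D by (auto simp: W_def)
  ultimately show False
    using connectedinD[OF C W W cov] by blast
qed

section \<open>Local structure at the boundary\<close>

text \<open>The convex sets below all have this shape: a box in some coordinates, others zero,
  positive or nonnegative. Lower bounds are treated as upper bounds of the negated
  coordinates.\<close>

lemma corner_box_segment:
  assumes "x \<in> S" "y \<in> S" "0 \<le> t" "t \<le> (1::real)"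
    and S: "S = {x \<in> coord_space I. (\<forall>i\<in>E. \<bar>x i - a i\<bar> < e) \<and> (\<forall>i\<in>A. x i = 0) \<and> (\<forall>i\<in>B. 0 < x i) \<and> (\<forall>i\<in>C. 0 \<le> x i)}"
  shows "(\<lambda>i. (1 - t) * x i + t * y i) \<in> S"
proof -
  have "\<bar>(1 - t) * x i + t * y i - a i\<bar> < e" if "i \<in> E" for i
  proof -
    have "x i < a i + e" "y i < a i + e" "- x i < e - a i" "- y i < e - a i"
      using assms(1,2) that unfolding S by (auto simp: abs_less_iff)
    then have "(1 - t) * x i + t * y i < a i + e" "(1 - t) * - x i + t * - y i < e - a i"
      using assms(3,4) by (intro convex_bound_lt; simp)+
    then show ?thesis by (simp add: abs_less_iff algebra_simps)
  qed
  moreover have "0 < (1 - t) * x i + t * y i" if "i \<in> B" for i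
  proof -
    have "- x i < 0" "- y i < 0" using assms(1,2) that unfolding S by auto
    then have "(1 - t) * - x i + t * - y i < 0" using assms(3,4) by (intro convex_bound_lt; simp)
    then show ?thesis by simp
  qed
  ultimately show ?thesis using assms(1-4) unfolding S by (auto simp: coord_space_def)
qed

text \<open>If the box is so small that boundary coordinates positive at \<open>p\<close> stay
  positive, the points with exactly, or at least, the zeros \<open>A\<close> form a convex subset of
  the box.\<close>

lemma chart_box:
  assumes c: "is_chart T n c" and p: "p \<in> cdom c" and Q: "openin T Q" "p \<in> Q"
  shows "\<exists>N. openin T N \<and> p \<in> N \<and> N \<subseteq> Q \<inter> cdom c \<and> (\<forall>q\<in>N. boundary_zeros c q \<subseteq> boundary_zeros c p) \<and>
    (\<forall>A\<subseteq>boundary_zeros c p. connectedin T {q \<in> N. boundary_zeros c q = A} \<and> {q \<in> N. boundary_zeros c q = A} \<noteq> {} \<and>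
       connectedin T {q \<in> N. A \<subseteq> boundary_zeros c q})"
proof -
  define I K Z a where "I = cindex c" and "K = cbound c" and "Z = boundary_zeros c p" and "a = cmap c p"
  have KI: "K \<subseteq> I" "finite I" using chart_bound[OF c] chart_finite[OF c] by (auto simp: I_def K_def)
  have ZK: "Z \<subseteq> K" "\<And>i. i \<in> Z \<Longrightarrow> a i = 0" "\<And>i. i \<in> K \<Longrightarrow> i \<notin> Z \<Longrightarrow> a i > 0"
    using cmap_nonneg[OF c p] by (auto simp: Z_def K_def a_def boundary_zeros_def less_le)
  have "openin (top_of_set (corner I K)) (cmap c ` (Q \<inter> cdom c))"
    unfolding I_def K_def using Q chart_openin_dom[OF c] by (intro chart_image_openin_corner[OF c]) auto
  from openin_contains_coord_box[OF this corner_subset_coord_space, of a]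
  obtain e0 where e0: "e0 > 0" "\<And>y. y \<in> corner I K \<Longrightarrow> \<forall>i\<in>I. \<bar>y i - a i\<bar> < e0 \<Longrightarrow> y \<in> cmap c ` (Q \<inter> cdom c)"
    using p Q(2) a_def by blast
  \<comment> \<open>Small enough for the box to stay in the image of \<open>Q\<close>, and at most
    every boundary coordinate that is positive at \<open>p\<close>.\<close>
  define e where "e = Min (insert e0 (a ` (K - Z)))"
  have finK: "finite (K - Z)" using KI finite_subset by blast
  have e: "e > 0" "e \<le> e0" "\<And>i. i \<in> K - Z \<Longrightarrow> e \<le> a i"
    using e0(1) ZK finK by (auto simp: e_def)
  define N where "N = {q \<in> cdom c. \<forall>i\<in>I. \<bar>cmap c q i - a i\<bar> < e}"
  have N: "openin T N" "p \<in> N" "N \<subseteq> cdom c"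
    using chart_preimage_open[OF c open_coord_box[OF KI(2)], of a e] e(1) p by (auto simp: N_def a_def)
  have "N \<subseteq> Q"
  proof
    fix q assume q: "q \<in> N"
    then have "cmap c q \<in> cmap c ` (Q \<inter> cdom c)"
      using cmap_corner[OF c, of q] e(2) by (intro e0(2)) (auto simp: N_def I_def K_def)
    then show "q \<in> Q" using chart_inj[OF c] q N(3) by (auto simp: inj_on_def)
  qed
  have bz: "boundary_zeros c q \<subseteq> Z" if "q \<in> N" for q
  proof
    fix i assume i: "i \<in> boundary_zeros c q"
    then have "cmap c q i = 0" "i \<in> K" "i \<in> I" using KI by (auto simp: boundary_zeros_def K_def)
    then show "i \<in> Z" using that e(3)[of i] ZK(3)[of i] unfolding N_def by force
  qed
  have img: "cmap c q \<in> corner I K \<and> (\<forall>i\<in>I. \<bar>cmap c q i - a i\<bar> < e)" if "q \<in> N" for q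
    using that cmap_corner[OF c, of q] by (auto simp: N_def I_def K_def)
  have box: "cinv c x \<in> N \<and> cmap c (cinv c x) = x" if "x \<in> corner I K" "\<forall>i\<in>I. \<bar>x i - a i\<bar> < e" for x
  proof -
    have "x \<in> cmap c ` (Q \<inter> cdom c)" using that e(2) by (intro e0(2)) auto
    then obtain q where q: "q \<in> cdom c" "x = cmap c q" by blast
    then show ?thesis using cinv_cmap[OF c q(1)] that by (simp add: N_def)
  qed
  have conn: "connectedin T {q \<in> N. cmap c q \<in> S}" if "connected S" "S \<subseteq> corner I K" "\<forall>x\<in>S. \<forall>i\<in>I. \<bar>x i - a i\<bar> < e" for S
  proof -
    have eq: "{q \<in> N. cmap c q \<in> S} = cinv c ` S"
    proof (intro equalityI subsetI)
      fix q assume "q \<in> {q \<in> N. cmap c q \<in> S}"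
      then show "q \<in> cinv c ` S" using cinv_cmap[OF c, of q] N(3) by force
    qed (use box that in auto)
    have "S \<subseteq> cmap c ` cdom c"
    proof
      fix x assume "x \<in> S"
      then have "cinv c x \<in> N" "cmap c (cinv c x) = x" using box[of x] that by auto
      then show "x \<in> cmap c ` cdom c" using N(3) by (metis image_eqI subsetD)
    qed
    then have "connectedin (top_of_set (cmap c ` cdom c)) S"
      using that(1) by (simp add: connectedin_subtopology)
    from connectedin_continuous_map_image[OF chart_inverse_continuous[OF c] this]
    show ?thesis by (simp add: eq)
  qed
  have "connectedin T {q \<in> N. boundary_zeros c q = A} \<and> {q \<in> N. boundary_zeros c q = A} \<noteq> {} \<and>
       connectedin T {q \<in> N. A \<subseteq> boundary_zeros c q}" if A: "A \<subseteq> Z" for A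
  proof (intro conjI)
    have AI: "A \<subseteq> I" "A \<subseteq> K" using A ZK KI by auto
    define S1 where "S1 = {x \<in> coord_space I. (\<forall>i\<in>I. \<bar>x i - a i\<bar> < e) \<and> (\<forall>i\<in>A. x i = 0) \<and> (\<forall>i\<in>K-A. 0 < x i) \<and> (\<forall>i\<in>{}. 0 \<le> x i)}"
    define S2 where "S2 = {x \<in> coord_space I. (\<forall>i\<in>I. \<bar>x i - a i\<bar> < e) \<and> (\<forall>i\<in>A. x i = 0) \<and> (\<forall>i\<in>{}. 0 < x i) \<and> (\<forall>i\<in>K. 0 \<le> x i)}"
    have c1: "S1 \<subseteq> corner I K"
    proof
      fix x assume x: "x \<in> S1"
      then have "0 \<le> x i" if "i \<in> K" for i
        using that by (cases "i \<in> A") (auto simp: S1_def intro: less_imp_le)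
      then show "x \<in> corner I K" using x by (auto simp: S1_def corner_def)
    qed
    have c2: "S2 \<subseteq> corner I K"
      by (auto simp: S2_def corner_def)
    have 1: "{q \<in> N. boundary_zeros c q = A} = {q \<in> N. cmap c q \<in> S1}"
    proof (intro Collect_cong conj_cong refl)
      fix q assume "q \<in> N"
      then show "boundary_zeros c q = A \<longleftrightarrow> cmap c q \<in> S1"
        using img[of q] AI by (fastforce simp: S1_def boundary_zeros_def corner_def K_def[symmetric] less_le)
    qed
    have 2: "{q \<in> N. A \<subseteq> boundary_zeros c q} = {q \<in> N. cmap c q \<in> S2}"
    proof (intro Collect_cong conj_cong refl)
      fix q assume "q \<in> N"
      then show "A \<subseteq> boundary_zeros c q \<longleftrightarrow> cmap c q \<in> S2"
        using img[of q] AI by (fastforce simp: S2_def boundary_zeros_def corner_def K_def[symmetric])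
    qed
    have S12: "connected S1" "connected S2"
      by (intro connected_segment_closed corner_box_segment[OF _ _ _ _ S1_def]; assumption)
        (intro connected_segment_closed corner_box_segment[OF _ _ _ _ S2_def]; assumption)
    show "connectedin T {q \<in> N. boundary_zeros c q = A}"
      unfolding 1 by (rule conn[OF S12(1) c1]) (simp add: S1_def)
    show "connectedin T {q \<in> N. A \<subseteq> boundary_zeros c q}"
      unfolding 2 by (rule conn[OF S12(2) c2]) (simp add: S2_def)
    \<comment> \<open>Starting from \<open>p\<close>, the zeros outside \<open>A\<close> are moved
      inwards by \<open>e / 2\<close>; this stays in the box and leaves exactly the boundary
      coordinates in \<open>A\<close> zero.\<close>
    define x where "x = (\<lambda>i. if i \<in> Z - A then e / 2 else a i)"
    have ax: "a \<in> coord_space I" using cmap_coord[OF c p] by (simp add: a_def I_def)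
    have "x \<in> S1"
      using e(1) ZK AI A KI ax by (auto simp: S1_def x_def coord_space_def)
    then have "cinv c x \<in> N \<and> cmap c (cinv c x) = x"
      using c1 by (intro box) (auto simp: S1_def)
    then have "cinv c x \<in> {q \<in> N. cmap c q \<in> S1}" using \<open>x \<in> S1\<close> by simp
    then show "{q \<in> N. boundary_zeros c q = A} \<noteq> {}" unfolding 1 by blast
  qed
  then show ?thesis using N \<open>N \<subseteq> Q\<close> bz unfolding Z_def by (intro exI[of _ N]) blast
qed

section \<open>Hyperfaces through a point\<close>

definition incident :: "nat \<Rightarrow> (nat \<Rightarrow> 'a set) \<Rightarrow> 'a \<Rightarrow> nat set" where
  "incident r H p = {h \<in> {1..r}. p \<in> H h}"

lemma incident_subset: "incident r H p \<subseteq> {1..r}"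
  by (auto simp: incident_def)

locale boundary_data =
  fixes M :: "('a, 'i) manifold" and r :: nat and H :: "nat \<Rightarrow> 'a set" and \<rho> :: "nat \<Rightarrow> 'a \<Rightarrow> real"
  assumes M: "manifold_with_corners M"
    and H: "bij_betw H {1..r} (hyperfaces M)"
    and \<rho>: "\<And>i. i \<in> {1..r} \<Longrightarrow> defining_function M (H i) (\<rho> i)"
begin

abbreviation "inc \<equiv> incident r H"

lemma hyperface_closure:
  assumes "h \<in> {1..r}"
  shows "\<exists>G\<in>open_faces_of_codim M 1. H h = mtop M closure_of G"
proof -
  have "H h \<in> hyperfaces M" using H assms bij_betwE by blast
  then show ?thesis by (auto simp: hyperfaces_def)
qed

lemma hyperface_index:
  assumes "G \<in> open_faces_of_codim M 1"
  shows "\<exists>h\<in>{1..r}. H h = mtop M closure_of G"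
proof -
  have "mtop M closure_of G \<in> H ` {1..r}"
    using assms H by (auto simp: hyperfaces_def bij_betw_def)
  then show ?thesis by auto
qed

lemma hyperface_subset: "h \<in> {1..r} \<Longrightarrow> H h \<subseteq> mcarrier M"
  using hyperface_closure closure_of_subset_topspace by metis

lemma defining_zero: "h \<in> {1..r} \<Longrightarrow> p \<in> mcarrier M \<Longrightarrow> \<rho> h p = 0 \<longleftrightarrow> p \<in> H h"
  using \<rho> unfolding defining_function_def by blast

lemma defining_nonneg: "h \<in> {1..r} \<Longrightarrow> p \<in> mcarrier M \<Longrightarrow> 0 \<le> \<rho> h p"
  using \<rho> unfolding defining_function_def by blast

lemma defining_smooth: "h \<in> {1..r} \<Longrightarrow> smooth_fun M (\<rho> h)"
  using \<rho> unfolding defining_function_def by blast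

text \<open>If \<open>\<rho> h\<close> vanished on two of the local boundary hypersurfaces through \<open>p\<close>, all its partial
  derivatives at \<open>p\<close> would be zero; hence \<open>\<beta>\<close>, which sends a local boundary hypersurface to the
  index of the hyperface that contains it, is injective.\<close>

lemma local_structure:
  assumes c: "c \<in> charts M" "p \<in> cdom c" and Q: "openin (mtop M) Q" "p \<in> Q"
  obtains N \<beta> where "openin (mtop M) N" "p \<in> N" "N \<subseteq> Q \<inter> cdom c"
    "\<And>q. q \<in> N \<Longrightarrow> boundary_zeros c q \<subseteq> boundary_zeros c p"
    "\<And>A. A \<subseteq> boundary_zeros c p \<Longrightarrow> connectedin (mtop M) {q \<in> N. boundary_zeros c q = A}"
    "\<And>A. A \<subseteq> boundary_zeros c p \<Longrightarrow> {q \<in> N. boundary_zeros c q = A} \<noteq> {}"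
    "\<And>A. A \<subseteq> boundary_zeros c p \<Longrightarrow> connectedin (mtop M) {q \<in> N. A \<subseteq> boundary_zeros c q}"
    "inj_on \<beta> (boundary_zeros c p)" "\<And>q. q \<in> N \<Longrightarrow> inc q = \<beta> ` boundary_zeros c q"
proof -
  note cc = charts_is_chart[OF c(1)]
  let ?T = "mtop M" and ?bz = "boundary_zeros c"
  obtain N where N': "openin ?T N \<and> p \<in> N \<and> N \<subseteq> Q \<inter> cdom c \<and> (\<forall>q\<in>N. ?bz q \<subseteq> ?bz p) \<and>
    (\<forall>A\<subseteq>?bz p. connectedin ?T {q \<in> N. ?bz q = A} \<and> {q \<in> N. ?bz q = A} \<noteq> {} \<and>
       connectedin ?T {q \<in> N. A \<subseteq> ?bz q})"
    using chart_box[OF cc c(2) Q] by (elim exE)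
  then have N: "openin ?T N" "p \<in> N" "N \<subseteq> Q \<inter> cdom c" "\<And>q. q \<in> N \<Longrightarrow> ?bz q \<subseteq> ?bz p"
    "\<And>A. A \<subseteq> ?bz p \<Longrightarrow> connectedin ?T {q \<in> N. ?bz q = A}" "\<And>A. A \<subseteq> ?bz p \<Longrightarrow> {q \<in> N. ?bz q = A} \<noteq> {}"
    "\<And>A. A \<subseteq> ?bz p \<Longrightarrow> connectedin ?T {q \<in> N. A \<subseteq> ?bz q}"
    by auto
  define D where "D = {p \<in> mcarrier M. has_depth M p 1}"
  \<comment> \<open>The depth-one part of the local hypersurface \<open>i\<close>; it is connected
    and therefore lies in a single open face of codimension one.\<close>
  define L where "L i = {q \<in> N. ?bz q = {i}}" for i
  have LD: "L i \<subseteq> D" for i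
  proof
    fix q assume q: "q \<in> L i"
    then have "q \<in> cdom c" using N(3) by (auto simp: L_def)
    then show "q \<in> D"
      using q has_depth_iff[OF M c(1), of q 1] charts_dom[OF c(1)] by (auto simp: D_def L_def)
  qed
  have "\<exists>h G. h \<in> {1..r} \<and> G \<in> open_faces_of_codim M 1 \<and> H h = ?T closure_of G \<and> L i \<subseteq> G" if i: "i \<in> ?bz p" for i
  proof -
    have "connectedin (subtopology ?T D) (L i)"
      using N(5)[of "{i}"] i LD by (auto simp: connectedin_subtopology L_def)
    moreover have "topspace (subtopology ?T D) \<noteq> {}"
      using N(6)[of "{i}"] i LD[of i] by (auto simp: L_def D_def)
    ultimately obtain G where G: "G \<in> connected_components_of (subtopology ?T D)" "L i \<subseteq> G"
      using exists_connected_component_of_superset[of "subtopology ?T D" "L i"] by fastforce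
    then have "G \<in> open_faces_of_codim M 1" by (simp add: open_faces_of_codim_def D_def)
    then show ?thesis using hyperface_index G(2) by blast
  qed
  then obtain \<beta> G where \<beta>: "\<And>i. i \<in> ?bz p \<Longrightarrow> \<beta> i \<in> {1..r} \<and> G i \<in> open_faces_of_codim M 1 \<and>
     H (\<beta> i) = ?T closure_of (G i) \<and> L i \<subseteq> G i"
    by metis
  \<comment> \<open>\<open>L i\<close> is dense in the local hypersurface \<open>i\<close>, so the
    closure of the open face containing \<open>L i\<close> contains that hypersurface within
    \<open>N\<close>.\<close>
  have in_H: "q \<in> H (\<beta> i)" if q: "q \<in> N" "i \<in> ?bz q" for q i
  proof -
    have i: "i \<in> ?bz p" using N(4) q by blast
    have qc: "q \<in> cdom c" using q N(3) by blast
    have "\<exists>y. y \<in> L i \<and> y \<in> Q'" if Q': "q \<in> Q'" "openin ?T Q'" for Q'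
    proof -
      have "openin ?T (Q' \<inter> N)" "q \<in> Q' \<inter> N" using Q' N(1) q(1) by auto
      from chart_box[OF cc qc this]
      obtain N' where N': "openin ?T N' \<and> q \<in> N' \<and> N' \<subseteq> Q' \<inter> N \<inter> cdom c \<and> (\<forall>x\<in>N'. ?bz x \<subseteq> ?bz q) \<and>
        (\<forall>A\<subseteq>?bz q. connectedin ?T {x \<in> N'. ?bz x = A} \<and> {x \<in> N'. ?bz x = A} \<noteq> {} \<and>
          connectedin ?T {x \<in> N'. A \<subseteq> ?bz x})"
        by (elim exE)
      then have "{x \<in> N'. ?bz x = {i}} \<noteq> {}" using q(2) by simp
      then show ?thesis using N' by (auto simp: L_def)
    qed
    then have "q \<in> ?T closure_of (L i)"
      using charts_dom[OF c(1) qc] by (auto simp: in_closure_of)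
    then show ?thesis using \<beta>[OF i] closure_of_mono by blast
  qed
  have inj: "inj_on \<beta> (?bz p)"
  proof (rule inj_onI, rule ccontr)
    fix i i' assume i: "i \<in> ?bz p" "i' \<in> ?bz p" "\<beta> i = \<beta> i'" "i \<noteq> i'"
    define h where "h = \<beta> i"
    have h: "h \<in> {1..r}" using \<beta> i by (simp add: h_def)
    have "p \<in> H h" using in_H[OF N(2) i(1)] by (simp add: h_def)
    then obtain v where v: "v \<in> tangent_space M p" "fun_differential M (\<rho> h) p v \<noteq> 0"
      using \<rho>[OF h] unfolding defining_function_def by blast
    have zero: "\<rho> h q = 0" if "q \<in> N" "i \<in> ?bz q \<or> i' \<in> ?bz q" for q
    proof -
      have "q \<in> H h" using in_H[OF that(1), of i] in_H[OF that(1), of i'] that(2) i(3) by (auto simp: h_def)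
      then show ?thesis using defining_zero[OF h] hyperface_subset[OF h] by blast
    qed
    have "chart_partial c j (\<rho> h) p = 0" if j: "j \<in> cindex c" for j
    proof (rule chart_partial_eq_0I[OF cc c(2) j N(1,2)])
      fix q assume q: "q \<in> N" "q \<in> cdom c" "\<And>k. k \<noteq> j \<Longrightarrow> cmap c q k = cmap c p k"
      \<comment> \<open>Moving the single coordinate \<open>j\<close> leaves at least one of the
        coordinates \<open>i\<close> and \<open>i'\<close> at zero.\<close>
      have "i \<in> ?bz q \<or> i' \<in> ?bz q"
        using q(3)[of i] q(3)[of i'] i by (cases "j = i") (auto simp: boundary_zeros_def)
      then show "\<rho> h q = 0" using zero q(1) by blast
    qed
    moreover have "c \<in> charts_at M p" using c by (simp add: charts_at_iff)
    ultimately show False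
      using fun_differential_eq[OF M v(1) _ smooth_funD[OF M defining_smooth[OF h] c], of] v(2) by simp
  qed
  have onto: "h \<in> \<beta> ` ?bz q" if q: "q \<in> N" "h \<in> inc q" for q h
  proof -
    have qc: "q \<in> cdom c" using q N(3) by blast
    have h: "h \<in> {1..r}" "q \<in> H h" using q(2) by (auto simp: incident_def)
    obtain G' where G': "G' \<in> open_faces_of_codim M 1" "H h = ?T closure_of G'"
      using hyperface_closure[OF h(1)] by blast
    \<comment> \<open>Points of depth one are dense in the hyperface. Such a point \<open>y\<close>
      near \<open>q\<close> lies on a single local hypersurface \<open>i\<close>, and the open faces
      \<open>G i\<close> and \<open>G'\<close> share it, so they coincide.\<close>
    have near: "\<exists>i\<in>?bz p. \<beta> i = h \<and> (\<exists>y\<in>Q'. y \<in> cdom c \<and> cmap c y i = 0)" if Q': "openin ?T Q'" "q \<in> Q'" for Q'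
    proof -
      obtain y where y: "y \<in> G'" "y \<in> Q'" "y \<in> N"
        using h(2) Q' N(1) q(1) unfolding G'(2) in_closure_of by (metis IntE IntI openin_Int)
      have yc: "y \<in> cdom c" using y(3) N(3) by blast
      have "y \<in> D" using G'(1) y(1) connected_components_of_subset unfolding open_faces_of_codim_def D_def
        by fastforce
      then have "card (?bz y) = 1" using has_depth_iff[OF M c(1) yc, of 1] by (simp add: D_def)
      then obtain i where i: "?bz y = {i}" by (auto simp: card_1_singleton_iff)
      have ip: "i \<in> ?bz p" using N(4)[OF y(3)] i by blast
      have "y \<in> G i" using \<beta>[OF ip] y(3) i by (auto simp: L_def)
      then have "\<not> disjnt (G i) G'" using y(1) by (auto simp: disjnt_def)
      then have "G i = G'"
        using G'(1) \<beta>[OF ip] connected_components_of_disjoint unfolding open_faces_of_codim_def by blast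
      then have "H (\<beta> i) = H h" using \<beta>[OF ip] G'(2) by simp
      then have "\<beta> i = h" using inj_onD[OF bij_betw_imp_inj_on[OF H] _ _ h(1)] \<beta>[OF ip] by blast
      then show ?thesis using ip i y(2) yc by (auto simp: boundary_zeros_def)
    qed
    from near[OF N(1) q(1)] obtain i where i: "i \<in> ?bz p" "\<beta> i = h" by blast
    have "cmap c q i = 0"
    proof (rule ccontr)
      assume ne: "cmap c q i \<noteq> 0"
      \<comment> \<open>If the coordinate \<open>i\<close> is nonzero at \<open>q\<close>, it is
        nonzero nearby, and points of the hyperface near \<open>q\<close> lie on another local
        hypersurface \<open>i'\<close> with the same index, against the injectivity of
        \<open>\<beta>\<close>.\<close>
      have "open {x :: 'i \<Rightarrow> real. x i \<noteq> 0}"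
        by (intro open_Collect_neq continuous_intros continuous_on_coord)
      from near[OF chart_preimage_open[OF cc this]] qc ne
      obtain i' where "i' \<in> ?bz p" "\<beta> i' = h" "\<exists>y\<in>{q \<in> cdom c. cmap c q i \<noteq> 0}. cmap c y i' = 0" by auto
      moreover from this have "i' = i" using inj i by (auto simp: inj_on_def)
      ultimately show False by auto
    qed
    then have "i \<in> ?bz q" using i(1) by (auto simp: boundary_zeros_def)
    then show ?thesis using i(2) by blast
  qed
  have "inc q = \<beta> ` ?bz q" if q: "q \<in> N" for q
  proof (intro equalityI subsetI)
    fix h assume "h \<in> \<beta> ` ?bz q"
    then obtain i where i: "i \<in> ?bz q" "h = \<beta> i" by blast
    then show "h \<in> inc q" using in_H[OF q i(1)] \<beta>[of i] N(4)[OF q] by (auto simp: incident_def)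
  qed (use onto[OF q] in auto)
  from that[OF N inj this] show ?thesis .
qed

lemma local_incidence:
  assumes c: "c \<in> charts M" "p \<in> cdom c"
  shows "\<exists>N \<beta>. openin (mtop M) N \<and> p \<in> N \<and> inj_on \<beta> (boundary_zeros c p) \<and> (\<forall>q\<in>N. inc q = \<beta> ` boundary_zeros c q)"
proof (rule local_structure[OF c openin_topspace charts_dom[OF c]])
  fix N \<beta> assume "openin (mtop M) N" "p \<in> N" "inj_on \<beta> (boundary_zeros c p)" "\<And>q. q \<in> N \<Longrightarrow> inc q = \<beta> ` boundary_zeros c q"
  then show ?thesis by (intro exI[of _ N] exI[of _ \<beta>]) simp
qed

lemma has_depth_incident:
  assumes "p \<in> mcarrier M"
  shows "has_depth M p k \<longleftrightarrow> card (inc p) = k"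
proof -
  obtain c where "c \<in> matlas M" and p: "p \<in> cdom c" using atlas_cover[OF M assms] by blast
  then have c: "c \<in> charts M" using atlas_subset_charts[OF M] by blast
  obtain N \<beta> where "p \<in> N" "inj_on \<beta> (boundary_zeros c p)" "\<And>q. q \<in> N \<Longrightarrow> inc q = \<beta> ` boundary_zeros c q"
    using local_incidence[OF c p] by blast
  then show ?thesis using has_depth_iff[OF M c p] by (simp add: card_image)
qed

text \<open>In a chart, \<open>\<rho> (\<beta> i)\<close> vanishes on the local hypersurface
  \<open>i\<close>, so at \<open>p\<close> only its partial derivative in direction \<open>i\<close>
  survives, and it is nonzero because the differential is. The system is diagonal and is solved by
  division.\<close>

lemma defining_functions_independent:
  assumes "p \<in> mcarrier M"
  shows "\<exists>v\<in>tangent_space M p. \<forall>h\<in>inc p. fun_differential M (\<rho> h) p v = a h"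
proof -
  obtain c where "c \<in> matlas M" and p: "p \<in> cdom c" using atlas_cover[OF M assms] by blast
  then have c: "c \<in> charts M" using atlas_subset_charts[OF M] by blast
  note cc = charts_is_chart[OF c]
  have cp: "c \<in> charts_at M p" using c p by (simp add: charts_at_iff)
  obtain N \<beta> where N: "openin (mtop M) N" "p \<in> N" "inj_on \<beta> (boundary_zeros c p)" "\<And>q. q \<in> N \<Longrightarrow> inc q = \<beta> ` boundary_zeros c q"
    using local_incidence[OF c p] by blast
  let ?Z = "boundary_zeros c p"
  have ZI: "?Z \<subseteq> cindex c" using chart_bound[OF cc] by (auto simp: boundary_zeros_def)
  define D where "D i = chart_partial c i (\<rho> (\<beta> i)) p" for i
  have \<beta>: "\<beta> i \<in> inc p" if "i \<in> ?Z" for i using N(2,4) that by blast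
  have diff: "fun_differential M (\<rho> (\<beta> i)) p v = v c i * D i" if v: "v \<in> tangent_space M p" and i: "i \<in> ?Z" for v i
  proof -
    have h: "\<beta> i \<in> {1..r}" using \<beta>[OF i] by (auto simp: incident_def)
    have 0: "chart_partial c j (\<rho> (\<beta> i)) p = 0" if j: "j \<in> cindex c" "j \<noteq> i" for j
    proof (rule chart_partial_eq_0I[OF cc p j(1) N(1,2)])
      fix q assume q: "q \<in> N" "q \<in> cdom c" "\<And>k. k \<noteq> j \<Longrightarrow> cmap c q k = cmap c p k"
      have "i \<in> boundary_zeros c q" using q(3)[of i] i j(2) by (auto simp: boundary_zeros_def)
      then have "\<beta> i \<in> inc q" using N(4)[OF q(1)] by blast
      then show "\<rho> (\<beta> i) q = 0"
        using defining_zero[OF h charts_dom[OF c q(2)]] by (auto simp: incident_def)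
    qed
    have "fun_differential M (\<rho> (\<beta> i)) p v = (\<Sum>j\<in>cindex c. v c j * chart_partial c j (\<rho> (\<beta> i)) p)"
      by (rule fun_differential_eq[OF M v cp smooth_funD[OF M defining_smooth[OF h] c p]])
    also have "\<dots> = (\<Sum>j\<in>cindex c. if j = i then v c i * D i else 0)"
      using 0 by (intro sum.cong) (auto simp: D_def)
    finally show ?thesis using i ZI chart_finite[OF cc] by auto
  qed
  have D: "D i \<noteq> 0" if i: "i \<in> ?Z" for i
  proof -
    have "\<beta> i \<in> {1..r}" "p \<in> H (\<beta> i)" using \<beta>[OF i] by (auto simp: incident_def)
    then obtain v where v: "v \<in> tangent_space M p" "fun_differential M (\<rho> (\<beta> i)) p v \<noteq> 0"
      using \<rho> unfolding defining_function_def by blast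
    then show ?thesis using diff[OF v(1) i] by auto
  qed
  define w where "w i = (if i \<in> ?Z then a (\<beta> i) / D i else 0)" for i
  have "w \<in> coord_space (cindex c)" using ZI by (auto simp: w_def coord_space_def)
  then obtain v where v: "v \<in> tangent_space M p" "v c = w"
    using tangent_exists[OF M cp] by blast
  have "fun_differential M (\<rho> h) p v = a h" if "h \<in> inc p" for h
  proof -
    have "h \<in> \<beta> ` ?Z" using that N(4)[OF N(2)] by simp
    then obtain i where i: "i \<in> ?Z" "h = \<beta> i" by (elim imageE)
    then show ?thesis using diff[OF v(1) i(1)] v(2) D[OF i(1)] by (simp add: w_def)
  qed
  then show ?thesis using v(1) by blast
qed

text \<open>Chart-free form of \<open>local_structure\<close>: the injection \<open>\<beta>\<close>
  turns sets of local hypersurfaces into sets of hyperface indices.\<close>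

lemma local_strata:
  assumes "p \<in> mcarrier M" and Q: "openin (mtop M) Q" "p \<in> Q"
  shows "\<exists>N. openin (mtop M) N \<and> p \<in> N \<and> N \<subseteq> Q \<and> (\<forall>A\<subseteq>inc p. connectedin (mtop M) {q \<in> N. inc q = A} \<and>
    {q \<in> N. inc q = A} \<noteq> {} \<and> connectedin (mtop M) {q \<in> N. A \<subseteq> inc q})"
proof -
  obtain c where "c \<in> matlas M" and p: "p \<in> cdom c" using atlas_cover[OF M assms(1)] by blast
  then have c: "c \<in> charts M" using atlas_subset_charts[OF M] by blast
  let ?bz = "boundary_zeros c"
  obtain N \<beta> where N: "openin (mtop M) N" "p \<in> N" "N \<subseteq> Q \<inter> cdom c"
    "\<And>q. q \<in> N \<Longrightarrow> ?bz q \<subseteq> ?bz p"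
    "\<And>A. A \<subseteq> ?bz p \<Longrightarrow> connectedin (mtop M) {q \<in> N. ?bz q = A}"
    "\<And>A. A \<subseteq> ?bz p \<Longrightarrow> {q \<in> N. ?bz q = A} \<noteq> {}"
    "\<And>A. A \<subseteq> ?bz p \<Longrightarrow> connectedin (mtop M) {q \<in> N. A \<subseteq> ?bz q}"
    "inj_on \<beta> (?bz p)" "\<And>q. q \<in> N \<Longrightarrow> inc q = \<beta> ` ?bz q"
    by (rule local_structure[OF c p Q]) (rule that)
  have "connectedin (mtop M) {q \<in> N. inc q = A} \<and> {q \<in> N. inc q = A} \<noteq> {} \<and> connectedin (mtop M) {q \<in> N. A \<subseteq> inc q}"
    if A: "A \<subseteq> inc p" for A
  proof -
    obtain B where B: "B \<subseteq> ?bz p" "A = \<beta> ` B"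
      using A N(2,9) by (metis subset_imageE)
    have "inc q = A \<longleftrightarrow> ?bz q = B" "A \<subseteq> inc q \<longleftrightarrow> B \<subseteq> ?bz q" if q: "q \<in> N" for q
      unfolding N(9)[OF q] B(2) using N(4)[OF q] B(1) N(8)
      by (simp_all add: inj_on_image_eq_iff inj_on_image_subset_iff)
    then have "{q \<in> N. inc q = A} = {q \<in> N. ?bz q = B}" "{q \<in> N. A \<subseteq> inc q} = {q \<in> N. B \<subseteq> ?bz q}"
      by auto
    then show ?thesis using N(5-7)[OF B(1)] by simp
  qed
  then show ?thesis using N(1-3) by blast
qed

end

section \<open>Strata cut out by hyperfaces and separating functions\<close>

locale separated_boundary_data = boundary_data +
  fixes f :: "nat set \<Rightarrow> 'a \<Rightarrow> real"
  assumes connected: "connected_space (mtop M)"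
    and separates: "\<And>J. J \<in> face_indices r H \<Longrightarrow> separates_components M (\<Inter>j\<in>J. H j) (f J)"
    and f_smooth: "\<And>J. J \<in> face_indices r H \<Longrightarrow> smooth_fun M (f J)"
begin

abbreviation "\<J> \<equiv> face_indices r H"

lemma finite_indices: "finite \<J>"
  by (rule finite_subset[of _ "Pow {1..r}"]) (auto simp: face_indices_def)

lemma index_subset: "J \<in> \<J> \<Longrightarrow> J \<subseteq> {1..r}"
  by (auto simp: face_indices_def)

lemma index_inter_eq: "J \<in> \<J> \<Longrightarrow> (\<Inter>j\<in>J. H j) = {q \<in> mcarrier M. J \<subseteq> inc q}"
  using hyperface_subset by (fastforce simp: face_indices_def incident_def)

lemma index_of_incident:
  assumes "J \<subseteq> inc p" "J \<noteq> {}"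
  shows "J \<in> \<J>"
  using assms by (auto simp: face_indices_def incident_def)

lemma separating_integer:
  assumes "J \<in> \<J>" "p \<in> mcarrier M" "J \<subseteq> inc p"
  shows "\<exists>m::int. f J p = of_int m"
proof -
  have "p \<in> (\<Inter>j\<in>J. H j)" using index_inter_eq[OF assms(1)] assms by blast
  then have "f J p \<in> real ` {1..card (connected_components_of (subtopology (mtop M) (\<Inter>j\<in>J. H j)))}"
    using separates[OF assms(1)] unfolding separates_components_def Let_def by blast
  then obtain n :: nat where "f J p = real n" by blast
  then show ?thesis by (metis of_int_of_nat_eq)
qed

text \<open>On a connected set inside \<open>F_J\<close> the values form a connected subset of a
  finite set, hence a single value.\<close>

lemma separating_constant:
  assumes J: "J \<in> \<J>" and C: "connectedin (mtop M) C" "\<And>q. q \<in> C \<Longrightarrow> J \<subseteq> inc q" and pq: "p \<in> C" "q \<in> C"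
  shows "f J p = f J q"
proof -
  let ?F = "\<Inter>j\<in>J. H j"
  have sub: "C \<subseteq> ?F" using index_inter_eq[OF J] C connectedin_subset_topspace by blast
  have cont: "continuous_map (subtopology (mtop M) ?F) euclideanreal (f J)"
    and img: "f J ` ?F \<subseteq> real ` {1..card (connected_components_of (subtopology (mtop M) ?F))}"
    using separates[OF J] unfolding separates_components_def Let_def by auto
  have "connectedin (subtopology (mtop M) ?F) C"
    using C(1) sub by (simp add: connectedin_subtopology)
  then have "connected (f J ` C)"
    using connectedin_continuous_map_image[OF cont] by simp
  moreover have "finite (f J ` C)"
    by (rule finite_subset[OF subset_trans[OF image_mono[OF sub] img]]) simp
  ultimately obtain a where "f J ` C = {a}"
    using connected_finite_iff_sing[of "f J ` C"] pq by blast
  then show ?thesis using imageI[OF pq(1), of "f J"] imageI[OF pq(2), of "f J"] by simp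
qed

text \<open>The points that carry the same data as \<open>p\<close>, incident hyperfaces and levels.
  It is the trace of a cell on \<open>M\<close> and turns out to be the open face of
  \<open>M\<close> through \<open>p\<close>.\<close>

definition stratum :: "'a \<Rightarrow> 'a set" where
  "stratum p = {q \<in> mcarrier M. inc q = inc p \<and> (\<forall>J\<in>\<J>. J \<subseteq> inc p \<longrightarrow> f J q = f J p)}"

text \<open>The stratum of \<open>p\<close> is dense in a connected component of the corresponding face
  (which is all of \<open>M\<close> for interior points), and it is locally connected there.\<close>

lemma stratum_connected:
  assumes p: "p \<in> mcarrier M"
  shows "connectedin (mtop M) (stratum p)"
proof -
  let ?A = "inc p"
  define F where "F = {q \<in> mcarrier M. ?A \<subseteq> inc q}"
  define C where "C = connected_component_of_set (subtopology (mtop M) F) p"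
  have pF: "p \<in> F" using p by (simp add: F_def)
  have CF: "C \<subseteq> F"
    using connected_component_of_subset_topspace[of "subtopology (mtop M) F" p] by (auto simp: C_def)
  have C: "connectedin (mtop M) C"
    using connectedin_connected_component_of[of "subtopology (mtop M) F" p] by (simp add: C_def connectedin_subtopology)
  have max: "S \<subseteq> C" if S: "connectedin (mtop M) S" "S \<subseteq> F" "S \<inter> C \<noteq> {}" for S
  proof -
    let ?X = "subtopology (mtop M) F"
    obtain x where x: "x \<in> S" "x \<in> C" using S(3) by blast
    have "connected_component_of ?X p x" using x(2) by (simp add: C_def)
    then have "C = connected_component_of_set ?X x"
      unfolding C_def by (simp add: connected_component_of_equiv)
    moreover have "connectedin ?X S" using S by (simp add: connectedin_subtopology)
    ultimately show ?thesis using connected_component_of_maximal x(1) by metis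
  qed
  have pC: "p \<in> C" using pF p by (simp add: C_def connected_component_of_refl)
  have D: "stratum p = {q \<in> C. inc q = ?A}"
  proof (intro equalityI subsetI)
    fix q assume q: "q \<in> {q \<in> C. inc q = ?A}"
    have "f J q = f J p" if "J \<in> \<J>" "J \<subseteq> ?A" for J
      by (rule separating_constant[OF that(1) C]) (use q pC CF that in \<open>auto simp: F_def\<close>)
    then show "q \<in> stratum p" using q CF by (auto simp: stratum_def F_def)
  next
    fix q assume q: "q \<in> stratum p"
    then have qM: "q \<in> mcarrier M" "inc q = ?A" by (auto simp: stratum_def)
    have "q \<in> C"
    proof (cases "?A = {}")
      \<comment> \<open>No separating function belongs to the empty index set; for interior points
        the connectedness of \<open>M\<close> takes its place.\<close>
      case True
      then have "F = mcarrier M" by (auto simp: F_def)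
      then have "mcarrier M \<subseteq> C" using connected pC p by (intro max) (auto simp: connectedin_topspace)
      then show ?thesis using qM by blast
    next
      case False
      have A: "?A \<in> \<J>" using index_of_incident False by blast
      then have eq: "f ?A q = f ?A p" using q by (simp add: stratum_def)
      have F: "(\<Inter>j\<in>?A. H j) = F" using index_inter_eq[OF A] by (simp add: F_def)
      let ?X = "subtopology (mtop M) F"
      have "q \<in> F" using qM by (simp add: F_def)
      then have q': "q \<in> topspace ?X" using qM by simp
      have p': "p \<in> topspace ?X" using pF p by simp
      have sep: "\<And>C D p q. C \<in> connected_components_of ?X \<Longrightarrow> D \<in> connected_components_of ?X \<Longrightarrow> C \<noteq> D \<Longrightarrow>
          p \<in> C \<Longrightarrow> q \<in> D \<Longrightarrow> f ?A p \<noteq> f ?A q"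
        using separates[OF A] unfolding separates_components_def Let_def F by blast
      have "connected_component_of_set ?X q = C"
      proof (rule ccontr)
        assume "connected_component_of_set ?X q \<noteq> C"
        then have "f ?A q \<noteq> f ?A p"
          using sep[of "connected_component_of_set ?X q" C q p] q' p' pC connected_component_of_refl[of ?X q]
          by (auto simp: connected_components_of_def C_def)
        then show False using eq by simp
      qed
      then show ?thesis using q' connected_component_of_refl[of ?X q] by auto
    qed
    then show "q \<in> {q \<in> C. inc q = ?A}" using qM by simp
  qed
  show ?thesis unfolding D
  proof (rule connectedin_dense_subset[OF C])
    fix q Q assume q: "q \<in> C" "openin (mtop M) Q" "q \<in> Q"
    then have qM: "q \<in> mcarrier M" "?A \<subseteq> inc q" using CF by (auto simp: F_def)
    obtain N where N': "openin (mtop M) N \<and> q \<in> N \<and> N \<subseteq> Q \<and> (\<forall>A\<subseteq>inc q. connectedin (mtop M) {x \<in> N. inc x = A} \<and>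
      {x \<in> N. inc x = A} \<noteq> {} \<and> connectedin (mtop M) {x \<in> N. A \<subseteq> inc x})"
      using local_strata[OF qM(1) q(2,3)] by (elim exE)
    then have N: "openin (mtop M) N" "q \<in> N" "N \<subseteq> Q"
      "connectedin (mtop M) {x \<in> N. inc x = ?A}" "{x \<in> N. inc x = ?A} \<noteq> {}" "connectedin (mtop M) {x \<in> N. ?A \<subseteq> inc x}"
      using qM(2) by simp_all
    \<comment> \<open>\<open>C\<close> is a full component of \<open>F\<close>, so the connected
      trace of \<open>F\<close> on \<open>N\<close>, which contains \<open>q\<close>, stays in
      \<open>C\<close>. Within \<open>N\<close> the stratum is thus given by
      \<open>inc x = inc p\<close>.\<close>
    have "{x \<in> N. ?A \<subseteq> inc x} \<subseteq> C"
    proof (rule max[OF N(6)])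
      show "{x \<in> N. ?A \<subseteq> inc x} \<subseteq> F" using openin_subset[OF N(1)] by (auto simp: F_def)
      show "{x \<in> N. ?A \<subseteq> inc x} \<inter> C \<noteq> {}" using q(1) N(2) qM(2) by blast
    qed
    then have "N \<inter> {x \<in> C. inc x = ?A} = {x \<in> N. inc x = ?A}" by blast
    then show "\<exists>N. openin (mtop M) N \<and> q \<in> N \<and> N \<subseteq> Q \<and> connectedin (mtop M) (N \<inter> {x \<in> C. inc x = ?A}) \<and>
        N \<inter> {x \<in> C. inc x = ?A} \<noteq> {}"
      using N by (intro exI[of _ N]) simp
  qed auto
qed

text \<open>Near \<open>p\<close> there are points incident to exactly the hyperfaces in
  \<open>A\<close>, and the points incident to at least those form a connected set there, so the
  levels of all \<open>J \<subseteq> A\<close> are inherited. This converts a deeper witness in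
  \<open>M\<close> into one of the right depth.\<close>

lemma incident_shrink:
  assumes p: "p \<in> mcarrier M" and A: "A \<subseteq> inc p"
  shows "\<exists>q\<in>mcarrier M. inc q = A \<and> (\<forall>J\<in>\<J>. J \<subseteq> A \<longrightarrow> f J q = f J p)"
proof -
  obtain N where N': "openin (mtop M) N \<and> p \<in> N \<and> N \<subseteq> mcarrier M \<and> (\<forall>A\<subseteq>inc p. connectedin (mtop M) {x \<in> N. inc x = A} \<and>
      {x \<in> N. inc x = A} \<noteq> {} \<and> connectedin (mtop M) {x \<in> N. A \<subseteq> inc x})"
    using local_strata[OF p openin_topspace p] by (elim exE)
  then have N: "openin (mtop M) N" "p \<in> N" "{x \<in> N. inc x = A} \<noteq> {}" "connectedin (mtop M) {x \<in> N. A \<subseteq> inc x}"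
    using A by simp_all
  then obtain q where q: "q \<in> N" "inc q = A" by blast
  have "f J q = f J p" if "J \<in> \<J>" "J \<subseteq> A" for J
    by (rule separating_constant[OF that(1) N(4)]) (use q that N(2) A in auto)
  then show ?thesis using q openin_subset[OF N(1)] by blast
qed

lemma stratum_self: "p \<in> mcarrier M \<Longrightarrow> p \<in> stratum p"
  by (simp add: stratum_def)

end

section \<open>Open subsets of corners\<close>

text \<open>Boxes with rational centres and radii \<open>1 / (n + 1)\<close> form a countable base;
  finiteness of \<open>I\<close> makes the set of centres countable, whatever the index
  type.\<close>

lemma second_countable_coord_space:
  assumes "finite I"
  shows "second_countable (top_of_set (coord_space I :: ('i \<Rightarrow> real) set))"
proof -
  define B where "B q n = coord_space I \<inter> {y. \<forall>i\<in>I. \<bar>y i - q i\<bar> < 1 / real (Suc n)}" for q :: "'i \<Rightarrow> real" and n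
  define \<B> where "\<B> = (\<lambda>(q, n). B q n) ` ((\<Pi>\<^sub>E i\<in>I. \<rat>) \<times> UNIV)"
  have "countable \<B>"
    unfolding \<B>_def by (intro countable_image countable_SIGMA countable_PiE assms) (auto simp: countable_rat)
  moreover have "openin (top_of_set (coord_space I)) V" if "V \<in> \<B>" for V
    using that open_coord_box[OF assms] by (auto simp: \<B>_def B_def)
  moreover have "\<exists>V\<in>\<B>. x \<in> V \<and> V \<subseteq> U" if U: "openin (top_of_set (coord_space I)) U" "x \<in> U" for U x
  proof -
    obtain e where e: "e > 0" "\<And>y. y \<in> coord_space I \<Longrightarrow> \<forall>i\<in>I. \<bar>y i - x i\<bar> < e \<Longrightarrow> y \<in> U"
      using openin_contains_coord_box[OF U(1) subset_refl U(2)] by blast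
    \<comment> \<open>The way from \<open>x\<close> to \<open>y\<close> is split at the rational
      centre, each part being shorter than \<open>e / 2\<close>.\<close>
    obtain n where n: "1 / real (Suc n) < e / 2"
      using reals_Archimedean[of "e / 2"] e(1) by (auto simp: inverse_eq_divide)
    have "\<exists>q\<in>\<rat>. \<bar>x i - q\<bar> < 1 / real (Suc n)" for i
    proof -
      obtain q where "q \<in> \<rat>" "x i < q" "q < x i + 1 / real (Suc n)"
        using Rats_dense_in_real[of "x i" "x i + 1 / real (Suc n)"] by auto
      then show ?thesis by (intro bexI[of _ q]) auto
    qed
    then obtain q where q: "\<And>i. q i \<in> \<rat>" "\<And>i. \<bar>x i - q i\<bar> < 1 / real (Suc n)" by metis
    define q' where "q' = restrict q I"
    have "B q' n \<in> \<B>" using q(1) by (auto simp: \<B>_def q'_def intro!: image_eqI[of _ _ "(q', n)"])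
    moreover have "x \<in> B q' n" using q(2) U openin_imp_subset[OF U(1)] by (auto simp: B_def q'_def)
    moreover have "B q' n \<subseteq> U"
    proof
      fix y assume y: "y \<in> B q' n"
      have "\<bar>y i - x i\<bar> < e" if i: "i \<in> I" for i
      proof -
        have "\<bar>y i - q i\<bar> < 1 / real (Suc n)" using y i by (auto simp: B_def q'_def)
        then show ?thesis using q(2)[of i] n by linarith
      qed
      then show "y \<in> U" using e(2)[of y] y by (auto simp: B_def)
    qed
    ultimately show ?thesis by blast
  qed
  ultimately show ?thesis unfolding second_countable_def by - (rule exI[of _ \<B>], auto)
qed

text \<open>An open part \<open>W\<close> of a corner with the identity as only atlas chart.
  \<open>X_0\<close>, \<open>X_1\<close> and \<open>X_M\<close> all have this form, and passing from
  one to the next only changes \<open>W\<close>.\<close>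

definition sub_corner :: "'i set \<Rightarrow> 'i set \<Rightarrow> ('i \<Rightarrow> real) set \<Rightarrow> ('i \<Rightarrow> real, 'i) manifold" where
  "sub_corner I K W = \<lparr>mtop = top_of_set W, mdim = card I, matlas = {(I, K, W, \<lambda>x. x)}\<rparr>"

lemma sub_corner_simps [simp]:
  "mtop (sub_corner I K W) = top_of_set W" "mdim (sub_corner I K W) = card I"
  "matlas (sub_corner I K W) = {(I, K, W, \<lambda>x. x)}"
  by (simp_all add: sub_corner_def)

lemma model_manifold_eq: "model_manifold I K = sub_corner I K (corner I K)"
  by (simp add: model_manifold_def sub_corner_def)

lemma submanifold_sub_corner: "submanifold_on (sub_corner I K W) S = sub_corner I K (W \<inter> S)"
  by (auto simp: submanifold_on_def sub_corner_def subtopology_subtopology)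

context
  fixes I K :: "'i set" and W :: "('i \<Rightarrow> real) set"
  assumes I: "finite I" and K: "K \<subseteq> I" and W: "openin (top_of_set (corner I K)) W"
begin

lemma sub_corner_subset: "W \<subseteq> coord_space I"
  using openin_imp_subset[OF W] corner_subset_coord_space by blast

lemma sub_corner_is_chart: "is_chart (top_of_set W) (card I) (I, K, W, \<lambda>x. x)"
  by (rule is_chartI[where \<psi> = "\<lambda>x. x"])
    (use I K W in \<open>auto simp: subtopology_subtopology continuous_map_in_subtopology\<close>)

lemma sub_corner_manifold: "manifold_with_corners (sub_corner I K W)"
  unfolding manifold_with_corners_iff
proof (intro conjI)
  show "Hausdorff_space (mtop (sub_corner I K W))"
  proof -
    have "Hausdorff_space (product_topology (\<lambda>i::'i. euclideanreal) UNIV)"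
      by (simp add: Hausdorff_space_product_topology)
    then show ?thesis by (simp add: euclidean_product_topology Hausdorff_space_subtopology)
  qed
  have "top_of_set W = subtopology (top_of_set (coord_space I)) W"
    using sub_corner_subset by (simp add: subtopology_subtopology inf.absorb2)
  then show "second_countable (mtop (sub_corner I K W))"
    using second_countable_subtopology[OF second_countable_coord_space[OF I]] by simp
  show "\<forall>c\<in>matlas (sub_corner I K W). is_chart (mtop (sub_corner I K W)) (mdim (sub_corner I K W)) c"
    using sub_corner_is_chart by simp
  show "\<forall>c\<in>matlas (sub_corner I K W). \<forall>d\<in>matlas (sub_corner I K W). compatible c d"
    using compatible_iff[OF sub_corner_is_chart sub_corner_is_chart] smooth_in_coord[OF sub_corner_is_chart]
    by simp
qed simp

lemma sub_corner_chart: "(I, K, W, \<lambda>x. x) \<in> charts (sub_corner I K W)"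
  by (rule atlas_subset_charts[OF sub_corner_manifold]) simp

text \<open>Where the coordinates in \<open>K - A\<close> are positive, only those in
  \<open>A\<close> act as boundary coordinates. The atlas of an open face asks for charts with as
  many boundary coordinates as its codimension, and this provides one.\<close>

lemma sub_corner_face_chart:
  assumes A: "A \<subseteq> K"
  shows "(I, A, {x \<in> W. \<forall>i\<in>K-A. 0 < x i}, \<lambda>x. x) \<in> charts (sub_corner I K W)"
proof -
  let ?U = "{x \<in> W. \<forall>i\<in>K-A. 0 < x i}"
  define P where "P = {x :: 'i \<Rightarrow> real. \<forall>i\<in>K-A. x i > 0}"
  have P: "open P"
  proof -
    have "P = (\<Inter>i\<in>K-A. {x. x i > 0})" by (auto simp: P_def)
    moreover have "open {x :: 'i \<Rightarrow> real. x i > 0}" for i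
      by (intro open_Collect_less continuous_intros continuous_on_coord)
    ultimately show ?thesis using K I by (auto intro!: open_INT finite_subset[of "K - A" I])
  qed
  obtain N where N: "open N" "W = corner I K \<inter> N" using W by (auto simp: openin_open)
  have WP: "?U = W \<inter> P" by (auto simp: P_def)
  have "?U = corner I A \<inter> (N \<inter> P)"
    using A by (auto simp: N(2) P_def corner_def) (meson DiffI less_imp_le)
  then have 1: "openin (top_of_set (corner I A)) ?U"
    using N(1) P open_Int openin_open by metis
  have 2: "openin (top_of_set W) ?U"
    unfolding WP using P openin_open by blast
  have ch: "is_chart (mtop (sub_corner I K W)) (mdim (sub_corner I K W)) (I, A, ?U, \<lambda>x. x)"
    by (rule is_chartI[where \<psi> = "\<lambda>x. x"])
      (use I K A 1 2 in \<open>auto simp: continuous_map_in_subtopology subtopology_subtopology\<close>)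
  show ?thesis
  proof (rule chartsI[OF sub_corner_manifold ch], intro bexI[of _ "(I, K, W, \<lambda>x. x)"] conjI ballI)
    fix p j assume p: "p \<in> cdom (I, A, ?U, \<lambda>x. x)"
    then show "p \<in> cdom (I, K, W, \<lambda>x. x)" by simp
    show "smooth_in (I, A, ?U, \<lambda>x. x) (\<lambda>q. cmap (I, K, W, \<lambda>x. x) q j) p"
      using smooth_in_coord[OF ch p] by simp
    show "smooth_in (I, K, W, \<lambda>x. x) (\<lambda>q. cmap (I, A, ?U, \<lambda>x. x) q j) p"
      using smooth_in_coord[OF sub_corner_is_chart, of p] p by simp
  qed (use sub_corner_chart in auto)
qed

lemma sub_corner_has_depth:
  assumes "q \<in> W"
  shows "has_depth (sub_corner I K W) q k \<longleftrightarrow> card {i \<in> K. q i = 0} = k"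
  using has_depth_iff[OF sub_corner_manifold sub_corner_chart, of q] assms by (simp add: boundary_zeros_def)

end

section \<open>Smooth functions and smooth maps into open parts of corners\<close>

lemma smooth_funI:
  assumes M: "manifold_with_corners M"
    and "\<And>p. p \<in> mcarrier M \<Longrightarrow> \<exists>c\<in>charts M. p \<in> cdom c \<and> smooth_in c g p"
  shows "smooth_fun M g"
  unfolding smooth_fun_iff[OF M]
proof (intro ballI)
  fix c p assume c: "c \<in> matlas M" "p \<in> cdom c"
  note cM = atlas_subset_charts[OF M c(1)]
  obtain d where d: "d \<in> charts M" "p \<in> cdom d" "smooth_in d g p"
    using assms(2)[OF charts_dom[OF cM c(2)]] by blast
  show "smooth_in c g p" by (rule smooth_in_change_chart[OF M cM d(1) c(2) d(2,3)])
qed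

text \<open>Near each point \<open>g\<close> is a continuous extension on an open set, restricted
  and pulled back by a chart.\<close>

lemma smooth_fun_continuous:
  assumes M: "manifold_with_corners M" and g: "smooth_fun M g"
  shows "continuous_map (mtop M) euclideanreal g"
proof -
  have "openin (mtop M) {p \<in> mcarrier M. g p \<in> V}" if V: "open V" for V
  proof (subst openin_subopen, intro ballI)
    fix p assume "p \<in> {p \<in> mcarrier M. g p \<in> V}"
    then have p: "p \<in> mcarrier M" "g p \<in> V" by auto
    then obtain c where c: "c \<in> matlas M" "p \<in> cdom c" using atlas_cover[OF M] by blast
    note cM = atlas_subset_charts[OF M c(1)] and cc = atlas_is_chart[OF M c(1)]
    obtain U h where U: "coord_open (cindex c) U" "cmap c p \<in> U" "\<And>m. Ck_on m (cindex c) U h"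
      "\<And>y. y \<in> cmap c ` cdom c \<inter> U \<Longrightarrow> h y = g (cinv c y)"
      using smooth_funD[OF M g cM c(2)] unfolding smooth_in_def smooth_at_def by blast
    have "openin (top_of_set U) (U \<inter> h -` V)"
      using continuous_openin_preimage_gen[OF Ck_on_imp_continuous[OF U(3)] V] .
    then have "coord_open (cindex c) (U \<inter> h -` V)" using openin_trans U(1) by blast
    then obtain N where N: "open N" "U \<inter> h -` V = coord_space (cindex c) \<inter> N"
      by (auto simp: openin_open)
    have hg: "h (cmap c q) = g q" if "q \<in> cdom c" "cmap c q \<in> U" for q
      using U(4)[of "cmap c q"] that cinv_cmap[OF cc] by auto
    have "{q \<in> cdom c. cmap c q \<in> N} \<subseteq> {p \<in> mcarrier M. g p \<in> V}"
    proof
      fix q assume "q \<in> {q \<in> cdom c. cmap c q \<in> N}"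
      then have q: "q \<in> cdom c" "cmap c q \<in> U \<inter> h -` V" unfolding N(2) using cmap_coord[OF cc] by auto
      then show "q \<in> {p \<in> mcarrier M. g p \<in> V}" using hg[of q] charts_dom[OF cM] by auto
    qed
    moreover have "cmap c p \<in> U \<inter> h -` V" using U(2) hg[OF c(2) U(2)] p(2) by simp
    then have "p \<in> {q \<in> cdom c. cmap c q \<in> N}" unfolding N(2) using c(2) by simp
    ultimately show "\<exists>T. openin (mtop M) T \<and> p \<in> T \<and> T \<subseteq> {p \<in> mcarrier M. g p \<in> V}"
      using chart_preimage_open[OF cc N(1)] by blast
  qed
  then show ?thesis by (simp add: continuous_map_def)
qed

lemma continuous_map_into_coord_space:
  assumes "\<And>i. i \<in> I \<Longrightarrow> continuous_map T euclideanreal (\<lambda>p. F p i)"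
    and "\<And>p. p \<in> topspace T \<Longrightarrow> F p \<in> S" "S \<subseteq> coord_space I"
  shows "continuous_map T (top_of_set S) F"
proof -
  have "continuous_map T euclideanreal (\<lambda>p. F p i)" for i
  proof (cases "i \<in> I")
    case False
    have "continuous_map T euclideanreal (\<lambda>p. 0 :: real)" by simp
    then show ?thesis
      by (rule continuous_map_eq) (use assms(2,3) False in \<open>auto simp: coord_space_def\<close>)
  qed (use assms in auto)
  then have "continuous_map T (product_topology (\<lambda>i. euclidean) UNIV) F"
    by (simp add: continuous_map_componentwise_UNIV)
  then show ?thesis
    using assms(2) by (auto simp: euclidean_product_topology continuous_map_in_subtopology)
qed

lemma smooth_map_into_sub_corner:
  assumes M: "manifold_with_corners M" and I: "finite I" and K: "K \<subseteq> I" and W: "openin (top_of_set (corner I K)) W"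
    and FW: "\<And>p. p \<in> mcarrier M \<Longrightarrow> F p \<in> W" and F: "\<And>i. i \<in> I \<Longrightarrow> smooth_fun M (\<lambda>p. F p i)"
  shows "smooth_map M (sub_corner I K W) F"
proof -
  note X = sub_corner_manifold[OF I K W] and c0 = sub_corner_chart[OF I K W]
  have "continuous_map (mtop M) (mtop (sub_corner I K W)) F"
    unfolding sub_corner_simps
    by (rule continuous_map_into_coord_space[OF smooth_fun_continuous[OF M F] FW sub_corner_subset[OF I K W]])
  then show ?thesis
  proof (rule smooth_mapI[OF M X])
    fix p assume p: "p \<in> mcarrier M"
    then obtain c where c: "c \<in> matlas M" "p \<in> cdom c" using atlas_cover[OF M] by blast
    have "smooth_in c (\<lambda>q. F q j) p" if "j \<in> I" for j
      using F[OF that] c unfolding smooth_fun_iff[OF M] by blast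
    then show "\<exists>c\<in>charts M. \<exists>d\<in>charts (sub_corner I K W). p \<in> cdom c \<and> F p \<in> cdom d \<and>
        (\<forall>j\<in>cindex d. smooth_in c (\<lambda>q. cmap d (F q) j) p)"
      using c c0 atlas_subset_charts[OF M c(1)] FW[OF p]
      by (intro bexI[of _ c] bexI[of _ "(I, K, W, \<lambda>x. x)"]) auto
  qed
qed

lemma smooth_map_coord_smooth:
  assumes M: "manifold_with_corners M" and I: "finite I" and K: "K \<subseteq> I" and W: "openin (top_of_set (corner I K)) W"
    and F: "smooth_map M (sub_corner I K W) F" and i: "i \<in> I"
  shows "smooth_fun M (\<lambda>p. F p i)"
proof (rule smooth_funI[OF M])
  fix p assume p: "p \<in> mcarrier M"
  then obtain c where c: "c \<in> matlas M" "p \<in> cdom c" using atlas_cover[OF M] by blast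
  note cM = atlas_subset_charts[OF M c(1)]
  have cont: "continuous_map (mtop M) (mtop (sub_corner I K W)) F" using F by (simp add: smooth_map_def)
  then have "F p \<in> W" using p by (force simp: continuous_map_def)
  then have "smooth_in c (\<lambda>q. F q i) p"
    using smooth_mapD[OF M sub_corner_manifold[OF I K W] cont F cM c(2) sub_corner_chart[OF I K W]] i by simp
  then show "\<exists>c\<in>charts M. p \<in> cdom c \<and> smooth_in c (\<lambda>p. F p i) p" using cM c(2) by blast
qed

section \<open>Smooth functions of one real variable\<close>

text \<open>A whole sequence of successive derivatives is exhibited at once, so that an induction on
  the order of differentiation can pass from \<open>D n\<close> to \<open>D (Suc n)\<close>.\<close>

definition real_smooth :: "real set \<Rightarrow> (real \<Rightarrow> real) \<Rightarrow> bool" where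
  "real_smooth S g \<longleftrightarrow> (\<exists>D. D 0 = g \<and> (\<forall>n. \<forall>t\<in>S. (D n has_real_derivative D (Suc n) t) (at t)))"

lemma real_smooth_exp: "real_smooth UNIV exp"
  unfolding real_smooth_def by (intro exI[of _ "\<lambda>_. exp"]) (auto intro!: derivative_eq_intros)

text \<open>The formula is the \<open>n\<close>-th derivative of \<open>1 / t\<close>; shifted by
  one it also gives the derivatives of the logarithm.\<close>

lemma real_smooth_inverse_aux:
  assumes "t > 0"
  shows "((\<lambda>t. (-1) ^ n * fact n * inverse t ^ Suc n) has_real_derivative
     (-1) ^ Suc n * fact (Suc n) * inverse t ^ Suc (Suc n)) (at (t::real))"
proof -
  have "((\<lambda>t. inverse t ^ Suc n) has_real_derivative (1 + real n) * (- (inverse t ^ Suc (Suc 0)) * inverse t ^ n)) (at t)"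
    by (rule DERIV_power_Suc[OF DERIV_inverse]) (use assms in simp)
  from DERIV_cmult[OF this, of "(-1) ^ n * fact n"] show ?thesis
    by (simp add: algebra_simps)
qed

lemma real_smooth_inverse: "real_smooth {0<..} inverse"
  unfolding real_smooth_def using real_smooth_inverse_aux
  by (intro exI[of _ "\<lambda>n t. (-1) ^ n * fact n * inverse t ^ Suc n"]) auto

lemma real_smooth_ln: "real_smooth {0<..} ln"
proof -
  define D :: "nat \<Rightarrow> real \<Rightarrow> real" where "D n = (case n of 0 \<Rightarrow> ln | Suc n \<Rightarrow> \<lambda>t. (-1) ^ n * fact n * inverse t ^ Suc n)" for n :: nat
  have "(D n has_real_derivative D (Suc n) t) (at t)" if "t > 0" for n and t :: real
  proof (cases n)
    case 0
    then show ?thesis using that by (auto simp: D_def intro!: derivative_eq_intros simp: inverse_eq_divide)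
  next
    case (Suc m)
    then show ?thesis using real_smooth_inverse_aux[OF that, of m] by (simp only: D_def nat.case)
  qed
  then show ?thesis unfolding real_smooth_def by (intro exI[of _ D]) (auto simp: D_def)
qed

lemma real_smooth_uminus: "real_smooth UNIV uminus"
  unfolding real_smooth_def
  by (intro exI[of _ "\<lambda>n. if n = 0 then uminus else if n = 1 then (\<lambda>_. -1) else (\<lambda>_. 0)"])
    (auto intro!: derivative_eq_intros)

lemma smooth_at_real_compose:
  assumes g: "real_smooth S g" and S: "open S" and x: "x \<in> coord_space I" "x i \<in> S"
  shows "smooth_at I T (\<lambda>y. g (y i)) x"
proof -
  obtain D where D: "D 0 = g" "\<And>n t. t \<in> S \<Longrightarrow> (D n has_real_derivative D (Suc n) t) (at t)"
    using g unfolding real_smooth_def by blast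
  define U where "U = coord_space I \<inter> {y. y i \<in> S}"
  have "open {y :: 'a \<Rightarrow> real. y i \<in> S}"
    using open_vimage[OF S continuous_on_coord[of UNIV i]] by (simp add: vimage_def)
  then have U: "coord_open I U" unfolding U_def by blast
  have "Ck_on m I U (\<lambda>y. D n (y i))" for m n
  proof (induction m arbitrary: n)
    have "continuous_on S (D n)" for n
      using D(2) DERIV_isCont continuous_at_imp_continuous_on by blast
    then have c: "continuous_on U (\<lambda>y. D n (y i))" for n
      by (rule continuous_on_compose2[OF _ continuous_on_coord]) (auto simp: U_def)
    {
      case 0
      then show ?case using c by simp
    next
      case (Suc m)
      show ?case
      proof (rule Ck_on_SucI[OF U c])
        fix j
        show "Ck_on m I U (if j = i then (\<lambda>y. D (Suc n) (y i)) else (\<lambda>_. 0))"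
          using Suc.IH Ck_on_const[OF U] by auto
        fix x assume "x \<in> U"
        then have "x i \<in> S" by (simp add: U_def)
        then show "((\<lambda>t. D n ((x(j := t)) i)) has_real_derivative
            (if j = i then (\<lambda>y. D (Suc n) (y i)) else (\<lambda>_. 0)) x) (at (x j))"
          using D(2)[of "x i" n] by auto
      qed
    }
  qed
  from this[of _ 0] show ?thesis
    unfolding smooth_at_def using U x D(1) by (intro exI[of _ U] exI[of _ "\<lambda>y. g (y i)"]) (auto simp: U_def)
qed

text \<open>The real line is modelled as \<open>coord_space\<close> over the unit type, which makes
  this an instance of composition in several variables.\<close>

lemma smooth_in_real_compose:
  assumes c: "is_chart T n c" and p: "p \<in> cdom c" and g: "smooth_in c g p"
    and h: "real_smooth S h" and S: "open S" "g p \<in> S"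
  shows "smooth_in c (\<lambda>q. h (g q)) p"
proof -
  let ?S = "cmap c ` cdom c"
  let ?G = "\<lambda>y. \<lambda>_::unit. g (cinv c y)"
  have "smooth_at (cindex c) ?S (\<lambda>y. (\<lambda>z. h (z ())) (?G y)) (cmap c p)"
  proof (rule smooth_at_compose[where h = "\<lambda>z. h (z ())" and G = ?G and T = "coord_space {()}"])
    show "smooth_at {()} (coord_space {()}) (\<lambda>z. h (z ())) (?G (cmap c p))"
      using S cinv_cmap[OF c p] by (intro smooth_at_real_compose[OF h S(1)]) (auto simp: coord_space_def)
  qed (use cmap_coord[OF c p] g p in \<open>auto simp: smooth_in_def coord_space_def\<close>)
  then show ?thesis by (simp add: smooth_in_def)
qed

section \<open>Cells\<close>

locale cell_space =
  fixes N r :: nat and \<J> :: "nat set set"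
  assumes finite_J: "finite \<J>"
begin

definition ix :: "coord set" where "ix = Zc ` {..<N} \<union> Xc ` {1..r} \<union> Yc ` \<J>"
definition bd :: "coord set" where "bd = Xc ` {1..r}"
definition zeros :: "(coord \<Rightarrow> real) \<Rightarrow> nat set" where "zeros q = {h \<in> {1..r}. q (Xc h) = 0}"

text \<open>\<open>A\<close> collects the vanishing \<open>x_h\<close>, and \<open>m J\<close> is
  the integer nearest to \<open>y_J\<close>. The walls of \<open>J\<close> are present only where
  all \<open>x_j\<close> with \<open>j \<in> J\<close> vanish, whence the restriction to
  \<open>J \<subseteq> A\<close>.\<close>

definition cell :: "nat set \<Rightarrow> (nat set \<Rightarrow> int) \<Rightarrow> (coord \<Rightarrow> real) set" where
  "cell A m = {q \<in> coord_space ix. (\<forall>h\<in>A. q (Xc h) = 0) \<and> (\<forall>h\<in>{1..r} - A. 0 < q (Xc h)) \<and>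
     (\<forall>J\<in>\<J>. J \<subseteq> A \<longrightarrow> \<bar>q (Yc J) - of_int (m J)\<bar> < 1/2)}"

lemma finite_ix: "finite ix" and bd_ix: "bd \<subseteq> ix" and finite_bd: "finite bd"
  using finite_J by (auto simp: ix_def bd_def)

lemma mem_corner_iff: "q \<in> corner ix bd \<longleftrightarrow> q \<in> coord_space ix \<and> (\<forall>h\<in>{1..r}. 0 \<le> q (Xc h))"
  by (auto simp: corner_def bd_def)

lemma zeros_subset: "zeros q \<subseteq> {1..r}"
  by (auto simp: zeros_def)

lemma cell_zeros: "q \<in> cell A m \<Longrightarrow> A \<subseteq> {1..r} \<Longrightarrow> zeros q = A"
proof (intro equalityI subsetI)
  fix h assume "q \<in> cell A m" "A \<subseteq> {1..r}" "h \<in> zeros q"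
  then have "h \<in> {1..r}" "q (Xc h) = 0" "\<forall>h\<in>{1..r} - A. 0 < q (Xc h)"
    by (simp_all add: cell_def zeros_def)
  then show "h \<in> A" by force
qed (auto simp: cell_def zeros_def)

lemma cell_corner: "cell A m \<subseteq> corner ix bd"
proof
  fix q assume q: "q \<in> cell A m"
  have "0 \<le> q (Xc h)" if "h \<in> {1..r}" for h
    using q that by (cases "h \<in> A") (auto simp: cell_def intro: less_imp_le)
  then show "q \<in> corner ix bd" using q by (auto simp: mem_corner_iff cell_def)
qed

lemma cell_iff_zeros:
  assumes "q \<in> corner ix bd" "A \<subseteq> {1..r}"
  shows "q \<in> cell A m \<longleftrightarrow> zeros q = A \<and> (\<forall>J\<in>\<J>. J \<subseteq> A \<longrightarrow> \<bar>q (Yc J) - of_int (m J)\<bar> < 1/2)"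
proof
  assume "q \<in> cell A m"
  then show "zeros q = A \<and> (\<forall>J\<in>\<J>. J \<subseteq> A \<longrightarrow> \<bar>q (Yc J) - of_int (m J)\<bar> < 1/2)"
    using cell_zeros assms(2) by (auto simp: cell_def)
next
  assume "zeros q = A \<and> (\<forall>J\<in>\<J>. J \<subseteq> A \<longrightarrow> \<bar>q (Yc J) - of_int (m J)\<bar> < 1/2)"
  then show "q \<in> cell A m"
    using assms by (auto simp: cell_def zeros_def mem_corner_iff less_le)
qed

lemma cell_nonempty: "A \<subseteq> {1..r} \<Longrightarrow> cell A m \<noteq> {}"
proof -
  assume A: "A \<subseteq> {1..r}"
  define q where "q c = (case c of Zc _ \<Rightarrow> 0 | Xc h \<Rightarrow> if h \<in> {1..r} - A then 1 else 0
     | Yc J \<Rightarrow> if J \<in> \<J> then real_of_int (m J) else 0)" for c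
  have "q \<in> cell A m"
    using A by (auto simp: cell_def q_def coord_space_def ix_def split: coord.splits)
  then show ?thesis by blast
qed

lemma cell_connected: "connected (cell A m)"
proof -
  \<comment> \<open>The cell in the form of \<open>corner_box_segment\<close>, with the integers
    \<open>m J\<close> as the centres of the box.\<close>
  define S where "S = {x \<in> coord_space ix. (\<forall>c\<in>Yc ` {J\<in>\<J>. J \<subseteq> A}. \<bar>x c - (case c of Yc J \<Rightarrow> real_of_int (m J) | _ \<Rightarrow> 0)\<bar> < 1/2) \<and>
    (\<forall>i\<in>Xc ` A. x i = 0) \<and> (\<forall>i\<in>Xc ` ({1..r} - A). 0 < x i) \<and> (\<forall>i\<in>{}. 0 \<le> x i)}"
  have "connected S"
    by (intro connected_segment_closed corner_box_segment[OF _ _ _ _ S_def]; assumption)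
  moreover have "S = cell A m" by (auto simp: S_def cell_def)
  ultimately show ?thesis by simp
qed

lemma close_integers_eq: "\<bar>x - of_int a\<bar> < 1/2 \<Longrightarrow> \<bar>x - of_int b\<bar> < (1/2 :: real) \<Longrightarrow> a = b"
proof -
  assume "\<bar>x - of_int a\<bar> < 1/2" "\<bar>x - of_int b\<bar> < (1/2 :: real)"
  then have "\<bar>real_of_int (a - b)\<bar> < 1" unfolding of_int_diff by linarith
  then show ?thesis by linarith
qed

lemma cell_cong:
  assumes "\<And>J. J \<in> \<J> \<Longrightarrow> J \<subseteq> A \<Longrightarrow> m J = m' J"
  shows "cell A m = cell A m'"
  using assms by (auto simp: cell_def)

lemma cell_eqI:
  assumes "q \<in> cell A m" "q \<in> cell A' m'" "A \<subseteq> {1..r}" "A' \<subseteq> {1..r}"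
  shows "A = A'" "\<And>J. J \<in> \<J> \<Longrightarrow> J \<subseteq> A \<Longrightarrow> m J = m' J" "cell A m = cell A' m'"
proof -
  show A: "A = A'" using cell_zeros assms by metis
  show m: "m J = m' J" if "J \<in> \<J>" "J \<subseteq> A" for J
    using assms(1,2) that A close_integers_eq[of "q (Yc J)" "m J" "m' J"] by (auto simp: cell_def)
  show "cell A m = cell A' m'" using cell_cong[OF m] A by simp
qed

lemma zeros_depth: "card {i \<in> bd. q i = 0} = card (zeros q)"
proof -
  have "{i \<in> bd. q i = 0} = Xc ` zeros q" by (auto simp: bd_def zeros_def)
  then show ?thesis by (simp add: card_image inj_on_def)
qed

lemma open_coord_gt: "open {q :: coord \<Rightarrow> real. 0 < q c}"
  and open_coord_near: "open {q :: coord \<Rightarrow> real. \<bar>q c - a\<bar> < e}"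
  by (intro open_Collect_less continuous_intros continuous_on_coord)+

lemma closed_coord_zero: "closed {q :: coord \<Rightarrow> real. q c = 0}"
  by (intro closed_Collect_eq continuous_intros continuous_on_coord)

end

text \<open>\<open>P\<close> lists the cells: all of them for \<open>X_1\<close>, those realised by
  points of \<open>M\<close> for \<open>X_M\<close>. Depths and open faces are computed once for
  both.\<close>

locale cell_union = cell_space +
  fixes W :: "(coord \<Rightarrow> real) set" and P :: "(nat set \<times> (nat set \<Rightarrow> int)) set"
  assumes W: "openin (top_of_set (corner ix bd)) W"
    and W_cells: "W = (\<Union>(A, m)\<in>P. cell A m)"
    and P: "\<And>A m. (A, m) \<in> P \<Longrightarrow> A \<subseteq> {1..r}"
begin

abbreviation "X \<equiv> sub_corner ix bd W"

lemmas X_manifold = sub_corner_manifold[OF finite_ix bd_ix W]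
lemmas X_chart = sub_corner_chart[OF finite_ix bd_ix W]

lemma W_corner: "W \<subseteq> corner ix bd"
  using openin_imp_subset[OF W] .

lemma X_has_depth: "q \<in> W \<Longrightarrow> has_depth X q k \<longleftrightarrow> card (zeros q) = k"
  using sub_corner_has_depth[OF finite_ix bd_ix W] zeros_depth by simp

lemma cell_subset_W: "(A, m) \<in> P \<Longrightarrow> cell A m \<subseteq> W"
  unfolding W_cells by blast

text \<open>Among points of depth \<open>card A\<close>, positivity off \<open>A\<close> forces the
  zero set to be a subset of \<open>A\<close> of the same size. The equations \<open>x_h = 0\<close>
  thus follow from open conditions.\<close>

lemma cell_openin_depth:
  assumes Am: "(A, m) \<in> P" and k: "card A = k"
  shows "openin (subtopology (mtop X) {q \<in> mcarrier X. has_depth X q k}) (cell A m)"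
proof -
  define O1 where "O1 = (\<Inter>h\<in>{1..r} - A. {q :: coord \<Rightarrow> real. 0 < q (Xc h)})"
  define O2 where "O2 = (\<Inter>J\<in>{J\<in>\<J>. J \<subseteq> A}. {q :: coord \<Rightarrow> real. \<bar>q (Yc J) - of_int (m J)\<bar> < 1/2})"
  have "open O1"
    unfolding O1_def by (intro open_INT ballI open_coord_gt) simp
  moreover have "open O2"
    unfolding O2_def by (intro open_INT ballI open_coord_near) (simp add: finite_J)
  moreover have "cell A m = {q \<in> W. has_depth X q k} \<inter> (O1 \<inter> O2)"
  proof (intro equalityI subsetI)
    fix q assume q: "q \<in> cell A m"
    then have "q \<in> W" using cell_subset_W[OF Am] by blast
    then show "q \<in> {q \<in> W. has_depth X q k} \<inter> (O1 \<inter> O2)"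
      using q X_has_depth[of q k] cell_zeros[OF q P[OF Am]] k by (auto simp: cell_def O1_def O2_def)
  next
    fix q assume q: "q \<in> {q \<in> W. has_depth X q k} \<inter> (O1 \<inter> O2)"
    have "zeros q \<subseteq> A" using q by (force simp: zeros_def O1_def)
    moreover have "card (zeros q) = card A" using q X_has_depth k by auto
    moreover have "finite A" using P[OF Am] finite_subset by blast
    ultimately have "zeros q = A" by (simp add: card_subset_eq)
    then show "q \<in> cell A m"
      using q W_corner cell_iff_zeros[of q A m] P[OF Am] by (auto simp: O2_def)
  qed
  moreover have "subtopology (mtop X) {q \<in> mcarrier X. has_depth X q k} = top_of_set {q \<in> W. has_depth X q k}"
    by (simp add: subtopology_subtopology inf_absorb2)
  ultimately show ?thesis
    by (metis open_Int openin_open)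
qed

lemma open_faces_cells: "open_faces_of_codim X k = {cell A m | A m. (A, m) \<in> P \<and> card A = k}"
  unfolding open_faces_of_codim_def
proof (rule connected_components_of_eq_partition)
  let ?T = "subtopology (mtop X) {q \<in> mcarrier X. has_depth X q k}"
  have T: "?T = top_of_set {q \<in> W. has_depth X q k}"
    by (simp add: subtopology_subtopology inf_absorb2)
  have depth: "cell A m \<subseteq> {q \<in> W. has_depth X q k}" if "(A, m) \<in> P" "card A = k" for A m
    using openin_subset[OF cell_openin_depth[OF that]] by auto
  show "C \<noteq> {} \<and> connectedin ?T C \<and> openin ?T C" if C': "C \<in> {cell A m | A m. (A, m) \<in> P \<and> card A = k}" for C
  proof -
    obtain A m where C: "C = cell A m" "(A, m) \<in> P" "card A = k" using C' by blast
    have "connectedin ?T C"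
      unfolding T connectedin_subtopology C(1) using cell_connected depth[OF C(2,3)] by simp
    then show ?thesis using C cell_nonempty P cell_openin_depth by auto
  qed
  show "C = D" if C': "C \<in> {cell A m | A m. (A, m) \<in> P \<and> card A = k}" and D': "D \<in> {cell A m | A m. (A, m) \<in> P \<and> card A = k}"
    and CD: "C \<inter> D \<noteq> {}" for C D
  proof -
    obtain A m where C: "C = cell A m" "(A, m) \<in> P" using C' by blast
    obtain A' m' where D: "D = cell A' m'" "(A', m') \<in> P" using D' by blast
    obtain q where "q \<in> cell A m" "q \<in> cell A' m'" using C D CD by blast
    then show ?thesis using cell_eqI(3) P C D by metis
  qed
  show "\<Union>{cell A m | A m. (A, m) \<in> P \<and> card A = k} = topspace ?T"
  proof (intro equalityI subsetI)
    fix q assume "q \<in> topspace ?T"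
    then have q: "q \<in> W" "has_depth X q k" by (auto simp: T)
    then obtain A m where Am: "(A, m) \<in> P" "q \<in> cell A m" unfolding W_cells by blast
    then have "card A = k" using cell_zeros[OF Am(2) P[OF Am(1)]] X_has_depth q by simp
    then show "q \<in> \<Union>{cell A m | A m. (A, m) \<in> P \<and> card A = k}" using Am by blast
  qed (use depth in \<open>auto simp: T\<close>)
qed

text \<open>A single chart covers the open face, so smoothness into and out of it can be checked
  coordinatewise.\<close>

lemma cell_chart:
  assumes Am: "(A, m) \<in> P"
  shows "(ix - Xc ` A, {}, cell A m, \<lambda>x. x) \<in> charts (open_face_manifold X (card A) (cell A m))"
proof -
  have A: "Xc ` A \<subseteq> bd" using P[OF Am] by (auto simp: bd_def)
  let ?c = "(ix, Xc ` A, {x \<in> W. \<forall>i\<in>bd - Xc ` A. 0 < x i}, \<lambda>x :: coord \<Rightarrow> real. x)"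
  have "{x \<in> W. \<forall>i\<in>bd - Xc ` A. 0 < x i} \<inter> cell A m = cell A m"
    using cell_subset_W[OF Am] by (auto simp: cell_def bd_def)
  moreover have "card (cbound ?c) = card A" by (simp add: card_image inj_on_def)
  ultimately show ?thesis
    using open_face_chart[OF X_manifold cell_openin_depth[OF Am refl] sub_corner_face_chart[OF finite_ix bd_ix W A]]
    by simp
qed

end

section \<open>Cells are diffeomorphic to Euclidean spaces\<close>

lemma
  assumes c: "is_chart T n c" and p: "p \<in> cdom c" and g: "smooth_in c g p"
  shows smooth_in_ln: "0 < g p \<Longrightarrow> smooth_in c (\<lambda>q. ln (g q)) p"
    and smooth_in_inverse: "0 < g p \<Longrightarrow> smooth_in c (\<lambda>q. inverse (g q)) p"
    and smooth_in_exp: "smooth_in c (\<lambda>q. exp (g q)) p"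
    and smooth_in_uminus: "smooth_in c (\<lambda>q. - g q) p"
    and smooth_in_add_const: "smooth_in c (\<lambda>q. g q + a) p"
  using smooth_in_real_compose[OF c p g real_smooth_ln] smooth_in_real_compose[OF c p g real_smooth_inverse]
    smooth_in_real_compose[OF c p g real_smooth_exp] smooth_in_real_compose[OF c p g real_smooth_uminus]
    smooth_in_add[OF g smooth_in_const[OF c p]]
  by auto

text \<open>\<open>cell_fwd\<close> straightens the factors \<open>(0,\<infinity>)\<close> by the logarithm and the intervals
  \<open>(m\<^sub>J - 1/2, m\<^sub>J + 1/2)\<close> by the logit function.\<close>

definition cell_fwd :: "nat set \<Rightarrow> (nat set \<Rightarrow> int) \<Rightarrow> coord \<Rightarrow> real \<Rightarrow> real" where
  "cell_fwd A m c t = (case c of Zc _ \<Rightarrow> t | Xc _ \<Rightarrow> ln t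
     | Yc J \<Rightarrow> if J \<subseteq> A then ln (t + (1/2 - of_int (m J))) + - ln (- t + (1/2 + of_int (m J))) else t)"

text \<open>\<open>1 - inverse (exp s + 1)\<close> is the logistic function, the inverse of the
  logit; the shift moves the unit interval to the interval centred at \<open>m J\<close>. The sums
  are bracketed so that \<open>smooth_in_add_const\<close> applies.\<close>

definition cell_bwd :: "nat set \<Rightarrow> (nat set \<Rightarrow> int) \<Rightarrow> coord \<Rightarrow> real \<Rightarrow> real" where
  "cell_bwd A m c s = (case c of Zc _ \<Rightarrow> s | Xc _ \<Rightarrow> exp s
     | Yc J \<Rightarrow> if J \<subseteq> A then - inverse (exp s + 1) + (1/2 + of_int (m J)) else s)"

definition cell_range :: "nat set \<Rightarrow> (nat set \<Rightarrow> int) \<Rightarrow> coord \<Rightarrow> real set" where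
  "cell_range A m c = (case c of Zc _ \<Rightarrow> UNIV | Xc _ \<Rightarrow> {0<..}
     | Yc J \<Rightarrow> if J \<subseteq> A then {t. \<bar>t - of_int (m J)\<bar> < 1/2} else UNIV)"

lemma cell_bwd_range: "cell_bwd A m c s \<in> cell_range A m c"
proof -
  have "0 < inverse (exp s + 1)" "inverse (exp s + 1) < 1"
    by (simp_all add: add_pos_pos inverse_less_1_iff)
  then have "\<bar>- inverse (exp s + 1) + (1/2 + a) - a\<bar> < 1/2" for a
    by linarith
  then show ?thesis
    unfolding cell_bwd_def cell_range_def by (cases c) simp_all
qed

lemma cell_bwd_fwd:
  assumes "t \<in> cell_range A m c"
  shows "cell_bwd A m c (cell_fwd A m c t) = t"
proof -
  have "inverse (exp (ln (t + (1/2 - a)) + - ln (- t + (1/2 + a))) + 1) = 1/2 + a - t" if "\<bar>t - a\<bar> < 1/2" for a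
  proof -
    \<comment> \<open>\<open>u\<close> is the position of \<open>t\<close> within the interval
      rescaled to \<open>(0, 1)\<close>, in terms of which the logit is
      \<open>ln u - ln (1 - u)\<close>.\<close>
    define u where "u = t + (1/2 - a)"
    have u: "0 < u" "0 < 1 - u" using that unfolding u_def by linarith+
    have "exp (ln u + - ln (1 - u)) + 1 = u / (1 - u) + 1"
      using u by (simp add: exp_add exp_minus exp_diff)
    also have "\<dots> = 1 / (1 - u)" using u by (simp add: field_simps)
    finally have "inverse (exp (ln u + - ln (1 - u)) + 1) = 1 - u" by simp
    moreover have "t + (1/2 - a) = u" "- t + (1/2 + a) = 1 - u" "1/2 + a - t = 1 - u" by (simp_all add: u_def)
    ultimately show ?thesis by (simp only:)
  qed
  then show ?thesis
    using assms by (auto simp: cell_bwd_def cell_fwd_def cell_range_def split: coord.splits if_splits)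
qed

lemma cell_fwd_bwd: "cell_fwd A m c (cell_bwd A m c s) = s"
proof -
  have "ln (1 - inverse (exp s + 1)) - ln (inverse (exp s + 1)) = s"
  proof -
    have "exp s + 1 > 0" by (simp add: add_pos_pos)
    then have "1 - inverse (exp s + 1) = exp s / (exp s + 1)" by (simp add: field_simps)
    then show ?thesis using \<open>exp s + 1 > 0\<close> by (simp add: ln_div ln_inverse)
  qed
  then show ?thesis by (auto simp: cell_bwd_def cell_fwd_def split: coord.splits)
qed

lemma smooth_in_cell_fwd:
  assumes c: "is_chart T n c" "p \<in> cdom c" "smooth_in c g p" "g p \<in> cell_range A m x"
  shows "smooth_in c (\<lambda>q. cell_fwd A m x (g q)) p"
proof (cases x)
  case (Yc J)
  show ?thesis
  proof (cases "J \<subseteq> A")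
    case True
    then have "smooth_in c (\<lambda>q. ln (g q + (1/2 - of_int (m J))) + - ln (- g q + (1/2 + of_int (m J)))) p"
    proof -
      have "\<bar>g p - of_int (m J)\<bar> < 1/2" using c(4) Yc True unfolding cell_range_def by simp
      then have "0 < g p + (1/2 - of_int (m J))" "0 < - g p + (1/2 + of_int (m J))" by linarith+
      then show ?thesis
        by (intro smooth_in_add smooth_in_ln[OF c(1,2)] smooth_in_uminus[OF c(1,2)] smooth_in_add_const[OF c(1,2)] c(3))
    qed
    then show ?thesis using Yc True by (simp add: cell_fwd_def)
  qed (use c Yc in \<open>simp add: cell_fwd_def\<close>)
next
  case (Xc h)
  then show ?thesis using smooth_in_ln[OF c(1-3)] c(4) by (simp add: cell_fwd_def cell_range_def)
qed (use c in \<open>simp add: cell_fwd_def\<close>)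

lemma smooth_in_cell_bwd:
  assumes c: "is_chart T n c" "p \<in> cdom c" "smooth_in c g p"
  shows "smooth_in c (\<lambda>q. cell_bwd A m x (g q)) p"
proof (cases x)
  case (Yc J)
  show ?thesis
  proof (cases "J \<subseteq> A")
    case True
    have "smooth_in c (\<lambda>q. - inverse (exp (g q) + 1) + (1/2 + of_int (m J))) p"
      by (intro smooth_in_inverse[OF c(1,2)] smooth_in_uminus[OF c(1,2)] smooth_in_exp[OF c(1,2)]
          smooth_in_add_const[OF c(1,2)] c(3)) (simp add: add_pos_pos)
    then show ?thesis using Yc True by (simp add: cell_bwd_def)
  qed (use c Yc in \<open>simp add: cell_bwd_def\<close>)
next
  case (Xc h)
  then show ?thesis using smooth_in_exp[OF c(1-3)] by (simp add: cell_bwd_def)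
qed (use c in \<open>simp add: cell_bwd_def\<close>)

context cell_union
begin

lemma cell_iff_range:
  assumes "A \<subseteq> {1..r}"
  shows "q \<in> cell A m \<longleftrightarrow> q \<in> coord_space (ix - Xc ` A) \<and> (\<forall>c\<in>ix - Xc ` A. q c \<in> cell_range A m c)"
proof -
  have "(\<forall>c\<in>ix - Xc ` A. q c \<in> cell_range A m c) \<longleftrightarrow> (\<forall>h\<in>{1..r} - A. 0 < q (Xc h)) \<and>
     (\<forall>J\<in>\<J>. J \<subseteq> A \<longrightarrow> \<bar>q (Yc J) - of_int (m J)\<bar> < 1/2)"
  proof -
    have "ix - Xc ` A = Zc ` {..<N} \<union> Xc ` ({1..r} - A) \<union> Yc ` \<J>" by (auto simp: ix_def)
    then show ?thesis by (simp add: ball_Un cell_range_def)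
  qed
  moreover have "q \<in> coord_space (ix - Xc ` A) \<longleftrightarrow> q \<in> coord_space ix \<and> (\<forall>h\<in>A. q (Xc h) = 0)"
    using assms by (auto simp: coord_space_def ix_def)
  ultimately show ?thesis by (simp add: cell_def)
qed

text \<open>The free coordinates are enumerated by \<open>{..<n}\<close> and straightened
  separately. No coordinate is mixed with another, so smoothness and invertibility reduce to one
  variable.\<close>

lemma cell_diffeomorphic:
  assumes Am: "(A, m) \<in> P"
  shows "\<exists>n. diffeomorphic (open_face_manifold X (card A) (cell A m)) (euclidean_manifold n)"
proof -
  let ?F = "cell A m"
  let ?E = "open_face_manifold X (card A) ?F"
  let ?I = "ix - Xc ` A"
  note A = P[OF Am] and opn = cell_openin_depth[OF Am refl]
  note E = open_face_manifold_with_corners[OF X_manifold opn] and Etop = open_face_topspace[OF X_manifold opn]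
  note e0 = cell_chart[OF Am]
  note e0c = charts_is_chart[OF e0]
  define n where "n = card ?I"
  have fin: "finite ?I" using finite_ix by simp
  obtain b where b: "bij_betw b {..<n} ?I"
    using ex_bij_betw_nat_finite[OF fin] by (auto simp: n_def atLeast0LessThan)
  define d where "d = inv_into {..<n} b"
  have bd: "b k \<in> ?I" "d (b k) = k" if "k < n" for k
    using b that by (auto simp: d_def bij_betw_def)
  have db: "d c < n" "b (d c) = c" if "c \<in> ?I" for c
    using b that inv_into_into[of c b "{..<n}"] f_inv_into_f[of c b "{..<n}"] by (auto simp: d_def bij_betw_def)
  define F where "F q = (\<lambda>k. if k < n then cell_fwd A m (b k) (q (b k)) else 0)" for q
  define G where "G y = (\<lambda>c. if c \<in> ?I then cell_bwd A m c (y (d c)) else 0)" for y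
  have opnE: "openin (top_of_set (corner {..<n} {})) (corner {..<n} {} :: (nat \<Rightarrow> real) set)"
    by simp
  have R: "euclidean_manifold n = sub_corner {..<n} {} (corner {..<n} {})"
    by (rule model_manifold_eq)
  note RM = sub_corner_manifold[OF finite_lessThan empty_subsetI opnE]
    and Rc = sub_corner_chart[OF finite_lessThan empty_subsetI opnE]
  have GF: "G y \<in> ?F" for y
    using cell_bwd_range by (auto simp: cell_iff_range[OF A] G_def coord_space_def)
  have "smooth_map ?E (euclidean_manifold n) F"
    unfolding R
  proof (rule smooth_map_into_sub_corner[OF E _ _ opnE])
    show "F p \<in> corner {..<n} {}" for p by (auto simp: F_def coord_space_def)
    show "smooth_fun ?E (\<lambda>p. F p k)" if "k \<in> {..<n}" for k
    proof (rule smooth_funI[OF E])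
      fix p assume "p \<in> mcarrier ?E"
      then have p: "p \<in> ?F" using Etop by simp
      have "smooth_in (?I, {}, ?F, \<lambda>x. x) (\<lambda>q. cell_fwd A m (b k) (q (b k))) p"
        using p bd(1)[of k] that smooth_in_coord[OF e0c, of p "b k"]
        by (intro smooth_in_cell_fwd[OF e0c]) (auto simp: cell_iff_range[OF A])
      then show "\<exists>c\<in>charts ?E. p \<in> cdom c \<and> smooth_in c (\<lambda>p. F p k) p"
        using e0 p that by (intro bexI[OF _ e0]) (simp add: F_def)
    qed
  qed auto
  moreover have "smooth_map (euclidean_manifold n) ?E G"
  proof -
    have s: "smooth_in ({..<n}, {}, corner {..<n} {}, \<lambda>x. x) (\<lambda>y. G y c) p" if "p \<in> corner {..<n} {}" for p c
    proof (cases "c \<in> ?I")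
      case True
      then show ?thesis
        using smooth_in_cell_bwd[OF charts_is_chart[OF Rc], of p "\<lambda>y. y (d c)" A m c]
          smooth_in_coord[OF charts_is_chart[OF Rc], of p "d c"] that by (simp add: G_def)
    next
      case False
      then show ?thesis
        using smooth_in_const[OF charts_is_chart[OF Rc], of p 0] that by (simp only: G_def if_False) simp
    qed
    have "continuous_map (top_of_set (corner {..<n} {})) (top_of_set ?F) G"
    proof (rule continuous_map_into_coord_space[where I = ix])
      show "continuous_map (top_of_set (corner {..<n} {})) euclideanreal (\<lambda>p. G p c)" for c
        using smooth_fun_continuous[OF RM smooth_funI[OF RM]] s Rc by force
      show "?F \<subseteq> coord_space ix" by (auto simp: cell_def)
    qed (use GF in auto)
    moreover have "mtop ?E = top_of_set ?F"
      using cell_subset_W[OF Am] by (simp add: open_face_manifold_def subtopology_subtopology inf_absorb2)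
    ultimately have cont: "continuous_map (mtop (sub_corner {..<n} {} (corner {..<n} {}))) (mtop ?E) G"
      by simp
    show ?thesis unfolding R
    proof (rule smooth_mapI[OF RM E cont])
      fix p :: "nat \<Rightarrow> real" assume p: "p \<in> mcarrier (sub_corner {..<n} {} (corner {..<n} {}))"
      then show "\<exists>c\<in>charts (sub_corner {..<n} {} (corner {..<n} {})). \<exists>d\<in>charts ?E. p \<in> cdom c \<and> G p \<in> cdom d \<and>
         (\<forall>j\<in>cindex d. smooth_in c (\<lambda>q. cmap d (G q) j) p)"
        using s GF by (intro bexI[OF _ Rc] bexI[OF _ e0]) auto
    qed
  qed
  moreover have "G (F q) = q" if "q \<in> ?F" for q
  proof
    fix c show "G (F q) c = q c"
    proof (cases "c \<in> ?I")
      case True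
      then have "q c \<in> cell_range A m c" using that by (simp add: cell_iff_range[OF A])
      then show ?thesis using True db[OF True] by (simp add: G_def F_def cell_bwd_fwd)
    next
      case False
      then show ?thesis using that by (auto simp: G_def cell_iff_range[OF A] coord_space_def)
    qed
  qed
  moreover have "F (G y) = y" if "y \<in> coord_space {..<n}" for y
  proof
    fix k show "F (G y) k = y k"
      using that bd[of k] by (cases "k < n") (auto simp: F_def G_def cell_fwd_bwd coord_space_def)
  qed
  moreover have "mcarrier (euclidean_manifold n) = coord_space {..<n}"
    unfolding R by simp
  ultimately show ?thesis
    unfolding diffeomorphic_def using Etop by blast
qed

end

section \<open>The classifying space\<close>

locale classifying_data = separated_boundary_data M r H \<rho> f
  for M :: "('a, 'i) manifold" and r H \<rho> f +
  fixes N :: nat and \<phi> :: "'a \<Rightarrow> nat \<Rightarrow> real"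
  assumes compact: "compact_space (mtop M)"
    and embedding: "smooth_embedding M (euclidean_manifold N) \<phi>"
begin

sublocale cell_space N r "face_indices r H"
  by unfold_locales (rule finite_indices)

definition \<Psi> :: "'a \<Rightarrow> coord \<Rightarrow> real" where "\<Psi> = Psi r \<phi> \<rho> \<J> f"

text \<open>For an index \<open>J \<subseteq> inc p\<close> the value \<open>f J p\<close> is
  already an integer, and the floor merely changes its type.\<close>

definition level :: "'a \<Rightarrow> nat set \<Rightarrow> int" where "level p J = \<lfloor>f J p\<rfloor>"

text \<open>For an index \<open>J\<close>, a point \<open>q\<close> of the corner lies in
  \<open>Y_J\<close> precisely if \<open>J \<subseteq> zeros q\<close> and its coordinate
  \<open>y_J\<close> is a half-integer.\<close>

definition carrier1 :: "(coord \<Rightarrow> real) set" where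
  "carrier1 = {q \<in> corner ix bd. \<forall>J\<in>\<J>. J \<subseteq> zeros q \<longrightarrow> q (Yc J) - 1/2 \<notin> \<int>}"

text \<open>The surviving points, described by a witness \<open>p\<close> in \<open>M\<close> that
  may be deeper than \<open>q\<close>. Near \<open>q\<close> the zero set can only shrink, so the
  inclusion \<open>zeros q \<subseteq> inc p\<close> persists and the set is open in the
  corner.\<close>

definition carrierM :: "(coord \<Rightarrow> real) set" where
  "carrierM = {q \<in> corner ix bd. \<exists>p\<in>mcarrier M. zeros q \<subseteq> inc p \<and> (\<forall>J\<in>\<J>. J \<subseteq> zeros q \<longrightarrow> \<bar>q (Yc J) - f J p\<bar> < 1/2)}"

lemma level_eq: "J \<in> \<J> \<Longrightarrow> p \<in> mcarrier M \<Longrightarrow> J \<subseteq> inc p \<Longrightarrow> real_of_int (level p J) = f J p"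
  using separating_integer by (fastforce simp: level_def)

lemma near_floor_of_not_half:
  fixes x :: real
  assumes "x - 1/2 \<notin> \<int>"
  shows "\<bar>x - of_int \<lfloor>x + 1/2\<rfloor>\<bar> < 1/2"
proof -
  have "x - 1/2 \<noteq> of_int (\<lfloor>x + 1/2\<rfloor> - 1)" using assms Ints_of_int by metis
  moreover have "of_int \<lfloor>x + 1/2\<rfloor> \<le> x + 1/2" "x + 1/2 < of_int \<lfloor>x + 1/2\<rfloor> + 1" by linarith+
  ultimately show ?thesis unfolding of_int_diff of_int_1 by linarith
qed

lemma near_integer_not_half:
  fixes x :: real
  assumes "\<bar>x - of_int m\<bar> < 1/2"
  shows "x - 1/2 \<notin> \<int>"
proof
  assume "x - 1/2 \<in> \<int>"
  then obtain k where k: "x - 1/2 = of_int k" by (auto elim: Ints_cases)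
  then have "\<bar>real_of_int (k - m) + 1/2\<bar> < 1/2" using assms unfolding of_int_diff by linarith
  then have "real_of_int (k - m) < real_of_int 0" "real_of_int (- 1) < real_of_int (k - m)"
    unfolding of_int_0 of_int_minus of_int_1 by linarith+
  then show False unfolding of_int_less_iff by linarith
qed

sublocale A1: cell_union N r "face_indices r H" carrier1 "{(A, m). A \<subseteq> {1..r}}"
proof
  have "closed {q :: coord \<Rightarrow> real. q (Yc J) - 1/2 \<in> \<int> \<and> (\<forall>j\<in>J. q (Xc j) = 0)}" for J
  proof -
    have "closed {q :: coord \<Rightarrow> real. q (Yc J) - 1/2 \<in> \<int>}"
    proof -
      have "closed ((\<lambda>q :: coord \<Rightarrow> real. q (Yc J) - 1/2) -` \<int>)"
        by (intro closed_vimage closed_Ints continuous_intros continuous_on_coord)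
      then show ?thesis by (simp add: vimage_def)
    qed
    then have "closed ({q. q (Yc J) - 1/2 \<in> \<int>} \<inter> (\<Inter>j\<in>J. {q :: coord \<Rightarrow> real. q (Xc j) = 0}))"
      by (intro closed_Int closed_INT ballI closed_coord_zero)
    moreover have "{q :: coord \<Rightarrow> real. q (Yc J) - 1/2 \<in> \<int> \<and> (\<forall>j\<in>J. q (Xc j) = 0)} =
        {q. q (Yc J) - 1/2 \<in> \<int>} \<inter> (\<Inter>j\<in>J. {q. q (Xc j) = 0})" by auto
    ultimately show ?thesis by (simp only:)
  qed
  then have "open (- (\<Union>J\<in>\<J>. {q :: coord \<Rightarrow> real. q (Yc J) - 1/2 \<in> \<int> \<and> (\<forall>j\<in>J. q (Xc j) = 0)}))"
    using finite_indices by (intro open_Compl closed_UN) auto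
  moreover have "carrier1 = corner ix bd \<inter> - (\<Union>J\<in>\<J>. {q. q (Yc J) - 1/2 \<in> \<int> \<and> (\<forall>j\<in>J. q (Xc j) = 0)})"
    using index_subset by (fastforce simp: carrier1_def zeros_def)
  ultimately show "openin (top_of_set (corner ix bd)) carrier1"
    by (simp only: openin_open_Int)
  show "carrier1 = (\<Union>(A, m)\<in>{(A, m). A \<subseteq> {1..r}}. cell A m)"
  proof (intro equalityI subsetI)
    fix q assume q: "q \<in> carrier1"
    have "q \<in> cell (zeros q) (\<lambda>J. \<lfloor>q (Yc J) + 1/2\<rfloor>)"
      using q near_floor_of_not_half cell_iff_zeros[of q "zeros q"] zeros_subset by (auto simp: carrier1_def)
    then show "q \<in> (\<Union>(A, m)\<in>{(A, m). A \<subseteq> {1..r}}. cell A m)" using zeros_subset by blast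
  next
    fix q assume "q \<in> (\<Union>(A, m)\<in>{(A, m). A \<subseteq> {1..r}}. cell A m)"
    then obtain A m where A: "A \<subseteq> {1..r}" "q \<in> cell A m" by blast
    then have "q \<in> corner ix bd" using cell_corner by blast
    moreover have "q (Yc J) - 1/2 \<notin> \<int>" if "J \<in> \<J>" "J \<subseteq> zeros q" for J
      using that A(2) cell_zeros[OF A(2,1)] near_integer_not_half[of "q (Yc J)" "m J"] by (simp add: cell_def)
    ultimately show "q \<in> carrier1" by (simp add: carrier1_def)
  qed
qed auto

sublocale U: cell_union N r "face_indices r H" carrierM "(\<lambda>p. (inc p, level p)) ` mcarrier M"
proof
  \<comment> \<open>Open conditions that force \<open>zeros q \<subseteq> A\<close> for points of
    the corner; letting \<open>A\<close> range over the subsets of \<open>inc p\<close> describes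
    \<open>carrierM\<close>.\<close>
  define Q where "Q p A = (\<Inter>h\<in>{1..r} - A. {q :: coord \<Rightarrow> real. 0 < q (Xc h)}) \<inter>
    (\<Inter>J\<in>{J\<in>\<J>. J \<subseteq> A}. {q :: coord \<Rightarrow> real. \<bar>q (Yc J) - f J p\<bar> < 1/2})" for p A
  have Qo: "open (Q p A)" for p A
    unfolding Q_def by (intro open_Int open_INT ballI open_coord_gt open_coord_near) (simp_all add: finite_indices)
  have "carrierM = corner ix bd \<inter> (\<Union>p\<in>mcarrier M. \<Union>A\<in>{A. A \<subseteq> inc p}. Q p A)"
  proof (intro equalityI subsetI)
    fix q assume q: "q \<in> carrierM"
    then obtain p where p: "q \<in> corner ix bd" "p \<in> mcarrier M" "zeros q \<subseteq> inc p" "\<forall>J\<in>\<J>. J \<subseteq> zeros q \<longrightarrow> \<bar>q (Yc J) - f J p\<bar> < 1/2"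
      unfolding carrierM_def by blast
    have "q \<in> Q p (zeros q)"
      using p unfolding Q_def by (auto simp: mem_corner_iff zeros_def less_le)
    then show "q \<in> corner ix bd \<inter> (\<Union>p\<in>mcarrier M. \<Union>A\<in>{A. A \<subseteq> inc p}. Q p A)"
      using p by blast
  next
    fix q assume "q \<in> corner ix bd \<inter> (\<Union>p\<in>mcarrier M. \<Union>A\<in>{A. A \<subseteq> inc p}. Q p A)"
    then obtain p A where p: "q \<in> corner ix bd" "p \<in> mcarrier M" "A \<subseteq> inc p" "q \<in> Q p A" by blast
    have "0 < q (Xc h)" if "h \<in> {1..r} - A" for h using p(4) that unfolding Q_def by blast
    then have "zeros q \<subseteq> A" by (force simp: zeros_def)
    then have "zeros q \<subseteq> inc p" "\<forall>J\<in>\<J>. J \<subseteq> zeros q \<longrightarrow> \<bar>q (Yc J) - f J p\<bar> < 1/2"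
      using p(3,4) unfolding Q_def by blast+
    then show "q \<in> carrierM" unfolding carrierM_def using p by blast
  qed
  moreover have "open (\<Union>p\<in>mcarrier M. \<Union>A\<in>{A. A \<subseteq> inc p}. Q p A)" using Qo by (intro open_UN ballI)
  ultimately show "openin (top_of_set (corner ix bd)) carrierM"
    by (simp only: openin_open_Int)
  show "carrierM = (\<Union>(A, m)\<in>(\<lambda>p. (inc p, level p)) ` mcarrier M. cell A m)"
  proof (intro equalityI subsetI)
    fix q assume q: "q \<in> carrierM"
    then obtain p where p: "q \<in> corner ix bd" "p \<in> mcarrier M" "zeros q \<subseteq> inc p" "\<forall>J\<in>\<J>. J \<subseteq> zeros q \<longrightarrow> \<bar>q (Yc J) - f J p\<bar> < 1/2"
      unfolding carrierM_def by blast
    \<comment> \<open>The witness is replaced by a point incident to exactly \<open>zeros q\<close>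
      with the same levels; its cell contains \<open>q\<close>.\<close>
    obtain p' where p': "p' \<in> mcarrier M" "inc p' = zeros q" "\<forall>J\<in>\<J>. J \<subseteq> zeros q \<longrightarrow> f J p' = f J p"
      using incident_shrink[OF p(2,3)] by blast
    have "q \<in> cell (inc p') (level p')"
      using cell_iff_zeros[OF p(1) zeros_subset] p' p(4) level_eq[OF _ p'(1)] by simp
    then show "q \<in> (\<Union>(A, m)\<in>(\<lambda>p. (inc p, level p)) ` mcarrier M. cell A m)" using p'(1) by blast
  next
    fix q assume "q \<in> (\<Union>(A, m)\<in>(\<lambda>p. (inc p, level p)) ` mcarrier M. cell A m)"
    then obtain p where p: "p \<in> mcarrier M" "q \<in> cell (inc p) (level p)" by blast
    have z: "zeros q = inc p" using cell_zeros[OF p(2) incident_subset] .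
    then have "\<forall>J\<in>\<J>. J \<subseteq> zeros q \<longrightarrow> \<bar>q (Yc J) - f J p\<bar> < 1/2"
      using p(2) level_eq[OF _ p(1)] unfolding cell_def by auto
    then show "q \<in> carrierM" unfolding carrierM_def using p cell_corner z by blast
  qed
next
  fix A m assume "(A, m) \<in> (\<lambda>p. (inc p, level p)) ` mcarrier M"
  then obtain p where "A = inc p" by blast
  then show "A \<subseteq> {1..r}" by (simp only: incident_subset)
qed

section \<open>The map \<Psi> and the faces that survive\<close>

lemma \<Psi>_simps:
  "\<Psi> p (Zc i) = \<phi> p i" "h \<in> {1..r} \<Longrightarrow> \<Psi> p (Xc h) = \<rho> h p" "J \<in> \<J> \<Longrightarrow> \<Psi> p (Yc J) = f J p"
  by (simp_all add: \<Psi>_def Psi_def)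

lemma \<phi>_smooth_map: "smooth_map M (sub_corner {..<N} {} (corner {..<N} {})) \<phi>"
  using embedding by (simp add: smooth_embedding_def immersion_def model_manifold_eq)

lemma \<phi>_coord: "p \<in> mcarrier M \<Longrightarrow> \<phi> p \<in> coord_space {..<N}"
  using \<phi>_smooth_map by (force simp: smooth_map_def continuous_map_def)

lemma \<Psi>_corner:
  assumes p: "p \<in> mcarrier M"
  shows "\<Psi> p \<in> corner ix bd"
proof -
  have "\<Psi> p c = 0" if "c \<notin> ix" for c
    using that coord_space_zero[OF \<phi>_coord[OF p]]
    by (cases c) (auto simp: \<Psi>_def Psi_def ix_def)
  then show ?thesis using defining_nonneg[OF _ p] by (auto simp: mem_corner_iff coord_space_def \<Psi>_simps)
qed

lemma zeros_\<Psi>: "p \<in> mcarrier M \<Longrightarrow> zeros (\<Psi> p) = inc p"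
  using defining_zero by (auto simp: zeros_def incident_def \<Psi>_simps)

text \<open>On the indices concerned \<open>f J p\<close> and \<open>f J p'\<close> are both
  integers, so being less than 1/2 apart means being equal.\<close>

lemma \<Psi>_cell_iff:
  assumes "p \<in> mcarrier M" "p' \<in> mcarrier M"
  shows "\<Psi> p \<in> cell (inc p') (level p') \<longleftrightarrow> p \<in> stratum p'"
proof -
  have "\<bar>f J p - real_of_int (level p' J)\<bar> < 1/2 \<longleftrightarrow> f J p = f J p'" if "J \<in> \<J>" "J \<subseteq> inc p'" "inc p = inc p'" for J
    using level_eq[OF that(1) assms(1)] level_eq[OF that(1) assms(2)] that
      close_integers_eq[of "f J p" "level p' J" "level p J"] by auto
  then have "inc p = inc p' \<and> (\<forall>J\<in>\<J>. J \<subseteq> inc p' \<longrightarrow> \<bar>\<Psi> p (Yc J) - real_of_int (level p' J)\<bar> < 1/2)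
      \<longleftrightarrow> inc p = inc p' \<and> (\<forall>J\<in>\<J>. J \<subseteq> inc p' \<longrightarrow> f J p = f J p')"
    by (metis \<Psi>_simps(3))
  moreover have "inc p' \<subseteq> {1..r}" by (rule incident_subset)
  ultimately show ?thesis
    using cell_iff_zeros[OF \<Psi>_corner[OF assms(1)], of "inc p'" "level p'"] zeros_\<Psi>[OF assms(1)] assms(1)
    unfolding stratum_def by simp
qed

lemma \<Psi>_carrierM: "p \<in> mcarrier M \<Longrightarrow> \<Psi> p \<in> carrierM"
  using \<Psi>_corner zeros_\<Psi> by (auto simp: carrierM_def \<Psi>_simps)

lemma carrierM_carrier1: "carrierM \<subseteq> carrier1"
proof
  fix q assume "q \<in> carrierM"
  then obtain p where "p \<in> mcarrier M" and q: "q \<in> cell (inc p) (level p)"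
    unfolding U.W_cells by blast
  have "inc p \<subseteq> {1..r}" by (rule incident_subset)
  then show "q \<in> carrier1"
    using A1.cell_subset_W[of "inc p" "level p"] q by auto
qed

text \<open>Passing to the closure lets further \<open>x_h\<close> vanish but cannot relax the
  bounds on \<open>y_J\<close>: where one becomes an equality, \<open>y_J\<close> is a half-integer
  and the point is missing from \<open>carrier1\<close>.\<close>

lemma closure_cell:
  assumes A: "A \<subseteq> {1..r}"
  shows "top_of_set carrier1 closure_of cell A m =
    {q \<in> carrier1. A \<subseteq> zeros q \<and> (\<forall>J\<in>\<J>. J \<subseteq> A \<longrightarrow> \<bar>q (Yc J) - of_int (m J)\<bar> < 1/2)}"
proof (intro equalityI subsetI)
  define T where "T = (\<Inter>h\<in>A. {q :: coord \<Rightarrow> real. q (Xc h) = 0}) \<inter>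
    (\<Inter>J\<in>{J\<in>\<J>. J \<subseteq> A}. {q :: coord \<Rightarrow> real. \<bar>q (Yc J) - of_int (m J)\<bar> \<le> 1/2})"
  have "closed {q :: coord \<Rightarrow> real. \<bar>q (Yc J) - of_int (m J)\<bar> \<le> 1/2}" for J
    by (intro closed_Collect_le continuous_intros continuous_on_coord)
  then have T: "closed T" unfolding T_def by (intro closed_Int closed_INT ballI closed_coord_zero)
  have sub: "cell A m \<subseteq> carrier1" using A1.cell_subset_W A by auto
  have "cell A m \<subseteq> carrier1 \<inter> T"
    using sub by (fastforce simp: T_def cell_def intro: less_imp_le)
  moreover have "closedin (top_of_set carrier1) (carrier1 \<inter> T)" using T by (rule closedin_closed_Int)
  ultimately have min: "top_of_set carrier1 closure_of cell A m \<subseteq> carrier1 \<inter> T"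
    by (rule closure_of_minimal)
  fix q assume "q \<in> top_of_set carrier1 closure_of cell A m"
  then have q: "q \<in> carrier1" "q \<in> T" using min by auto
  have Aq: "A \<subseteq> zeros q" using q(2) A by (auto simp: T_def zeros_def)
  have "\<bar>q (Yc J) - of_int (m J)\<bar> < 1/2" if J: "J \<in> \<J>" "J \<subseteq> A" for J
  proof -
    have "q (Yc J) - 1/2 \<notin> \<int>" using q(1) J Aq by (auto simp: carrier1_def)
    then have "q (Yc J) - 1/2 \<noteq> of_int (m J)" "q (Yc J) - 1/2 \<noteq> of_int (m J - 1)"
      using Ints_of_int by metis+
    moreover have "\<bar>q (Yc J) - of_int (m J)\<bar> \<le> 1/2" using q(2) J unfolding T_def by blast
    ultimately show ?thesis unfolding of_int_diff of_int_1 by linarith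
  qed
  then show "q \<in> {q \<in> carrier1. A \<subseteq> zeros q \<and> (\<forall>J\<in>\<J>. J \<subseteq> A \<longrightarrow> \<bar>q (Yc J) - of_int (m J)\<bar> < 1/2)}"
    using q(1) Aq by blast
next
  fix q assume "q \<in> {q \<in> carrier1. A \<subseteq> zeros q \<and> (\<forall>J\<in>\<J>. J \<subseteq> A \<longrightarrow> \<bar>q (Yc J) - of_int (m J)\<bar> < 1/2)}"
  then have q: "q \<in> carrier1" "A \<subseteq> zeros q" "\<forall>J\<in>\<J>. J \<subseteq> A \<longrightarrow> \<bar>q (Yc J) - of_int (m J)\<bar> < 1/2" by auto
  have qc: "q \<in> corner ix bd" using q(1) by (simp add: carrier1_def)
  have "\<exists>y. y \<in> cell A m \<and> y \<in> Q" if Q: "q \<in> Q \<and> openin (top_of_set carrier1) Q" for Q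
  proof -
    have "carrier1 \<subseteq> coord_space ix" by (auto simp: carrier1_def mem_corner_iff)
    then obtain e where e: "e > 0" "\<And>y. y \<in> carrier1 \<Longrightarrow> \<forall>i\<in>ix. \<bar>y i - q i\<bar> < e \<Longrightarrow> y \<in> Q"
      using openin_contains_coord_box[of carrier1 Q ix q] Q by blast
    \<comment> \<open>A nearby point of the open cell: every \<open>x_h\<close> with
      \<open>h\<close> outside \<open>A\<close> is increased, which makes it positive even if it
      vanishes at \<open>q\<close>.\<close>
    define y where "y c = (if c \<in> Xc ` ({1..r} - A) then q c + e / 2 else q c)" for c
    have "y i = 0" if "i \<notin> ix" for i
    proof -
      have "i \<notin> Xc ` ({1..r} - A)" using that by (auto simp: ix_def)
      then show ?thesis using that qc by (simp add: y_def mem_corner_iff coord_space_def)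
    qed
    then have "y \<in> coord_space ix" by (simp add: coord_space_def)
    moreover have "y (Xc h) = 0" if "h \<in> A" for h
      using that q(2) by (auto simp: y_def zeros_def)
    moreover have "0 < y (Xc h)" if "h \<in> {1..r} - A" for h
      using that qc e(1) by (auto simp: y_def mem_corner_iff intro: add_nonneg_pos)
    moreover have "y (Yc J) = q (Yc J)" for J by (auto simp: y_def)
    ultimately have y: "y \<in> cell A m" using q(3) by (simp add: cell_def)
    then have "y \<in> carrier1" using A1.cell_subset_W A by auto
    then have "y \<in> Q" using e(1) by (intro e(2)) (auto simp: y_def)
    then show ?thesis using y by blast
  qed
  then show "q \<in> top_of_set carrier1 closure_of cell A m"
    using q(1) by (simp add: in_closure_of)
qed

lemma X1_eq: "X1 N r \<J> = sub_corner ix bd carrier1"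
proof -
  have X0: "X0 N r \<J> = sub_corner ix bd (corner ix bd)"
    by (simp add: X0_def model_manifold_eq ix_def bd_def)
  have "corner ix bd \<inter> (corner ix bd - (\<Union>J\<in>\<J>. Y_set N r \<J> J)) = carrier1"
    using index_subset unfolding Y_set_def X0 by (fastforce simp: carrier1_def zeros_def)
  then show ?thesis unfolding X1_def X0 submanifold_sub_corner by (simp add: sub_corner_simps)
qed

lemma faces_X1: "faces (X1 N r \<J>) = {top_of_set carrier1 closure_of cell A m | A m. A \<subseteq> {1..r}}"
  unfolding faces_def open_faces_def X1_eq A1.open_faces_cells by auto

text \<open>A face through a surviving \<open>q\<close> comes from a cell with
  \<open>A \<subseteq> zeros q\<close>, whose integers agree with the levels of a witness
  \<open>p\<close>, so it contains the image of \<open>p\<close>. Conversely, if the face belonging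
  to the cell of \<open>q\<close> meets \<open>M\<close>, any common point is a witness for
  \<open>q\<close>.\<close>

lemma XM_eq: "XM N r \<J> (\<Psi> ` mcarrier M) = sub_corner ix bd carrierM"
proof -
  have "carrier1 \<inter> (carrier1 - \<Union>{F \<in> faces (X1 N r \<J>). F \<inter> \<Psi> ` mcarrier M = {}}) = carrierM"
  proof (intro equalityI subsetI)
    fix q assume q: "q \<in> carrierM"
    then obtain p where p: "q \<in> corner ix bd" "p \<in> mcarrier M" "zeros q \<subseteq> inc p" "\<forall>J\<in>\<J>. J \<subseteq> zeros q \<longrightarrow> \<bar>q (Yc J) - f J p\<bar> < 1/2"
      unfolding carrierM_def by blast
    have "F \<inter> \<Psi> ` mcarrier M \<noteq> {}" if F: "F \<in> faces (X1 N r \<J>)" "q \<in> F" for F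
    proof -
      obtain A m where A: "A \<subseteq> {1..r}" "F = top_of_set carrier1 closure_of cell A m"
        using F(1) unfolding faces_X1 by blast
      have Aq: "A \<subseteq> zeros q" "\<forall>J\<in>\<J>. J \<subseteq> A \<longrightarrow> \<bar>q (Yc J) - of_int (m J)\<bar> < 1/2"
        using F(2) unfolding A(2) closure_cell[OF A(1)] by auto
      have "\<bar>f J p - of_int (m J)\<bar> < 1/2" if J: "J \<in> \<J>" "J \<subseteq> A" for J
      proof -
        have "\<bar>q (Yc J) - of_int (level p J)\<bar> < 1/2"
          using p J Aq(1) level_eq[OF J(1) p(2)] by auto
        then have "m J = level p J" using close_integers_eq[of "q (Yc J)"] Aq(2) J by blast
        then show ?thesis using level_eq[OF J(1) p(2)] J Aq(1) p(3) by auto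
      qed
      then have "\<Psi> p \<in> F"
        unfolding A(2) closure_cell[OF A(1)]
        using \<Psi>_carrierM[OF p(2)] carrierM_carrier1 zeros_\<Psi>[OF p(2)] Aq(1) p(3) by (auto simp: \<Psi>_simps)
      then show ?thesis using p(2) by blast
    qed
    then show "q \<in> carrier1 \<inter> (carrier1 - \<Union>{F \<in> faces (X1 N r \<J>). F \<inter> \<Psi> ` mcarrier M = {}})"
      using q carrierM_carrier1 by blast
  next
    fix q assume q: "q \<in> carrier1 \<inter> (carrier1 - \<Union>{F \<in> faces (X1 N r \<J>). F \<inter> \<Psi> ` mcarrier M = {}})"
    define m where "m J = \<lfloor>q (Yc J) + 1/2\<rfloor>" for J
    have m: "\<bar>q (Yc J) - of_int (m J)\<bar> < 1/2" if "J \<in> \<J>" "J \<subseteq> zeros q" for J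
      using q that near_floor_of_not_half by (auto simp: carrier1_def m_def)
    let ?F = "top_of_set carrier1 closure_of cell (zeros q) m"
    have "?F \<in> faces (X1 N r \<J>)" unfolding faces_X1 using zeros_subset by blast
    moreover have "q \<in> ?F" unfolding closure_cell[OF zeros_subset] using q m by simp
    ultimately obtain p where p: "p \<in> mcarrier M" "\<Psi> p \<in> ?F" using q by blast
    then have z: "zeros q \<subseteq> inc p" "\<And>J. J \<in> \<J> \<Longrightarrow> J \<subseteq> zeros q \<Longrightarrow> \<bar>f J p - of_int (m J)\<bar> < 1/2"
      unfolding closure_cell[OF zeros_subset] using zeros_\<Psi>[OF p(1)] by (auto simp: \<Psi>_simps)
    have "\<bar>q (Yc J) - f J p\<bar> < 1/2" if J: "J \<in> \<J>" "J \<subseteq> zeros q" for J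
    proof -
      have Jp: "real_of_int (level p J) = f J p" using level_eq[OF J(1) p(1)] J z(1) by blast
      have "level p J = m J" using close_integers_eq[of "f J p" "level p J" "m J"] z(2)[OF J] Jp by simp
      then show ?thesis using m[OF J] Jp by simp
    qed
    then show "q \<in> carrierM" unfolding carrierM_def using q p(1) z(1) by (auto simp: carrier1_def)
  qed
  then show ?thesis
    unfolding XM_def by (simp add: X1_eq submanifold_sub_corner del: Int_Diff)
qed

lemma open_faces_X: "open_faces_of_codim U.X k = {cell (inc p) (level p) | p. p \<in> mcarrier M \<and> card (inc p) = k}"
  unfolding U.open_faces_cells by auto

lemma \<Psi>_smooth: "smooth_map M U.X \<Psi>"
proof (rule smooth_map_into_sub_corner[OF M finite_ix bd_ix U.W])
  show "\<Psi> p \<in> carrierM" if "p \<in> mcarrier M" for p using \<Psi>_carrierM that .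
  fix c assume "c \<in> ix"
  then show "smooth_fun M (\<lambda>p. \<Psi> p c)"
    using smooth_map_coord_smooth[OF M finite_lessThan empty_subsetI _ \<phi>_smooth_map] defining_smooth f_smooth
    by (auto simp: ix_def \<Psi>_simps)
qed

lemma \<Psi>_continuous: "continuous_map (mtop M) (mtop U.X) \<Psi>"
  using \<Psi>_smooth by (simp add: smooth_map_def)

text \<open>Openness of a stratum among the points of its depth is pulled back through
  \<open>\<Psi>\<close> from the openness of the corresponding cell.\<close>

lemma open_faces_M: "open_faces_of_codim M k = {stratum p | p. p \<in> mcarrier M \<and> card (inc p) = k}"
  unfolding open_faces_of_codim_def
proof (rule connected_components_of_eq_partition)
  let ?D = "{p \<in> mcarrier M. has_depth M p k}"
  let ?DX = "{q \<in> mcarrier U.X. has_depth U.X q k}"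
  have depth: "stratum p \<subseteq> ?D" if "card (inc p) = k" for p
    using that has_depth_incident by (auto simp: stratum_def)
  show "C \<noteq> {} \<and> connectedin (subtopology (mtop M) ?D) C \<and> openin (subtopology (mtop M) ?D) C"
    if C': "C \<in> {stratum p | p. p \<in> mcarrier M \<and> card (inc p) = k}" for C
  proof -
    obtain p where p: "C = stratum p" "p \<in> mcarrier M" "card (inc p) = k" using C' by blast
    obtain Q where Q: "openin (mtop U.X) Q" "cell (inc p) (level p) = Q \<inter> ?DX"
      using U.cell_openin_depth[OF imageI[OF p(2)] p(3)] by (auto simp: openin_subtopology)
    have "stratum p = {q \<in> mcarrier M. \<Psi> q \<in> Q} \<inter> ?D"
    proof (intro equalityI subsetI)
      fix q assume q: "q \<in> stratum p"
      then have "q \<in> mcarrier M" by (simp add: stratum_def)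
      then show "q \<in> {q \<in> mcarrier M. \<Psi> q \<in> Q} \<inter> ?D"
        using \<Psi>_cell_iff[OF _ p(2)] q depth[OF p(3)] Q(2) by blast
    next
      fix q assume q: "q \<in> {q \<in> mcarrier M. \<Psi> q \<in> Q} \<inter> ?D"
      then have "\<Psi> q \<in> ?DX"
        using \<Psi>_carrierM[of q] U.X_has_depth[of "\<Psi> q" k] zeros_\<Psi>[of q] has_depth_incident[of q k] by simp
      then have "\<Psi> q \<in> cell (inc p) (level p)" using q Q(2) by blast
      then show "q \<in> stratum p" using \<Psi>_cell_iff[OF _ p(2)] q by blast
    qed
    moreover have "openin (mtop M) {q \<in> mcarrier M. \<Psi> q \<in> Q}"
      using openin_continuous_map_preimage[OF \<Psi>_continuous Q(1)] .
    ultimately have "openin (subtopology (mtop M) ?D) (stratum p)"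
      unfolding openin_subtopology by blast
    moreover have "connectedin (subtopology (mtop M) ?D) (stratum p)"
      using stratum_connected[OF p(2)] depth[OF p(3)] by (simp add: connectedin_subtopology)
    ultimately show ?thesis using stratum_self[OF p(2)] p(1) by blast
  qed
  show "C = D" if "C \<in> {stratum p | p. p \<in> mcarrier M \<and> card (inc p) = k}"
    "D \<in> {stratum p | p. p \<in> mcarrier M \<and> card (inc p) = k}" "C \<inter> D \<noteq> {}" for C D
    using that by (auto simp: stratum_def)
  show "\<Union>{stratum p | p. p \<in> mcarrier M \<and> card (inc p) = k} = topspace (subtopology (mtop M) ?D)"
  proof (intro equalityI subsetI)
    fix p assume "p \<in> topspace (subtopology (mtop M) ?D)"
    then have p: "p \<in> mcarrier M" "has_depth M p k" by auto
    then have "card (inc p) = k" using has_depth_incident by blast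
    then show "p \<in> \<Union>{stratum p | p. p \<in> mcarrier M \<and> card (inc p) = k}" using p(1) stratum_self by blast
  qed (use depth in auto)
qed

lemma open_faces_bij: "bij_betw (\<lambda>F. {p \<in> mcarrier M. \<Psi> p \<in> F}) (open_faces U.X) (open_faces M)"
proof -
  have X: "open_faces U.X = (\<lambda>p. cell (inc p) (level p)) ` mcarrier M"
    unfolding open_faces_def open_faces_X by auto
  have MM: "open_faces M = stratum ` mcarrier M"
    unfolding open_faces_def open_faces_M by auto
  have eq: "{q \<in> mcarrier M. \<Psi> q \<in> cell (inc p) (level p)} = stratum p" if "p \<in> mcarrier M" for p
    using \<Psi>_cell_iff[OF _ that] by (auto simp: stratum_def)
  \<comment> \<open>\<open>\<Psi> p\<close> lies in both cells, and distinct cells are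
    disjoint.\<close>
  have inj: "cell (inc p) (level p) = cell (inc p') (level p')"
    if "p \<in> mcarrier M" "p' \<in> mcarrier M" "stratum p = stratum p'" for p p'
  proof -
    have "\<Psi> p \<in> cell (inc p) (level p)" "\<Psi> p \<in> cell (inc p') (level p')"
      using \<Psi>_cell_iff[OF that(1)] stratum_self[OF that(1)] that by auto
    then show ?thesis by (rule cell_eqI(3)[OF _ _ incident_subset incident_subset])
  qed
  have "inj_on (\<lambda>F. {p \<in> mcarrier M. \<Psi> p \<in> F}) (open_faces U.X)"
  proof (rule inj_onI)
    fix F F' assume "F \<in> open_faces U.X" "F' \<in> open_faces U.X"
    then obtain p p' where p: "p \<in> mcarrier M" "F = cell (inc p) (level p)"
      and p': "p' \<in> mcarrier M" "F' = cell (inc p') (level p')" unfolding X by blast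
    assume "{q \<in> mcarrier M. \<Psi> q \<in> F} = {q \<in> mcarrier M. \<Psi> q \<in> F'}"
    then have "stratum p = stratum p'" unfolding p(2) p'(2) by (simp only: eq[OF p(1)] eq[OF p'(1)])
    then show "F = F'" unfolding p(2) p'(2) by (rule inj[OF p(1) p'(1)])
  qed
  moreover have "(\<lambda>F. {p \<in> mcarrier M. \<Psi> p \<in> F}) ` open_faces U.X = open_faces M"
    unfolding X MM image_image by (rule image_cong) (simp_all add: eq)
  ultimately show ?thesis by (simp add: bij_betw_def)
qed

section \<open>The inclusion as a closed embedding\<close>

lemma \<Psi>_immersion: "immersion M U.X \<Psi>"
  unfolding immersion_def
proof (intro conjI \<Psi>_smooth ballI inj_onI)
  let ?R = "sub_corner {..<N} {} (corner {..<N} {}) :: (nat \<Rightarrow> real, nat) manifold"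
  let ?e = "({..<N}, {}, corner {..<N} {}, \<lambda>x. x) :: (nat \<Rightarrow> real, nat) chart"
  let ?c = "(ix, bd, carrierM, \<lambda>x. x) :: (coord \<Rightarrow> real, coord) chart"
  fix p v v' assume p: "p \<in> mcarrier M" and v: "v \<in> tangent_space M p" "v' \<in> tangent_space M p"
    and eq: "map_differential M U.X \<Psi> p v = map_differential M U.X \<Psi> p v'"
  have opnE: "openin (top_of_set (corner {..<N} {})) (corner {..<N} {} :: (nat \<Rightarrow> real) set)" by simp
  note RM = sub_corner_manifold[OF finite_lessThan empty_subsetI opnE]
  have cont: "continuous_map (mtop M) (mtop ?R) \<phi>" using \<phi>_smooth_map by (simp add: smooth_map_def)
  have e: "?e \<in> charts_at ?R (\<phi> p)"
    using sub_corner_chart[OF finite_lessThan empty_subsetI opnE] \<phi>_coord[OF p] by (simp add: charts_at_iff)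
  have c: "?c \<in> charts_at U.X (\<Psi> p)"
    using U.X_chart \<Psi>_carrierM[OF p] by (simp add: charts_at_iff)
  \<comment> \<open>The \<open>Zc\<close> components of the differential of \<open>\<Psi>\<close>
    are those of the differential of \<open>\<phi>\<close>, which is injective.\<close>
  have *: "fun_differential M (\<lambda>q. \<phi> q i) p v = fun_differential M (\<lambda>q. \<phi> q i) p v'" if "i < N" for i
  proof -
    have "Zc i \<in> ix" using that by (simp add: ix_def)
    then have "map_differential M U.X \<Psi> p v ?c (Zc i) = fun_differential M (\<lambda>q. \<phi> q i) p v" for v
      using c by (simp add: map_differential_def \<Psi>_simps)
    then show ?thesis using eq by metis
  qed
  have "map_differential M ?R \<phi> p v ?e = map_differential M ?R \<phi> p v' ?e"
    using * by (auto simp: map_differential_def)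
  then have "map_differential M ?R \<phi> p v = map_differential M ?R \<phi> p v'"
    by (rule tangent_eqI[OF RM map_differential_tangent[OF M RM cont \<phi>_smooth_map p v(1)]
          map_differential_tangent[OF M RM cont \<phi>_smooth_map p v(2)] e])
  moreover have "inj_on (map_differential M ?R \<phi> p) (tangent_space M p)"
    using embedding p by (simp add: smooth_embedding_def immersion_def model_manifold_eq)
  ultimately show "v = v'" using v by (auto dest: inj_onD)
qed

lemma \<Psi>_inj: "inj_on \<Psi> (mcarrier M)"
proof (rule inj_onI)
  fix p q assume pq: "p \<in> mcarrier M" "q \<in> mcarrier M" "\<Psi> p = \<Psi> q"
  have "\<phi> p = \<phi> q" using fun_cong[OF pq(3), of "Zc _"] by (auto simp: \<Psi>_simps)
  moreover have "inj_on \<phi> (mcarrier M)"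
    using embedding homeomorphic_imp_injective_map
    unfolding smooth_embedding_def embedding_map_def by blast
  ultimately show "p = q" using pq by (auto dest: inj_onD)
qed

lemma \<Psi>_closed: "closedin (mtop U.X) (\<Psi> ` mcarrier M)"
proof (rule compactin_imp_closedin)
  show "Hausdorff_space (mtop U.X)" using U.X_manifold by (simp add: manifold_with_corners_def)
  have "compactin (mtop M) (mcarrier M)" using compact by (simp add: compact_space_def)
  then show "compactin (mtop U.X) (\<Psi> ` mcarrier M)" using image_compactin \<Psi>_continuous by blast
qed

text \<open>The tangent space of the open face contains every coordinate direction except the
  \<open>x_h\<close> with \<open>h \<in> A\<close>. These remaining components can be prescribed by
  vectors of \<open>M\<close>, because the differentials of the \<open>\<rho> h\<close> are
  independent.\<close>

lemma \<Psi>_transverse: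
  assumes F: "F \<in> open_faces_of_codim U.X k"
  shows "transverse_to_face M U.X \<Psi> k F"
  unfolding transverse_to_face_def
proof (intro ballI impI)
  fix p assume p: "p \<in> mcarrier M" and pF: "\<Psi> p \<in> F"
  obtain p0 where p0: "p0 \<in> mcarrier M" "card (inc p0) = k" "F = cell (inc p0) (level p0)"
    using F unfolding open_faces_X by blast
  have "p \<in> stratum p0" using \<Psi>_cell_iff[OF p p0(1)] pF p0(3) by blast
  then have inc: "inc p = inc p0" by (simp add: stratum_def)
  let ?A = "inc p0"
  let ?E = "open_face_manifold U.X k F"
  let ?c = "(ix, bd, carrierM, \<lambda>x. x) :: (coord \<Rightarrow> real, coord) chart"
  let ?e = "(ix - Xc ` ?A, {}, F, \<lambda>x. x) :: (coord \<Rightarrow> real, coord) chart"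
  have Am: "(inc p0, level p0) \<in> (\<lambda>p. (inc p, level p)) ` mcarrier M" using p0(1) by blast
  have opn: "openin (subtopology (mtop U.X) {q \<in> mcarrier U.X. has_depth U.X q k}) F"
    using U.cell_openin_depth[OF Am p0(2)] p0(3) by simp
  note E = open_face_manifold_with_corners[OF U.X_manifold opn] and Etop = open_face_topspace[OF U.X_manifold opn]
    and Econt = open_face_inclusion_continuous[OF U.X_manifold opn] and Esm = open_face_inclusion_smooth[OF U.X_manifold opn]
  have eE: "?e \<in> charts ?E" using U.cell_chart[OF Am] p0 by simp
  then have e: "?e \<in> charts_at ?E (\<Psi> p)" using pF by (simp add: charts_at_iff)
  have c: "?c \<in> charts_at U.X (\<Psi> p)"
    using U.X_chart \<Psi>_carrierM[OF p] by (simp add: charts_at_iff)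
  have pE: "\<Psi> p \<in> mcarrier ?E" using Etop pF by simp
  note d\<Psi> = map_differential_tangent[OF M U.X_manifold \<Psi>_continuous \<Psi>_smooth p]
  note d\<iota> = map_differential_tangent[OF E U.X_manifold Econt Esm pE]
  show "{\<lambda>c j. map_differential M U.X \<Psi> p v c j + map_differential ?E U.X (\<lambda>q. q) (\<Psi> p) u c j | v u.
           v \<in> tangent_space M p \<and> u \<in> tangent_space ?E (\<Psi> p)} = tangent_space U.X (\<Psi> p)"
  proof (intro equalityI subsetI)
    fix w assume w: "w \<in> tangent_space U.X (\<Psi> p)"
    obtain v where v: "v \<in> tangent_space M p" "\<forall>h\<in>inc p. fun_differential M (\<rho> h) p v = w ?c (Xc h)"
      using defining_functions_independent[OF p, of "\<lambda>h. w ?c (Xc h)"] by blast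
    \<comment> \<open>What is left of \<open>w\<close> after subtracting the image of
      \<open>v\<close>. The \<open>x_h\<close> components with \<open>h \<in> A\<close> cancel by
      the choice of \<open>v\<close>, so the rest is tangent to the face.\<close>
    define z where "z j = (if j \<in> ix - Xc ` ?A then w ?c j - map_differential M U.X \<Psi> p v ?c j else 0)" for j
    have "z \<in> coord_space (cindex ?e)" by (simp add: z_def coord_space_def)
    then obtain u where u: "u \<in> tangent_space ?E (\<Psi> p)" "u ?e = z"
      using tangent_exists[OF E e] by blast
    let ?s = "\<lambda>c j. map_differential M U.X \<Psi> p v c j + map_differential ?E U.X (\<lambda>q. q) (\<Psi> p) u c j"
    have s: "?s \<in> tangent_space U.X (\<Psi> p)"
      by (rule tangent_add[OF U.X_manifold d\<Psi>[OF v(1)] d\<iota>[OF u(1)]])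
    have "w ?c = ?s ?c"
    proof
      fix j show "w ?c j = ?s ?c j"
      proof (cases "j \<in> ix")
        case j: True
        have "map_differential ?E U.X (\<lambda>q. q) (\<Psi> p) u ?c j =
            (\<Sum>i\<in>cindex ?e. u ?e i * chart_partial ?e i (\<lambda>q. cmap ?c q j) (\<Psi> p))"
          by (rule map_differential_eq[where f = "\<lambda>q. q", OF E U.X_manifold Econt Esm u(1) e c]) (simp add: j)
        also have "\<dots> = (\<Sum>i\<in>cindex ?e. z i * (if i = j then 1 else 0))"
          using chart_partial_coord[OF charts_is_chart[OF eE], of "\<Psi> p" _ j] pF
          by (intro sum.cong) (simp_all add: u(2))
        also have "\<dots> = z j"
          using finite_ix by (simp add: if_distrib z_def cong: if_cong)
        finally have \<iota>: "map_differential ?E U.X (\<lambda>q. q) (\<Psi> p) u ?c j = z j" .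
        show ?thesis
        proof (cases "j \<in> Xc ` ?A")
          case True
          then obtain h where h: "h \<in> inc p" "j = Xc h" using inc by auto
          have "h \<in> {1..r}" by (rule subsetD[OF incident_subset h(1)])
          then have "map_differential M U.X \<Psi> p v ?c j = fun_differential M (\<rho> h) p v"
            using c j h(2) by (simp add: map_differential_def \<Psi>_simps)
          then show ?thesis using \<iota> v(2) h True by (simp add: z_def)
        next
          case False
          then show ?thesis using \<iota> j by (simp add: z_def)
        qed
      next
        case False
        then show ?thesis
          using tangent_coord[OF U.X_manifold w c] tangent_coord[OF U.X_manifold s c]
          by (simp add: coord_space_def)
      qed
    qed
    then have "w = ?s" by (rule tangent_eqI[OF U.X_manifold w s c])
    then show "w \<in> {\<lambda>c j. map_differential M U.X \<Psi> p v c j + map_differential ?E U.X (\<lambda>q. q) (\<Psi> p) u c j | v u.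
           v \<in> tangent_space M p \<and> u \<in> tangent_space ?E (\<Psi> p)}" using v(1) u(1) by blast
  qed (use tangent_add[OF U.X_manifold d\<Psi> d\<iota>] in blast)
qed

text \<open>The closure of the cell lies in \<open>x_h = 0\<close>, and \<open>\<rho> h\<close>
  vanishes on \<open>H'\<close> only, so its preimage is contained in \<open>H'\<close>; density of
  the stratum in \<open>H'\<close> gives the other inclusion. As the closure of a connected stratum,
  \<open>H'\<close> is its own single component.\<close>

lemma hyperface_component:
  assumes "H' \<in> hyperfaces M"
  shows "\<exists>H''\<in>hyperfaces U.X. H' \<in> connected_components_of (subtopology (mtop M) {p \<in> mcarrier M. \<Psi> p \<in> H''})"
proof -
  obtain G where G: "G \<in> open_faces_of_codim M 1" "H' = mtop M closure_of G"
    using assms by (auto simp: hyperfaces_def)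
  obtain h where h: "h \<in> {1..r}" "H h = H'" using hyperface_index[OF G(1)] G(2) by auto
  obtain p where p: "G = stratum p" "p \<in> mcarrier M" "card (inc p) = 1"
    using G(1) unfolding open_faces_M by blast
  have GM: "G \<subseteq> mcarrier M" using p(1) by (auto simp: stratum_def)
  have sub: "G \<subseteq> H'" unfolding G(2) by (rule closure_of_subset[OF GM])
  then have "h \<in> inc p" using h stratum_self[OF p(2)] p(1) by (auto simp: incident_def)
  \<comment> \<open>Depth one leaves \<open>h\<close> as the only incident hyperface, so the cell
    lies in \<open>x_h = 0\<close>.\<close>
  then have inc: "inc p = {h}" using p(3) by (auto simp: card_1_singleton_iff)
  let ?F = "cell (inc p) (level p)"
  let ?H = "mtop U.X closure_of ?F"
  have FX: "?F \<in> open_faces_of_codim U.X 1" unfolding open_faces_X using p by blast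
  then have HX: "?H \<in> hyperfaces U.X" by (auto simp: hyperfaces_def)
  have "{q \<in> mcarrier M. \<Psi> q \<in> ?H} = H'"
  proof (intro equalityI subsetI)
    fix q assume q: "q \<in> H'"
    have "\<Psi> q \<in> mtop U.X closure_of (\<Psi> ` G)"
      using continuous_map_image_closure_subset[OF \<Psi>_continuous, of G] q G(2) by blast
    moreover have "\<Psi> ` G \<subseteq> ?F"
      using \<Psi>_cell_iff[OF _ p(2)] p(1) GM by blast
    ultimately have "\<Psi> q \<in> ?H" using closure_of_mono by blast
    moreover have "q \<in> mcarrier M" using q hyperface_subset[OF h(1)] h(2) by blast
    ultimately show "q \<in> {q \<in> mcarrier M. \<Psi> q \<in> ?H}" by blast
  next
    fix q assume q: "q \<in> {q \<in> mcarrier M. \<Psi> q \<in> ?H}"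
    have "?F \<subseteq> carrierM \<inter> {q. q (Xc h) = 0}"
      using U.cell_subset_W[OF imageI[OF p(2)]] inc by (auto simp: cell_def)
    moreover have "closedin (mtop U.X) (carrierM \<inter> {q. q (Xc h) = 0})"
      using closedin_closed_Int[OF closed_coord_zero] by simp
    ultimately have "?H \<subseteq> carrierM \<inter> {q. q (Xc h) = 0}" by (rule closure_of_minimal)
    then have "\<rho> h q = 0" using q \<Psi>_simps(2)[OF h(1)] by auto
    then show "q \<in> H'" using defining_zero[OF h(1)] q h(2) by blast
  qed
  moreover have "connected_components_of (subtopology (mtop M) H') = {H'}"
  proof (rule connected_components_of_eq_partition)
    have H'M: "H' \<subseteq> mcarrier M" using hyperface_subset[OF h(1)] h(2) by blast
    then have top: "topspace (subtopology (mtop M) H') = H'" by auto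
    show "\<Union>{H'} = topspace (subtopology (mtop M) H')" using top by simp
    have "connectedin (mtop M) H'"
      unfolding G(2) p(1) by (rule connectedin_closure_of[OF stratum_connected[OF p(2)]])
    moreover have "H' \<noteq> {}" using sub p stratum_self by blast
    ultimately show "P \<noteq> {} \<and> connectedin (subtopology (mtop M) H') P \<and> openin (subtopology (mtop M) H') P"
      if "P \<in> {H'}" for P
      using that openin_topspace[of "subtopology (mtop M) H'"] top by (simp add: connectedin_subtopology)
  qed auto
  ultimately show ?thesis using HX by (intro bexI[of _ ?H]) auto
qed

lemma classifying: "manifold_with_corners U.X \<and> classifying_space M U.X \<Psi>"
  unfolding classifying_space_def closed_embedding_def
proof (intro conjI allI ballI)
  show "manifold_with_corners U.X" by (rule U.X_manifold)
  fix k F assume F: "F \<in> open_faces_of_codim U.X k"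
  show "transverse_to_face M U.X \<Psi> k F" by (rule \<Psi>_transverse[OF F])
  obtain p where "p \<in> mcarrier M" "card (inc p) = k" "F = cell (inc p) (level p)"
    using F unfolding open_faces_X by blast
  then show "\<exists>n. diffeomorphic (open_face_manifold U.X k F) (euclidean_manifold n)"
    using U.cell_diffeomorphic[of "inc p" "level p"] by blast
qed (use \<Psi>_immersion \<Psi>_inj \<Psi>_closed hyperface_component open_faces_bij in auto)

end

theorem proposition7:
  fixes M :: "('a, 'i) manifold"
    and r N :: nat
    and H :: "nat \<Rightarrow> 'a set"
    and \<rho> :: "nat \<Rightarrow> 'a \<Rightarrow> real"
    and \<phi> :: "'a \<Rightarrow> nat \<Rightarrow> real"
    and f :: "nat set \<Rightarrow> 'a \<Rightarrow> real"
    and \<J> :: "nat set set"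
    and \<Psi> :: "'a \<Rightarrow> coord \<Rightarrow> real"
    and X :: "(coord \<Rightarrow> real, coord) manifold"
  assumes "manifold_with_corners M"
    and "compact_space (mtop M)"
    and "connected_space (mtop M)"
    and "has_embedded_faces M"
    and "bij_betw H {1..r} (hyperfaces M)"
    and "\<And>i. i \<in> {1..r} \<Longrightarrow> defining_function M (H i) (\<rho> i)"
    and "smooth_embedding M (euclidean_manifold N) \<phi>"
    and "\<J> = face_indices r H"
    and "\<And>J. J \<in> \<J> \<Longrightarrow> separates_components M (\<Inter>j\<in>J. H j) (f J)"
    and "\<And>J. J \<in> \<J> \<Longrightarrow> smooth_fun M (f J)"
    and "\<Psi> = Psi r \<phi> \<rho> \<J> f"
    and "X = XM N r \<J> (\<Psi> ` mcarrier M)"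
  shows "manifold_with_corners X \<and> classifying_space M X \<Psi>"
proof -
  interpret C: classifying_data M r H \<rho> f N \<phi>
    using assms by unfold_locales auto
  have "\<Psi> = C.\<Psi>" using assms by (simp add: C.\<Psi>_def)
  moreover have "X = C.U.X" using assms C.XM_eq by (simp add: C.\<Psi>_def)
  ultimately show ?thesis using C.classifying by simp
qed

end
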